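(* Let $n\ge 2$ and $\mu>0$, and let $\mathbf{X}(t)=(\mathbf{W}(t),\mathbf{S}(t))$, $t\ge 0$, be the Moran Genealogy Process of size $n$ with event rate $\mu$, with state space $\mathcal{X}^n=\mathcal{W}^n\times\mathbb{R}_+^{n-1}$. Then $\mathbf{X}$ has a unique invariant probability measure, namely \[ \pi_n(d\mathbf{w}\,d\mathbf{s}) = \left(\frac{\mu}{\binom{n}{2}}\right)^{n-1}\exp\left(-\sum_{j=1}^{n-1}\frac{\binom{j+1}{2}}{\binom{n}{2}}\,\mu\,\mathbf{s}_j\right)d\mathbf{w}\,d\mathbf{s}, \] where $d\mathbf{w}$ is counting measure on $\mathcal{W}^n$ and $d\mathbf{s}$ is Lebesgue measure on $\mathbb{R}_+^{n-1}$. Moreover, $\mathbf{X}$ is uniformly and exponentially ergodic: there are constants $D<\infty$ and $0\le\rho<1$ such that $\|\nu K^t-\pi_n\|_{\mathrm{TV}}<D\rho^t$ for all $t\ge 0$ and all probability measures $\nu$ on $\mathcal{X}^n$.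
   Context: A population of constant size $n$ evolves in continuous time: Moran events occur at the times of a Poisson process of rate $\mu$; at each event an ordered pair $(u,v)$ of distinct living individuals is chosen uniformly at random, $u$ dies and $v$ gives birth, the newborn taking over the label $u$. The state at time $t$ is the genealogy of the $n$ living individuals (leaves labelled $1,\dots,n$). $\mathcal{W}^n$ is the finite set of ranked leaf-labelled rooted binary tree topologies on leaves $\{1,\dots,n\}$, i.e. binary trees with $n-1$ internal nodes totally ordered in time (rank $1$ = root, each internal node ranked after its parent); $|\mathcal{W}^n|=n!(n-1)!/2^{n-1}$. $\mathbf{W}(t)\in\mathcal{W}^n$ is the ranked topology of the genealogy at time $t$. If $T_1\le\dots\le T_{n-1}$ are the times of the internal nodes (most recent common ancestors) at time $t$, then $\mathbf{S}(t)=(\mathbf{s}_1,\dots,\mathbf{s}_{n-1})$ with $\mathbf{s}_m=T_{m+1}-T_m$ for $m<n-1$ and $\mathbf{s}_{n-1}=t-T_{n-1}$ (coalescent intervals). At a Moran event with pair $(u,v)$, leaf $u$ and its parent node are removed (the sibling subtree of $u$ being reattached to the parent of the removed node), and a new internal node of latest rank, at the current time, is inserted on the lineage of $v$ with children $u$ and $v$; between events the last interval $\mathbf{s}_{n-1}$ grows linearly. $\mathbf{X}$ is a càdlàg continuous-time Markov process. $K^t$ is its transition semigroup, $(\nu K^t)(E)=\int\nu(d\mathbf{x})P^t(\mathbf{x},E)$ with $P^t(\mathbf{x},E)=\Pr(\mathbf{X}(t)\in E\mid\mathbf{X}(0)=\mathbf{x})$, and $\|\mu\|_{\mathrm{TV}}=\sup_{|f|\le1}|\mu(f)|$.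 *)

theory Defs
  imports "HOL-Probability.Probability"
begin

text \<open>A ranked tree topology on leaves 1..n is encoded by its chain of clade
partitions: B m (for m = 0..n-1) is the set of leaf-sets (clades) of the m+1
lineages alive between the internal node of rank m and the one of rank m+1
(B 0 = the single clade of the root lineage, B (n-1) = singletons).
Passing from B m to B (m+1) splits exactly one block into two nonempty
blocks: this split is the internal node of rank m+1. Values beyond n-1 are
fixed to the empty set so that the encoding is unique.\<close>

definition split_step :: "'a set set \<Rightarrow> 'a set set \<Rightarrow> bool" where
  "split_step P Q \<longleftrightarrow> (\<exists>b\<in>P. \<exists>b1 b2. b1 \<noteq> {} \<and> b2 \<noteq> {} \<and> b1 \<inter> b2 = {} \<and>
      b1 \<union> b2 = b \<and> Q = insert b1 (insert b2 (P - {b})))"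

definition ranked_trees :: "nat \<Rightarrow> (nat \<Rightarrow> nat set set) set" where
  "ranked_trees n = {B. B 0 = {{1..n}} \<and> (\<forall>m. Suc m < n \<longrightarrow> split_step (B m) (B (Suc m)))
                       \<and> (\<forall>m\<ge>n. B m = {})}"

text \<open>A state is (W, S) with S the coalescent intervals s_1..s_(n-1) (an
extensional function on {1..<n}).\<close>

definition state_space :: "nat \<Rightarrow> ((nat \<Rightarrow> nat set set) \<times> (nat \<Rightarrow> real)) measure" where
  "state_space n = count_space (ranked_trees n) \<Otimes>\<^sub>M
                   (\<Pi>\<^sub>M i\<in>{1..<n}. restrict_space lborel {0..})"

definition del_leaf :: "nat \<Rightarrow> nat set set \<Rightarrow> nat set set" where
  "del_leaf u P = (\<lambda>b. b - {u}) ` P - {{}}"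

definition add_leaf :: "nat \<Rightarrow> nat \<Rightarrow> nat set set \<Rightarrow> nat set set" where
  "add_leaf u v P = (\<lambda>b. if v \<in> b then insert u b else b) ` P"

text \<open>rank of the parent node of leaf u\<close>
definition par_rank :: "nat \<Rightarrow> (nat \<Rightarrow> nat set set) \<Rightarrow> nat" where
  "par_rank u B = (LEAST m. {u} \<in> B m)"

text \<open>Moran event with pair (u,v): u dies, v reproduces, at the current time.\<close>
definition moran_jump :: "nat \<Rightarrow> nat \<times> nat \<Rightarrow> (nat \<Rightarrow> nat set set) \<times> (nat \<Rightarrow> real)
                          \<Rightarrow> (nat \<Rightarrow> nat set set) \<times> (nat \<Rightarrow> real)" where
  "moran_jump n uv x =
     (let u = fst uv; v = snd uv; B = fst x; s = snd x; r = par_rank u B in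
      ((\<lambda>m. if m < n - 1 then add_leaf u v (del_leaf u (B (if m < r then m else Suc m)))
            else if m = n - 1 then (\<lambda>i. {i}) ` {1..n} else {}),
       restrict (\<lambda>m. if m = n - 1 then 0
                     else if Suc m < r then s m
                     else if Suc m = r then s m + s (Suc m)
                     else s (Suc m)) {1..<n}))"

definition mgp_flow :: "nat \<Rightarrow> real \<Rightarrow> (nat \<Rightarrow> nat set set) \<times> (nat \<Rightarrow> real)
                        \<Rightarrow> (nat \<Rightarrow> nat set set) \<times> (nat \<Rightarrow> real)" where
  "mgp_flow n h x = (fst x, (snd x)(n - 1 := snd x (n - 1) + h))"

definition moran_pairs :: "nat \<Rightarrow> (nat \<times> nat) set" where
  "moran_pairs n = {(u, v). u \<in> {1..n} \<and> v \<in> {1..n} \<and> u \<noteq> v}"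

text \<open>Driving noise: i.i.d. (Exp(mu) inter-event time, uniform ordered pair);
the event times form a Poisson process of rate mu.\<close>
definition driving :: "nat \<Rightarrow> real \<Rightarrow> (real \<times> (nat \<times> nat)) stream measure" where
  "driving n \<mu> = stream_space (density lborel (exponential_density \<mu>)
                     \<Otimes>\<^sub>M measure_pmf (pmf_of_set (moran_pairs n)))"

definition ev_time :: "(real \<times> (nat \<times> nat)) stream \<Rightarrow> nat \<Rightarrow> real" where
  "ev_time \<omega> k = (\<Sum>i<k. fst (\<omega> !! i))"

primrec post_state :: "nat \<Rightarrow> (nat \<Rightarrow> nat set set) \<times> (nat \<Rightarrow> real) \<Rightarrow> (real \<times> (nat \<times> nat)) stream
                       \<Rightarrow> nat \<Rightarrow> (nat \<Rightarrow> nat set set) \<times> (nat \<Rightarrow> real)" where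
  "post_state n x \<omega> 0 = x"
| "post_state n x \<omega> (Suc k) =
     moran_jump n (snd (\<omega> !! k)) (mgp_flow n (fst (\<omega> !! k)) (post_state n x \<omega> k))"

definition n_events :: "(real \<times> (nat \<times> nat)) stream \<Rightarrow> real \<Rightarrow> nat" where
  "n_events \<omega> t = card {k. 0 < k \<and> ev_time \<omega> k \<le> t}"

definition mgp :: "nat \<Rightarrow> (nat \<Rightarrow> nat set set) \<times> (nat \<Rightarrow> real) \<Rightarrow> (real \<times> (nat \<times> nat)) stream
                   \<Rightarrow> real \<Rightarrow> (nat \<Rightarrow> nat set set) \<times> (nat \<Rightarrow> real)" where
  "mgp n x \<omega> t = (let N = n_events \<omega> t in mgp_flow n (t - ev_time \<omega> N) (post_state n x \<omega> N))"

definition mgp_kernel :: "nat \<Rightarrow> real \<Rightarrow> real \<Rightarrow> (nat \<Rightarrow> nat set set) \<times> (nat \<Rightarrow> real)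
                          \<Rightarrow> ((nat \<Rightarrow> nat set set) \<times> (nat \<Rightarrow> real)) measure" where
  "mgp_kernel n \<mu> t x = distr (driving n \<mu>) (state_space n) (\<lambda>\<omega>. mgp n x \<omega> t)"

definition mgp_evolve :: "nat \<Rightarrow> real \<Rightarrow> ((nat \<Rightarrow> nat set set) \<times> (nat \<Rightarrow> real)) measure \<Rightarrow> real
                          \<Rightarrow> ((nat \<Rightarrow> nat set set) \<times> (nat \<Rightarrow> real)) measure" where
  "mgp_evolve n \<mu> \<nu> t = \<nu> \<bind> mgp_kernel n \<mu> t"

definition mgp_stationary :: "nat \<Rightarrow> real \<Rightarrow> ((nat \<Rightarrow> nat set set) \<times> (nat \<Rightarrow> real)) measure" where
  "mgp_stationary n \<mu> = density (state_space n)
     (\<lambda>x. ennreal ((\<mu> / real (n choose 2)) ^ (n - 1) *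
        exp (- (\<Sum>j=1..n-1. real (Suc j choose 2) / real (n choose 2) * \<mu> * snd x j))))"

definition tv_norm_diff :: "'a measure \<Rightarrow> 'a measure \<Rightarrow> 'a measure \<Rightarrow> real" where
  "tv_norm_diff S M N = (SUP f \<in> {f \<in> borel_measurable S. \<forall>x\<in>space S. \<bar>f x\<bar> \<le> 1}.
       \<bar>(\<integral>x. f x \<partial>M) - (\<integral>x. f x \<partial>N)\<bar>)"

end

theory Submission
  imports Defs
begin

text \<open>
  \<^bold>\<open>Invariance.\<close> Under \<open>\<pi>\<close> the topology is uniform and the intervals are independent exponentials with
  rates \<open>\<lambda>\<^sub>j = j (j + 1) \<kappa>\<close>, \<open>\<kappa> = \<mu> / (n (n - 1))\<close>, so that \<open>\<lambda>\<^bsub>n-1\<^esub> = \<mu>\<close>. A jump removes the node of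
  rank \<open>r\<close> above the dying leaf; every pair of a target topology and a rank \<open>r\<close> has at most \<open>2 r\<close>
  preimages, since the old topology is recovered from the order of the new cherry and the sister
  clade of the removed leaf. Let \<open>P\<^sub>r\<close> be the law of the intervals with \<open>s\<^sub>r\<close> deleted and \<open>L\<^sub>r\<close> the law
  with \<open>s\<^sub>r\<close> merged into \<open>s\<^bsub>r-1\<^esub>\<close>. The convolution of two exponentials gives
  \<open>2 L\<^sub>r + (r - 1) P\<^bsub>r-1\<^esub> = (r + 1) P\<^sub>r\<close>, which telescopes to \<open>\<Sum>\<^sub>r 2 r L\<^sub>r = n (n - 1) P\<^bsub>n-1\<^esub>\<close>. Hence the
  jump maps \<open>\<pi>\<close> below \<open>\<pi>\<close> with the last interval reset to \<open>0\<close>. Decomposing the semigroup by the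
  number of events and conditioning on the last one shows that all partial sums of \<open>\<pi> K\<^sup>t\<close> are
  below \<open>\<pi>\<close>; both are probability measures, so they are equal.

  \<^bold>\<open>Ergodicity.\<close> Two copies driven by the same noise coincide after the consecutive pairs
  \<open>(2, 1), (3, 1), \<dots>, (n, 1)\<close>, because all their nodes are then new. The probability that this
  pattern has not occurred by time \<open>t\<close> decays exponentially, uniformly in the initial states. This
  bounds the oscillation of \<open>K\<^sup>t f\<close>, which gives the total variation bound and uniqueness.
\<close>

subsection \<open>Ranked tree topologies\<close>

lemma split_stepI:
  assumes "b \<in> P" "b1 \<noteq> {}" "b2 \<noteq> {}" "b1 \<inter> b2 = {}" "b1 \<union> b2 = b"
    "Q = insert b1 (insert b2 (P - {b}))"
  shows "split_step P Q"
  using assms unfolding split_step_def by blast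

lemma split_stepE:
  assumes "split_step P Q" "partition_on A P"
  obtains b b1 b2 where "b \<in> P" "b1 \<noteq> {}" "b2 \<noteq> {}" "b1 \<inter> b2 = {}" "b = b1 \<union> b2"
    "Q = insert b1 (insert b2 (P - {b}))" "b1 \<notin> P" "b2 \<notin> P" "b1 \<noteq> b2"
proof -
  obtain b b1 b2 where *: "b \<in> P" "b1 \<noteq> {}" "b2 \<noteq> {}" "b1 \<inter> b2 = {}" "b = b1 \<union> b2"
    "Q = insert b1 (insert b2 (P - {b}))"
    using assms(1) unfolding split_step_def by blast
  have disj: "x = y" if "x \<in> P" "y \<in> P" "x \<inter> y \<noteq> {}" for x y
    using assms(2) that unfolding partition_on_def disjoint_def by blast
  have "b1 \<notin> P" "b2 \<notin> P" using disj[of b1 b] disj[of b2 b] * by blast+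
  moreover have "b1 \<noteq> b2" using * by blast
  ultimately show ?thesis using that * by blast
qed

lemma partition_on_unique_block:
  assumes "partition_on A P" "x \<in> P" "y \<in> P" "z \<in> x" "z \<in> y"
  shows "x = y"
  using assms unfolding partition_on_def disjoint_def by blast

lemma split_step_partition_on:
  assumes "partition_on A P" "split_step P Q"
  shows "partition_on A Q"
proof -
  obtain b b1 b2 where *: "b \<in> P" "b1 \<noteq> {}" "b2 \<noteq> {}" "b1 \<inter> b2 = {}" "b = b1 \<union> b2"
    "Q = insert b1 (insert b2 (P - {b}))" "b1 \<notin> P" "b2 \<notin> P" "b1 \<noteq> b2"
    by (rule split_stepE[OF assms(2,1)])
  have d: "x \<inter> b = {}" if "x \<in> P" "x \<noteq> b" for x
    using partition_on_unique_block[OF assms(1) that(1) *(1)] that by blast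
  show ?thesis
  proof (rule partition_onI)
    show "\<Union> Q = A" using partition_onD1[OF assms(1)] * by auto
    show "disjnt p p'" if "p \<in> Q" "p' \<in> Q" "p \<noteq> p'" for p p'
    proof -
      have "x \<inter> y = {}" if "x \<in> P" "y \<in> P" "x \<noteq> y" for x y
        using partition_onD2[OF assms(1)] that unfolding disjoint_def by blast
      moreover have "x \<inter> b1 = {}" "x \<inter> b2 = {}" if "x \<in> P" "x \<noteq> b" for x
        using d[OF that] *(5) by auto
      ultimately show ?thesis
        using that *(4,6) unfolding disjnt_def by (metis Diff_iff Int_commute insert_iff)
    qed
    show "{} \<notin> Q" using * partition_onD3[OF assms(1)] by auto
  qed
qed

lemma split_step_card:
  assumes "partition_on A P" "split_step P Q" "finite P"
  shows "finite Q" "card Q = Suc (card P)"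
proof -
  obtain b b1 b2 where *: "b \<in> P" "b1 \<noteq> {}" "b2 \<noteq> {}" "b1 \<inter> b2 = {}" "b = b1 \<union> b2"
    "Q = insert b1 (insert b2 (P - {b}))" "b1 \<notin> P" "b2 \<notin> P" "b1 \<noteq> b2"
    by (rule split_stepE[OF assms(2,1)])
  show "finite Q" using * assms by auto
  have "card P > 0" using * assms(3) card_gt_0_iff by blast
  then show "card Q = Suc (card P)" using * assms(3) by simp
qed

lemma singleton_split_step:
  assumes "partition_on A P" "split_step P Q" "{u} \<in> P"
  shows "{u} \<in> Q"
proof -
  obtain b b1 b2 where *: "b \<in> P" "b1 \<noteq> {}" "b2 \<noteq> {}" "b1 \<inter> b2 = {}" "b = b1 \<union> b2"
    "Q = insert b1 (insert b2 (P - {b}))" "b1 \<notin> P" "b2 \<notin> P" "b1 \<noteq> b2"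
    by (rule split_stepE[OF assms(2,1)])
  have "b \<noteq> {u}" using *(2-5) by (metis Int_absorb Un_singleton_iff)
  then show ?thesis using * assms(3) by blast
qed

lemma partition_on_all_singletons:
  assumes "finite A" "partition_on A P" "card P = card A"
  shows "P = (\<lambda>i. {i}) ` A"
proof -
  have fP: "finite P" using assms finite_elements by blast
  have fb: "finite b" if "b \<in> P" for b
    using that assms partition_onD1 by (metis Union_upper finite_subset)
  have ge: "1 \<le> card b" if "b \<in> P" for b
    using that fb partition_onD3[OF assms(2)] by (metis One_nat_def Suc_leI card_gt_0_iff)
  have "card A = sum card P"
    using card_Union_disjoint[of P] partition_onD1[OF assms(2)] partition_onD2[OF assms(2)] fb
    by simp
  then have "sum (\<lambda>_. 1) P = sum card P" using assms(3) by simp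
  then have one: "card b = 1" if "b \<in> P" for b
    using sum_mono_inv[of "\<lambda>_. 1" P card b] ge that fP by auto
  show ?thesis
  proof (intro equalityI subsetI)
    fix b assume "b \<in> P"
    then show "b \<in> (\<lambda>i. {i}) ` A"
      using one[of b] partition_onD1[OF assms(2)] card_1_singletonE by (metis Union_iff imageI insertI1)
  next
    fix b assume "b \<in> (\<lambda>i. {i}) ` A"
    then obtain i where i: "i \<in> A" "b = {i}" by auto
    then obtain c where "c \<in> P" "i \<in> c" using partition_onD1[OF assms(2)] by auto
    then show "b \<in> P" using one[of c] i card_1_singletonE by (metis singletonD)
  qed
qed

lemma ranked_trees_partition:
  assumes "B \<in> ranked_trees n" "m < n"
  shows "partition_on {1..n} (B m)" "finite (B m)" "card (B m) = Suc m"
proof -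
  have "partition_on {1..n} (B m) \<and> finite (B m) \<and> card (B m) = Suc m"
    using assms(2)
  proof (induction m)
    case 0
    then show ?case using assms(1) unfolding ranked_trees_def
      by (auto intro!: partition_onI)
  next
    case (Suc m)
    then show ?case using assms(1) split_step_partition_on split_step_card
      unfolding ranked_trees_def by (metis (mono_tags, lifting) Suc_lessD mem_Collect_eq)
  qed
  then show "partition_on {1..n} (B m)" "finite (B m)" "card (B m) = Suc m" by auto
qed

lemma ranked_trees_split:
  assumes "B \<in> ranked_trees n" "Suc m < n"
  shows "split_step (B m) (B (Suc m))"
  using assms unfolding ranked_trees_def by auto

lemma ranked_trees_last:
  assumes "B \<in> ranked_trees n" "n \<ge> 1"
  shows "B (n - 1) = (\<lambda>i. {i}) ` {1..n}"
  using ranked_trees_partition[OF assms(1), of "n - 1"] assms(2)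
  by (intro partition_on_all_singletons) auto

definition tree_chains :: "'a set \<Rightarrow> nat \<Rightarrow> 'a set set \<Rightarrow> (nat \<Rightarrow> 'a set set) set" where
  "tree_chains A m Q = {B. B 0 = {A} \<and> (\<forall>j<m. split_step (B j) (B (Suc j))) \<and> B m = Q
     \<and> (\<forall>j>m. B j = {})}"

lemma tree_chains_partition:
  assumes "B \<in> tree_chains A m Q" "A \<noteq> {}" "j \<le> m"
  shows "partition_on A (B j)"
  using assms(3)
proof (induction j)
  case 0
  show ?case using assms(1,2) unfolding tree_chains_def by (auto intro!: partition_onI)
next
  case (Suc j)
  then show ?case using assms split_step_partition_on unfolding tree_chains_def
    by (metis (mono_tags, lifting) Suc_leD Suc_le_eq mem_Collect_eq)
qed

definition merge_blocks :: "'a set set \<Rightarrow> 'a set set \<Rightarrow> 'a set set" where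
  "merge_blocks Q e = insert (\<Union>e) (Q - e)"

lemma merge_blocks_partition:
  assumes "partition_on A Q" "e \<subseteq> Q" "card e = 2" "finite Q"
  shows "partition_on A (merge_blocks Q e)" "split_step (merge_blocks Q e) Q"
    "Suc (card (merge_blocks Q e)) = card Q" "Q - merge_blocks Q e = e"
proof -
  obtain b1 b2 where e: "e = {b1,b2}" "b1 \<noteq> b2" using assms(3) by (meson card_2_iff)
  have b: "b1 \<in> Q" "b2 \<in> Q" "b1 \<noteq> {}" "b2 \<noteq> {}" using assms e partition_onD3[OF assms(1)] by auto
  have d: "x \<inter> y = {}" if "x \<in> Q" "y \<in> Q" "x \<noteq> y" for x y
    using partition_on_unique_block[OF assms(1) that(1,2)] that by blast
  have U: "b1 \<union> b2 \<notin> Q"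
    using d[of "b1 \<union> b2" b1] d[of "b1 \<union> b2" b2] b e(2) by blast
  show "partition_on A (merge_blocks Q e)"
  proof (rule partition_onI)
    show "\<Union> (merge_blocks Q e) = A"
      using partition_onD1[OF assms(1)] b e unfolding merge_blocks_def by auto
    show "disjnt p p'" if "p \<in> merge_blocks Q e" "p' \<in> merge_blocks Q e" "p \<noteq> p'" for p p'
    proof -
      have "x \<inter> \<Union>e = {}" if "x \<in> Q - e" for x using that d b e by blast
      then show ?thesis using that d unfolding merge_blocks_def disjnt_def
        by (metis DiffD1 Int_commute insert_iff)
    qed
    show "{} \<notin> merge_blocks Q e"
      using b e partition_onD3[OF assms(1)] unfolding merge_blocks_def by auto
  qed
  show "split_step (merge_blocks Q e) Q"
  proof -
    have "b1 \<union> b2 \<in> merge_blocks Q e" using e unfolding merge_blocks_def by auto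
    moreover have "b1 \<inter> b2 = {}" using d b e by auto
    moreover have "Q = insert b1 (insert b2 (merge_blocks Q e - {b1 \<union> b2}))"
      using U b e unfolding merge_blocks_def by auto
    ultimately show ?thesis using b by (intro split_stepI[of "b1 \<union> b2" _ b1 b2]) auto
  qed
  have "card (Q - e) = card Q - 2" using assms by (simp add: card_Diff_subset finite_subset)
  moreover have "card Q \<ge> 2" using assms card_mono by metis
  ultimately show "Suc (card (merge_blocks Q e)) = card Q"
    using U e assms(4) unfolding merge_blocks_def by simp
  show "Q - merge_blocks Q e = e" using U b e unfolding merge_blocks_def by auto
qed

lemma split_step_merge_blocks:
  assumes "partition_on A P" "split_step P Q"
  shows "\<exists>e\<subseteq>Q. card e = 2 \<and> P = merge_blocks Q e"
proof -
  obtain b b1 b2 where *: "b \<in> P" "b1 \<noteq> {}" "b2 \<noteq> {}" "b1 \<inter> b2 = {}" "b = b1 \<union> b2"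
    "Q = insert b1 (insert b2 (P - {b}))" "b1 \<notin> P" "b2 \<notin> P" "b1 \<noteq> b2"
    by (rule split_stepE[OF assms(2,1)])
  have "P = merge_blocks Q {b1,b2}" using * unfolding merge_blocks_def by auto
  moreover have "{b1,b2} \<subseteq> Q" using * by blast
  moreover have "card {b1,b2} = 2" using * by simp
  ultimately show ?thesis by blast
qed

lemma card_tree_chains:
  assumes "finite A" "A \<noteq> {}" "partition_on A Q" "card Q = Suc m"
  shows "finite (tree_chains A m Q) \<and> card (tree_chains A m Q) = (\<Prod>j=1..m. Suc j choose 2)"
  using assms(3,4)
proof (induction m arbitrary: Q)
  case 0
  have "Q = {A}" using 0 partition_onD1 card_1_singletonE
    by (metis One_nat_def ccpo_Sup_singleton)
  then have "tree_chains A 0 Q = {\<lambda>j. if j = 0 then {A} else {}}"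
    unfolding tree_chains_def by (auto simp: fun_eq_iff)
  then show ?case by simp
next
  case (Suc m)
  let ?E = "{e. e \<subseteq> Q \<and> card e = 2}"
  let ?F = "\<lambda>e. (\<lambda>B. B(Suc m := Q)) ` tree_chains A m (merge_blocks Q e)"
  have fQ: "finite Q" using Suc.prems(2) by (metis card.infinite nat.distinct(1))
  have fE: "finite ?E" using fQ by simp
  have IH: "finite (tree_chains A m (merge_blocks Q e))"
     "card (tree_chains A m (merge_blocks Q e)) = (\<Prod>j=1..m. Suc j choose 2)"
    if "e \<in> ?E" for e
    using Suc.IH[of "merge_blocks Q e"] merge_blocks_partition[OF Suc.prems(1) _ _ fQ, of e] that Suc.prems(2)
    by auto
  have inj: "inj_on (\<lambda>B. B(Suc m := Q)) (tree_chains A m P)" for P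
  proof (rule inj_onI)
    fix B B' assume *: "B \<in> tree_chains A m P" "B' \<in> tree_chains A m P" "B(Suc m := Q) = B'(Suc m := Q)"
    have "B (Suc m) = B' (Suc m)" using * unfolding tree_chains_def by simp
    then show "B = B'" using *(3) by (metis fun_upd_triv fun_upd_upd)
  qed
  have eq: "tree_chains A (Suc m) Q = (\<Union>e\<in>?E. ?F e)"
  proof (intro equalityI subsetI)
    fix B assume B: "B \<in> tree_chains A (Suc m) Q"
    have "split_step (B m) Q" using B unfolding tree_chains_def by auto
    then obtain e where e: "e \<subseteq> Q" "card e = 2" "B m = merge_blocks Q e"
      using split_step_merge_blocks tree_chains_partition[OF B assms(2), of m] by (metis le_Suc_eq order_refl)
    have "B(Suc m := {}) \<in> tree_chains A m (merge_blocks Q e)"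
      using B e unfolding tree_chains_def by auto
    moreover have "B = (B(Suc m := {}))(Suc m := Q)" using B unfolding tree_chains_def by auto
    ultimately show "B \<in> (\<Union>e\<in>?E. ?F e)" using e by blast
  next
    fix B assume "B \<in> (\<Union>e\<in>?E. ?F e)"
    then obtain e B' where e: "e \<subseteq> Q" "card e = 2" "B' \<in> tree_chains A m (merge_blocks Q e)"
      "B = B'(Suc m := Q)" by auto
    have "split_step (merge_blocks Q e) Q"
      using merge_blocks_partition[OF Suc.prems(1) e(1,2) fQ] by simp
    then show "B \<in> tree_chains A (Suc m) Q"
      using e unfolding tree_chains_def by (auto simp: less_Suc_eq)
  qed
  have disj: "?F e \<inter> ?F e' = {}" if "e \<in> ?E" "e' \<in> ?E" "e \<noteq> e'" for e e'
  proof -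
    have "merge_blocks Q e \<noteq> merge_blocks Q e'"
      using merge_blocks_partition(4)[OF Suc.prems(1) _ _ fQ] that by (metis (mono_tags, lifting) mem_Collect_eq)
    moreover have "B m = merge_blocks Q e" if "B \<in> ?F e" for B e
      using that unfolding tree_chains_def by auto
    ultimately show ?thesis by (metis disjoint_iff)
  qed
  have "card (\<Union>e\<in>?E. ?F e) = (\<Sum>e\<in>?E. card (?F e))"
    using fE IH disj by (intro card_UN_disjoint) auto
  also have "\<dots> = (\<Sum>e\<in>?E. (\<Prod>j=1..m. Suc j choose 2))"
    using IH card_image[OF inj] by (intro sum.cong) auto
  also have "\<dots> = (Suc (Suc m) choose 2) * (\<Prod>j=1..m. Suc j choose 2)"
    using n_subsets[OF fQ, of 2] Suc.prems by simp
  finally show ?case using eq IH fE by (simp add: mult.commute)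
qed

lemma ranked_trees_chains:
  assumes "n \<ge> 1"
  shows "ranked_trees n = tree_chains {1..n} (n - 1) ((\<lambda>i. {i}) ` {1..n})"
proof (intro equalityI subsetI)
  fix B assume "B \<in> ranked_trees n"
  then show "B \<in> tree_chains {1..n} (n - 1) ((\<lambda>i. {i}) ` {1..n})"
    using ranked_trees_last[OF _ assms, of B] assms
    unfolding tree_chains_def by (simp add: ranked_trees_def)
next
  fix B assume "B \<in> tree_chains {1..n} (n - 1) ((\<lambda>i. {i}) ` {1..n})"
  then show "B \<in> ranked_trees n"
    using assms unfolding tree_chains_def by (simp add: ranked_trees_def)
qed

lemma card_ranked_trees:
  assumes "n \<ge> 1"
  shows "finite (ranked_trees n)" "card (ranked_trees n) = (\<Prod>j=1..n-1. Suc j choose 2)"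
proof -
  have "partition_on {1..n} ((\<lambda>i. {i}) ` {1..n})" by (rule partition_onI) auto
  moreover have "card ((\<lambda>i. {i}) ` {1..n}) = Suc (n - 1)"
    using assms by (subst card_image) auto
  ultimately have "finite (tree_chains {1..n} (n - 1) ((\<lambda>i. {i}) ` {1..n})) \<and>
    card (tree_chains {1..n} (n - 1) ((\<lambda>i. {i}) ` {1..n})) = (\<Prod>j=1..n-1. Suc j choose 2)"
    using assms by (intro card_tree_chains) auto
  then show "finite (ranked_trees n)" "card (ranked_trees n) = (\<Prod>j=1..n-1. Suc j choose 2)"
    unfolding ranked_trees_chains[OF assms] by auto
qed

subsection \<open>Deleting and adding leaves\<close>

lemma del_leaf_partition_on:
  assumes "partition_on A P"
  shows "partition_on (A - {u}) (del_leaf u P)"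
proof (rule partition_onI)
  show "\<Union> (del_leaf u P) = A - {u}"
    using partition_onD1[OF assms] unfolding del_leaf_def by auto
  show "disjnt p p'" if pp: "p \<in> del_leaf u P" "p' \<in> del_leaf u P" "p \<noteq> p'" for p p'
  proof -
    obtain b b' where b: "b \<in> P" "b' \<in> P" "p = b - {u}" "p' = b' - {u}"
      using pp unfolding del_leaf_def by auto
    then have "b \<noteq> b'" using pp by auto
    then have "b \<inter> b' = {}" using b partition_on_unique_block[OF assms b(1,2)] by blast
    then show ?thesis using b unfolding disjnt_def by auto
  qed
  show "{} \<notin> del_leaf u P" unfolding del_leaf_def by auto
qed

lemma del_leaf_split_step:
  assumes "partition_on A P" "split_step P Q" "{u} \<in> Q \<Longrightarrow> {u} \<in> P"
  shows "split_step (del_leaf u P) (del_leaf u Q)"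
proof -
  obtain b b1 b2 where *: "b \<in> P" "b1 \<noteq> {}" "b2 \<noteq> {}" "b1 \<inter> b2 = {}" "b = b1 \<union> b2"
    "Q = insert b1 (insert b2 (P - {b}))" "b1 \<notin> P" "b2 \<notin> P" "b1 \<noteq> b2"
    by (rule split_stepE[OF assms(2,1)])
  have ne: "b1 - {u} \<noteq> {}" "b2 - {u} \<noteq> {}"
  proof -
    have "b1 \<noteq> {u}" "b2 \<noteq> {u}" using assms(3) *(6,7,8) by auto
    then show "b1 - {u} \<noteq> {}" "b2 - {u} \<noteq> {}" using *(2,3) by auto
  qed
  have "del_leaf u (P - {b}) = del_leaf u P - {b - {u}}"
  proof -
    have "x = b" if "x \<in> P" "x - {u} = b - {u}" for x
    proof -
      obtain z where "z \<in> b - {u}" using ne *(5) by blast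
      then show ?thesis using that partition_on_unique_block[OF assms(1) that(1) *(1), of z] by blast
    qed
    then show ?thesis unfolding del_leaf_def by blast
  qed
  moreover have "del_leaf u Q = insert (b1 - {u}) (insert (b2 - {u}) (del_leaf u (P - {b})))"
    using ne *(6) unfolding del_leaf_def by auto
  moreover have "b - {u} \<in> del_leaf u P" using *(1,5) ne unfolding del_leaf_def by blast
  moreover have "(b1 - {u}) \<inter> (b2 - {u}) = {}" "(b1 - {u}) \<union> (b2 - {u}) = b - {u}" using *(4,5) by auto
  ultimately show ?thesis using ne
    by (intro split_stepI[of "b - {u}" _ "b1 - {u}" "b2 - {u}"]) simp_all
qed

lemma del_leaf_parent:
  assumes "partition_on A P" "split_step P Q" "{u} \<in> Q" "{u} \<notin> P"
  shows "del_leaf u Q = del_leaf u P"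
proof -
  obtain b b1 b2 where *: "b \<in> P" "b1 \<noteq> {}" "b2 \<noteq> {}" "b1 \<inter> b2 = {}" "b = b1 \<union> b2"
    "Q = insert b1 (insert b2 (P - {b}))" "b1 \<notin> P" "b2 \<notin> P" "b1 \<noteq> b2"
    by (rule split_stepE[OF assms(2,1)])
  have "b1 = {u} \<or> b2 = {u}" using assms(3,4) *(6) by auto
  then have "\<exists>c. b = insert u c \<and> u \<notin> c \<and> c \<noteq> {} \<and> Q = insert {u} (insert c (P - {b}))"
  proof
    assume "b1 = {u}"
    then have "b = insert u b2" "u \<notin> b2" "b2 \<noteq> {}" "Q = insert {u} (insert b2 (P - {b}))"
      using *(3-6) by simp_all
    then show ?thesis by blast
  next
    assume "b2 = {u}"
    then have "b = insert u b1" "u \<notin> b1" "b1 \<noteq> {}" "Q = insert {u} (insert b1 (P - {b}))"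
      using *(2,4-6) by (simp_all add: insert_commute)
    then show ?thesis by blast
  qed
  then obtain c where c: "b = insert u c" "u \<notin> c" "c \<noteq> {}" "Q = insert {u} (insert c (P - {b}))"
    by blast
  have "del_leaf u Q = insert c (del_leaf u (P - {b}))"
    using c unfolding del_leaf_def by auto
  moreover have "del_leaf u P = insert c (del_leaf u (P - {b}))"
  proof -
    have "P = insert b (P - {b})" using *(1) by auto
    then have "del_leaf u P = del_leaf u (insert b (P - {b}))" by simp
    also have "\<dots> = insert c (del_leaf u (P - {b}))"
      using c(1-3) unfolding del_leaf_def by auto
    finally show ?thesis .
  qed
  ultimately show ?thesis by simp
qed

lemma add_leaf_split_step:
  assumes "partition_on A P" "split_step P Q" "u \<notin> A"
  shows "split_step (add_leaf u v P) (add_leaf u v Q)"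
proof -
  let ?f = "\<lambda>b. if v \<in> b then insert u b else b"
  obtain b b1 b2 where *: "b \<in> P" "b1 \<noteq> {}" "b2 \<noteq> {}" "b1 \<inter> b2 = {}" "b = b1 \<union> b2"
    "Q = insert b1 (insert b2 (P - {b}))" "b1 \<notin> P" "b2 \<notin> P" "b1 \<noteq> b2"
    by (rule split_stepE[OF assms(2,1)])
  have uP: "u \<notin> x" if "x \<in> P" for x using partition_onD1[OF assms(1)] assms(3) that by auto
  have inj: "x = y" if "x \<in> P" "y \<in> P" "?f x = ?f y" for x y
    using that uP[of x] uP[of y] by (auto split: if_splits)
  have "add_leaf u v P - {?f b} = add_leaf u v (P - {b})"
    unfolding add_leaf_def using inj[of _ b] *(1) by auto
  moreover have "add_leaf u v Q = insert (?f b1) (insert (?f b2) (add_leaf u v (P - {b})))"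
    unfolding add_leaf_def *(6) by simp
  moreover have "?f b \<in> add_leaf u v P" unfolding add_leaf_def using *(1) by blast
  moreover have "?f b1 \<inter> ?f b2 = {}" using *(4,5) uP[OF *(1)] by auto
  moreover have "?f b1 \<union> ?f b2 = ?f b" using *(5) by auto
  moreover have "?f b1 \<noteq> {}" "?f b2 \<noteq> {}" using *(2,3) by auto
  ultimately show ?thesis
    by (intro split_stepI[of "?f b" _ "?f b1" "?f b2"]) simp_all
qed

lemma del_leaf_add_leaf:
  assumes "partition_on A P" "u \<notin> A"
  shows "del_leaf u (add_leaf u v P) = P"
proof -
  have uP: "u \<notin> x" if "x \<in> P" for x using partition_onD1[OF assms(1)] assms(2) that by auto
  have "(\<lambda>b. b - {u}) ` add_leaf u v P = id ` P"
    unfolding add_leaf_def image_image by (rule image_cong) (use uP in auto)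
  then show ?thesis using partition_onD3[OF assms(1)] unfolding del_leaf_def by auto
qed

lemma par_rank_props:
  assumes "B \<in> ranked_trees n" "n \<ge> 2" "u \<in> {1..n}"
  shows "1 \<le> par_rank u B" "par_rank u B \<le> n - 1"
    "\<And>m. m < par_rank u B \<Longrightarrow> {u} \<notin> B m"
    "\<And>m. par_rank u B \<le> m \<Longrightarrow> m < n \<Longrightarrow> {u} \<in> B m"
proof -
  have last: "{u} \<in> B (n - 1)" using ranked_trees_last[OF assms(1)] assms(2,3) by auto
  then show "par_rank u B \<le> n - 1" unfolding par_rank_def by (rule Least_le)
  have mem: "{u} \<in> B (par_rank u B)" unfolding par_rank_def using last by (rule LeastI)
  show "{u} \<notin> B m" if "m < par_rank u B" for m
    using that not_less_Least unfolding par_rank_def by blast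
  have "B 0 = {{1..n}}" using assms(1) unfolding ranked_trees_def by auto
  moreover have "{1..n} \<noteq> {u}"
  proof
    assume "{1..n} = {u}"
    then have "card {1..n} = 1" by simp
    then show False using assms(2) by simp
  qed
  ultimately have "{u} \<notin> B 0" by (metis singletonD)
  then show "1 \<le> par_rank u B" using mem by (cases "par_rank u B") auto
  show "{u} \<in> B m" if "par_rank u B \<le> m" "m < n" for m
    using that
  proof (induction m)
    case 0 then show ?case using mem by simp
  next
    case (Suc m)
    show ?case
    proof (cases "par_rank u B = Suc m")
      case True then show ?thesis using mem by simp
    next
      case False
      then have "{u} \<in> B m" using Suc by auto
      then show ?thesis
        using singleton_split_step[OF ranked_trees_partition(1)[OF assms(1), of m]
            ranked_trees_split[OF assms(1), of m]] Suc.prems by auto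
    qed
  qed
qed

lemma del_leaf_par_rank:
  assumes "B \<in> ranked_trees n" "n \<ge> 2" "u \<in> {1..n}" "Suc m = par_rank u B"
  shows "del_leaf u (B m) = del_leaf u (B (Suc m))"
proof -
  have "Suc m < n" using par_rank_props(2)[OF assms(1-3)] assms(2,4) by auto
  then show ?thesis
    using del_leaf_parent[OF ranked_trees_partition(1)[OF assms(1), of m] ranked_trees_split[OF assms(1)], of u]
      par_rank_props(3,4)[OF assms(1-3)] assms(4) by (metis Suc_lessD lessI order_refl)
qed

definition jump_tree :: "nat \<Rightarrow> nat \<times> nat \<Rightarrow> (nat \<Rightarrow> nat set set) \<Rightarrow> nat \<Rightarrow> nat set set" where
  "jump_tree n p B = (\<lambda>m. if m < n - 1
      then add_leaf (fst p) (snd p) (del_leaf (fst p) (B (if m < par_rank (fst p) B then m else Suc m)))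
      else if m = n - 1 then (\<lambda>i. {i}) ` {1..n} else {})"

definition jump_times :: "nat \<Rightarrow> nat \<Rightarrow> (nat \<Rightarrow> real) \<Rightarrow> nat \<Rightarrow> real" where
  "jump_times n r s = restrict (\<lambda>m. if m = n - 1 then 0
                     else if Suc m < r then s m
                     else if Suc m = r then s m + s (Suc m)
                     else s (Suc m)) {1..<n}"

lemma moran_jump_eq:
  "moran_jump n p x = (jump_tree n p (fst x), jump_times n (par_rank (fst p) (fst x)) (snd x))"
  unfolding moran_jump_def jump_tree_def jump_times_def by (simp add: Let_def)

lemma jump_tree_eq_Suc:
  assumes "B \<in> ranked_trees n" "n \<ge> 2" "(u, v) \<in> moran_pairs n"
    "par_rank u B \<le> Suc m" "m < n - 1"
  shows "jump_tree n (u, v) B m = add_leaf u v (del_leaf u (B (Suc m)))"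
proof (cases "Suc m = par_rank u B")
  case True
  then have "del_leaf u (B m) = del_leaf u (B (Suc m))"
    using del_leaf_par_rank[OF assms(1,2)] assms(3) unfolding moran_pairs_def by auto
  then show ?thesis using True assms(5) by (simp add: jump_tree_def)
next
  case False
  then show ?thesis using assms(4,5) by (simp add: jump_tree_def)
qed

lemma del_leaf_singletons: "del_leaf u ((\<lambda>i. {i}) ` A) = (\<lambda>i. {i}) ` (A - {u})"
  unfolding del_leaf_def by auto

lemma add_leaf_singletons:
  "v \<in> A \<Longrightarrow> add_leaf u v ((\<lambda>i. {i}) ` A) = insert {u, v} ((\<lambda>i. {i}) ` (A - {v}))"
  unfolding add_leaf_def by auto

lemma jump_tree_cherry:
  assumes "B \<in> ranked_trees n" "n \<ge> 2" "(u, v) \<in> moran_pairs n"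
  shows "jump_tree n (u, v) B (n - 2) = insert {u, v} ((\<lambda>i. {i}) ` ({1..n} - {u, v}))"
proof -
  have uv: "u \<in> {1..n}" "v \<in> {1..n}" "u \<noteq> v" using assms(3) unfolding moran_pairs_def by auto
  have "par_rank u B \<le> Suc (n - 2)" using par_rank_props(2)[OF assms(1,2) uv(1)] assms(2) by simp
  then have "jump_tree n (u, v) B (n - 2) = add_leaf u v (del_leaf u (B (Suc (n - 2))))"
    using assms by (intro jump_tree_eq_Suc) auto
  also have "Suc (n - 2) = n - 1" using assms(2) by simp
  also have "B (n - 1) = (\<lambda>i. {i}) ` {1..n}" using ranked_trees_last[OF assms(1)] assms(2) by simp
  also have "add_leaf u v (del_leaf u ((\<lambda>i. {i}) ` {1..n})) = insert {u, v} ((\<lambda>i. {i}) ` ({1..n} - {u} - {v}))"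
    using uv unfolding del_leaf_singletons by (subst add_leaf_singletons) auto
  also have "{1..n} - {u} - {v} = {1..n} - {u, v}" by auto
  finally show ?thesis .
qed

lemma jump_tree_ranked_trees:
  assumes "B \<in> ranked_trees n" "n \<ge> 2" "(u, v) \<in> moran_pairs n"
  shows "jump_tree n (u, v) B \<in> ranked_trees n"
proof -
  let ?J = "jump_tree n (u, v) B" and ?r = "par_rank u B"
  have uv: "u \<in> {1..n}" "v \<in> {1..n}" "u \<noteq> v" using assms(3) unfolding moran_pairs_def by auto
  note pr = par_rank_props[OF assms(1,2) uv(1)]
  have pD: "partition_on ({1..n} - {u}) (del_leaf u (B m))" if "m < n" for m
    using that by (intro del_leaf_partition_on ranked_trees_partition(1)[OF assms(1)])
  have B0: "B 0 = {{1..n}}" using assms(1) unfolding ranked_trees_def by auto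
  have J0: "?J 0 = {{1..n}}"
  proof -
    have "?J 0 = add_leaf u v (del_leaf u (B 0))" using pr(1) assms(2) by (simp add: jump_tree_def)
    also have "del_leaf u (B 0) = {{1..n} - {u}}" using uv unfolding B0 del_leaf_def by auto
    also have "add_leaf u v {{1..n} - {u}} = {{1..n}}" using uv unfolding add_leaf_def by auto
    finally show ?thesis .
  qed
  have step: "split_step (?J m) (?J (Suc m))" if "Suc m < n" for m
  proof (cases "Suc m = n - 1")
    case True
    have "m = n - 2" using True by auto
    then have m: "?J m = insert {u, v} ((\<lambda>i. {i}) ` ({1..n} - {u, v}))"
      using jump_tree_cherry[OF assms] by simp
    have e: "?J (Suc m) = (\<lambda>i. {i}) ` {1..n}" using True by (simp add: jump_tree_def)
    have "?J (Suc m) = insert {u} (insert {v} (?J m - {{u, v}}))"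
      unfolding m e using uv by (auto simp: doubleton_eq_iff)
    moreover have "{u, v} \<in> ?J m" unfolding m by simp
    moreover have "{u} \<union> {v} = {u, v}" "{u} \<inter> {v} = {}" using uv by auto
    ultimately show ?thesis
      by (intro split_stepI[of "{u, v}" _ "{u}" "{v}"]) simp_all
  next
    case False
    then have lt: "Suc m < n - 1" using that by simp
    show ?thesis
    proof (cases "Suc m < ?r")
      case True
      have "split_step (del_leaf u (B m)) (del_leaf u (B (Suc m)))"
        using True pr(3) ranked_trees_partition(1)[OF assms(1), of m] ranked_trees_split[OF assms(1), of m] that
        by (intro del_leaf_split_step[of "{1..n}"]) auto
      then have "split_step (add_leaf u v (del_leaf u (B m))) (add_leaf u v (del_leaf u (B (Suc m))))"
        using pD[of m] that by (intro add_leaf_split_step[of "{1..n} - {u}"]) auto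
      then show ?thesis using True lt by (simp add: jump_tree_def)
    next
      case False
      have "split_step (del_leaf u (B (Suc m))) (del_leaf u (B (Suc (Suc m))))"
        using False pr(4) ranked_trees_partition(1)[OF assms(1), of "Suc m"]
          ranked_trees_split[OF assms(1), of "Suc m"] lt
        by (intro del_leaf_split_step[of "{1..n}"]) auto
      then have "split_step (add_leaf u v (del_leaf u (B (Suc m)))) (add_leaf u v (del_leaf u (B (Suc (Suc m)))))"
        using pD[of "Suc m"] that by (intro add_leaf_split_step[of "{1..n} - {u}"]) auto
      then show ?thesis using False lt jump_tree_eq_Suc[OF assms, of m] jump_tree_eq_Suc[OF assms, of "Suc m"]
        by simp
    qed
  qed
  have "?J m = {}" if "m \<ge> n" for m using that assms(2) by (auto simp: jump_tree_def)
  then show ?thesis using J0 step unfolding ranked_trees_def by blast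
qed

subsection \<open>Fibres of the jump map\<close>

lemma ranked_trees_refine:
  assumes "B \<in> ranked_trees n" "m' < n" "m \<le> m'" "b \<in> B m'"
  shows "\<exists>b'\<in>B m. b \<subseteq> b'"
  using assms(3,2,4)
proof (induction m' arbitrary: b rule: dec_induct)
  case base
  then show ?case by blast
next
  case (step k)
  obtain d b1 b2 where *: "d \<in> B k" "b1 \<union> b2 = d" "B (Suc k) = insert b1 (insert b2 (B k - {d}))"
    using ranked_trees_split[OF assms(1) step.prems(1)] unfolding split_step_def by blast
  have "\<exists>d'\<in>B k. b \<subseteq> d'" using step.prems(2) * by (metis Diff_iff insert_iff order_refl sup_ge1 sup_ge2)
  then obtain d' where "d' \<in> B k" "b \<subseteq> d'" by blast
  then show ?case using step.IH[of d'] step.prems(1) by (meson Suc_lessD order_trans)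
qed

lemma insert_del_leaf_singleton:
  assumes "partition_on A P" "{u} \<in> P"
  shows "insert {u} (del_leaf u P) = P"
proof -
  have "x - {u} = x" if "x \<in> P" "x \<noteq> {u}" for x
    using partition_on_unique_block[OF assms(1) that(1) assms(2), of u] that(2) by auto
  then have "(\<lambda>b. b - {u}) ` (P - {{u}}) = id ` (P - {{u}})" by (intro image_cong) auto
  moreover have "P = insert {u} (P - {{u}})" using assms(2) by auto
  then have "(\<lambda>b. b - {u}) ` P = (\<lambda>b. b - {u}) ` insert {u} (P - {{u}})" by (rule arg_cong)
  ultimately have "(\<lambda>b. b - {u}) ` P = insert {} (P - {{u}})"
    unfolding image_insert by simp
  then show ?thesis using assms(2) partition_onD3[OF assms(1)] unfolding del_leaf_def by auto
qed

lemma reinsert_del_leaf: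
  assumes "partition_on A P" "d \<in> P" "u \<in> d" "c \<subseteq> d - {u}" "c \<noteq> {}"
  shows "(\<lambda>b. if c \<subseteq> b then insert u b else b) ` del_leaf u P = P"
proof -
  have 1: "(if c \<subseteq> x - {u} then insert u (x - {u}) else x - {u}) = x" if "x \<in> P" for x
  proof (cases "x = d")
    case True then show ?thesis using assms(3,4) by auto
  next
    case False
    then have "x \<inter> d = {}" using partition_on_unique_block[OF assms(1) that assms(2)] by blast
    then show ?thesis using assms(3-5) by auto
  qed
  have "x - {u} \<noteq> {}" if "x \<in> P" for x
  proof (cases "x = d")
    case True then show ?thesis using assms(4,5) by auto
  next
    case False
    then have "u \<notin> x" using partition_on_unique_block[OF assms(1) that assms(2)] assms(3) by blast
    then show ?thesis using that partition_onD3[OF assms(1)] by auto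
  qed
  then have "del_leaf u P = (\<lambda>x. x - {u}) ` P" unfolding del_leaf_def by auto
  then have "(\<lambda>b. if c \<subseteq> b then insert u b else b) ` del_leaf u P
      = (\<lambda>x. if c \<subseteq> x - {u} then insert u (x - {u}) else x - {u}) ` P"
    by (simp only: image_image)
  also have "\<dots> = id ` P" using 1 by (intro image_cong) auto
  finally show ?thesis by simp
qed

text \<open>A tree is recovered from its image under a jump once one knows the rank of the removed
  node and the sister clade of the removed leaf.\<close>

definition reattach :: "nat \<Rightarrow> nat \<Rightarrow> nat \<Rightarrow> nat set \<Rightarrow> (nat \<Rightarrow> nat set set) \<Rightarrow> nat \<Rightarrow> nat set set" where
  "reattach n u r c B = (\<lambda>m. if m < r then (\<lambda>b. if c \<subseteq> b then insert u b else b) ` del_leaf u (B m)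
     else if m < n then insert {u} (del_leaf u (B (m - 1))) else {})"

lemma reattach_jump_tree:
  assumes "B \<in> ranked_trees n" "n \<ge> 2" "(u, v) \<in> moran_pairs n"
  defines "r \<equiv> par_rank u B"
  shows "\<exists>c \<in> del_leaf u (jump_tree n (u, v) B (r - 1)). B = reattach n u r c (jump_tree n (u, v) B)"
proof -
  let ?J = "jump_tree n (u, v) B"
  have uv: "u \<in> {1..n}" "v \<in> {1..n}" "u \<noteq> v" using assms(3) unfolding moran_pairs_def by auto
  note pr = par_rank_props[OF assms(1,2) uv(1), folded r_def]
  note part = ranked_trees_partition(1)[OF assms(1)]
  have del_add: "del_leaf u (add_leaf u v (del_leaf u (B m))) = del_leaf u (B m)" if "m < n" for m
    using part[OF that] by (intro del_leaf_add_leaf[of "{1..n} - {u}"] del_leaf_partition_on) auto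
  have low: "del_leaf u (?J m) = del_leaf u (B m)" if "m < r" for m
  proof -
    have "?J m = add_leaf u v (del_leaf u (B m))" using that pr(2) by (simp add: jump_tree_def r_def)
    then show ?thesis using del_add[of m] that pr(2) by simp
  qed
  have high: "del_leaf u (?J (m - 1)) = del_leaf u (B m)" if "r \<le> m" "m < n" for m
  proof -
    have "?J (m - 1) = add_leaf u v (del_leaf u (B (Suc (m - 1))))"
      using that pr(1) assms(2) by (intro jump_tree_eq_Suc[OF assms(1-3)]) (auto simp: r_def)
    then show ?thesis using del_add[of m] that pr(1) by simp
  qed
  have rn: "r - 1 < n" "r - 1 < r" using pr(1,2) assms(2) by auto
  obtain d where d: "d \<in> B (r - 1)" "u \<in> d"
    using partition_onD1[OF part[OF rn(1)]] uv(1) by auto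
  let ?c = "d - {u}"
  have c: "?c \<noteq> {}" using d pr(3)[OF rn(2)] by (metis Diff_eq_empty_iff empty_iff subset_singletonD)
  have "?c \<in> del_leaf u (B (r - 1))" using d c unfolding del_leaf_def by auto
  then have "?c \<in> del_leaf u (?J (r - 1))" using low[OF rn(2)] by simp
  moreover have "B m = reattach n u r ?c ?J m" for m
  proof -
    consider "m < r" | "r \<le> m" "m < n" | "n \<le> m" by linarith
    then show ?thesis
    proof cases
      case 1
      obtain d' where d': "d' \<in> B m" "d \<subseteq> d'"
        using ranked_trees_refine[OF assms(1) rn(1) _ d(1), of m] 1 by (metis Suc_pred' Suc_le_eq Suc_le_mono less_le_trans pr(1) zero_less_one less_Suc_eq_le)
      have "(\<lambda>b. if ?c \<subseteq> b then insert u b else b) ` del_leaf u (B m) = B m"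
        using d' d c 1 pr(2) assms(2) by (intro reinsert_del_leaf[OF part, of m d']) auto
      then show ?thesis using 1 low[OF 1] by (simp add: reattach_def)
    next
      case 2
      then show ?thesis using insert_del_leaf_singleton[OF part pr(4), of m] high[of m]
        by (simp add: reattach_def)
    next
      case 3
      then have "\<not> m < r" using pr(2) assms(2) by linarith
      moreover have "B m = {}" using assms(1) 3 unfolding ranked_trees_def by auto
      ultimately show ?thesis using 3 by (simp add: reattach_def)
    qed
  qed
  then have "B = reattach n u r ?c ?J" by blast
  ultimately show ?thesis by blast
qed

lemma finite_moran_pairs: "finite (moran_pairs n)"
  by (rule finite_subset[of _ "{1..n} \<times> {1..n}"]) (auto simp: moran_pairs_def)

lemma card_moran_pairs: "card (moran_pairs n) = n * (n - 1)"
proof -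
  have "moran_pairs n = (SIGMA u:{1..n}. {1..n} - {u})" unfolding moran_pairs_def by auto
  then show ?thesis by simp
qed

definition jump_fibre :: "nat \<Rightarrow> (nat \<Rightarrow> nat set set) \<Rightarrow> nat \<Rightarrow> ((nat \<Rightarrow> nat set set) \<times> (nat \<times> nat)) set" where
  "jump_fibre n B' r = {z \<in> ranked_trees n \<times> moran_pairs n.
     jump_tree n (snd z) (fst z) = B' \<and> par_rank (fst (snd z)) (fst z) = r}"

lemma card_jump_fibre:
  assumes "n \<ge> 2" "B' \<in> ranked_trees n" "1 \<le> r" "r \<le> n - 1"
  shows "card (jump_fibre n B' r) \<le> 2 * r"
proof (cases "jump_fibre n B' r = {}")
  case False
  then obtain B0 u0 v0 where 0: "B0 \<in> ranked_trees n" "(u0, v0) \<in> moran_pairs n"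
    "jump_tree n (u0, v0) B0 = B'"
    unfolding jump_fibre_def by auto
  let ?P = "{(u0, v0), (v0, u0)}"
  let ?S = "SIGMA p:?P. del_leaf (fst p) (B' (r - 1))"
  let ?G = "\<lambda>z. (reattach n (fst (fst z)) r (snd z) B', fst z)"
  have r: "r - 1 < n" using assms by auto
  have fB: "finite (B' (r - 1))" "card (B' (r - 1)) = r"
    using ranked_trees_partition[OF assms(2) r] assms(3) by auto
  have card_del: "finite (del_leaf u (B' (r - 1)))" "card (del_leaf u (B' (r - 1))) \<le> r" for u
  proof -
    have "card (del_leaf u (B' (r - 1))) \<le> card ((\<lambda>b. b - {u}) ` B' (r - 1))"
      unfolding del_leaf_def using fB by (intro card_mono) auto
    also have "\<dots> \<le> r" using card_image_le[OF fB(1)] fB(2) by metis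
    finally show "card (del_leaf u (B' (r - 1))) \<le> r" .
    show "finite (del_leaf u (B' (r - 1)))" using fB unfolding del_leaf_def by auto
  qed
  have sub: "jump_fibre n B' r \<subseteq> ?G ` ?S"
  proof
    fix z assume "z \<in> jump_fibre n B' r"
    then obtain B u v where z: "z = (B, (u, v))" "B \<in> ranked_trees n" "(u, v) \<in> moran_pairs n"
      "jump_tree n (u, v) B = B'" "par_rank u B = r"
      unfolding jump_fibre_def by auto
    have "insert {u, v} ((\<lambda>i. {i}) ` ({1..n} - {u, v})) = insert {u0, v0} ((\<lambda>i. {i}) ` ({1..n} - {u0, v0}))"
      using jump_tree_cherry[OF 0(1) assms(1) 0(2)] jump_tree_cherry[OF z(2) assms(1) z(3)] 0(3) z(4) by simp
    then have "{u, v} \<in> insert {u0, v0} ((\<lambda>i. {i}) ` ({1..n} - {u0, v0}))" by blast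
    moreover have "u \<noteq> v" using z(3) unfolding moran_pairs_def by auto
    then have "{u, v} \<noteq> {i}" for i by (metis insertI1 insert_commute singletonD)
    ultimately have "{u, v} = {u0, v0}" by blast
    then have p: "(u, v) \<in> ?P" unfolding doubleton_eq_iff by blast
    obtain c where "c \<in> del_leaf u (B' (r - 1))" "B = reattach n u r c B'"
      using reattach_jump_tree[OF z(2) assms(1) z(3)] z(4,5) by auto
    then have "((u, v), c) \<in> ?S" "z = ?G ((u, v), c)" using p z(1) by auto
    then show "z \<in> ?G ` ?S" by blast
  qed
  have "card (jump_fibre n B' r) \<le> card ?S"
    using sub card_del(1) by (intro surj_card_le) auto
  also have "\<dots> = (\<Sum>p\<in>?P. card (del_leaf (fst p) (B' (r - 1))))"
    using card_del(1) by (intro card_SigmaI) auto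
  also have "\<dots> \<le> (\<Sum>p\<in>?P. r)" using card_del(2) by (intro sum_mono) auto
  also have "\<dots> = card ?P * r" by (subst sum_constant) (simp only: of_nat_id)
  also have "card ?P * r \<le> 2 * r"
    using card_length[of "[(u0, v0), (v0, u0)]"] by (intro mult_right_mono) (simp_all only: list.set list.size)
  finally show ?thesis .
qed auto

lemma sum_jump_tree_le:
  fixes G :: "nat \<Rightarrow> (nat \<Rightarrow> nat set set) \<Rightarrow> ennreal"
  assumes "n \<ge> 2"
  shows "(\<Sum>B\<in>ranked_trees n. \<Sum>p\<in>moran_pairs n. G (par_rank (fst p) B) (jump_tree n p B))
    \<le> (\<Sum>B\<in>ranked_trees n. \<Sum>r=1..n-1. of_nat (2 * r) * G r B)"
proof -
  let ?W = "ranked_trees n" and ?P = "moran_pairs n"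
  let ?h = "\<lambda>z. (jump_tree n (snd z) (fst z), par_rank (fst (snd z)) (fst z))"
  have fW: "finite ?W" using card_ranked_trees assms by simp
  have img: "?h ` (?W \<times> ?P) \<subseteq> ?W \<times> {1..n-1}"
  proof
    fix y assume "y \<in> ?h ` (?W \<times> ?P)"
    then obtain B u v where *: "B \<in> ?W" "(u, v) \<in> ?P" "y = ?h (B, (u, v))" by auto
    then have "u \<in> {1..n}" unfolding moran_pairs_def by auto
    then show "y \<in> ?W \<times> {1..n-1}"
      using * jump_tree_ranked_trees[OF *(1) assms *(2)] par_rank_props(1,2)[OF *(1) assms] by auto
  qed
  have "(\<Sum>B\<in>?W. \<Sum>p\<in>?P. G (par_rank (fst p) B) (jump_tree n p B))
      = (\<Sum>z\<in>?W \<times> ?P. G (snd (?h z)) (fst (?h z)))"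
    by (simp add: sum.cartesian_product case_prod_beta)
  also have "\<dots> = (\<Sum>y\<in>?W \<times> {1..n-1}. \<Sum>z\<in>{z \<in> ?W \<times> ?P. ?h z = y}. G (snd (?h z)) (fst (?h z)))"
    using fW finite_moran_pairs img by (intro sum.group[symmetric]) auto
  also have "\<dots> = (\<Sum>y\<in>?W \<times> {1..n-1}. of_nat (card (jump_fibre n (fst y) (snd y))) * G (snd y) (fst y))"
  proof (intro sum.cong refl)
    fix y
    have "{z \<in> ?W \<times> ?P. ?h z = y} = jump_fibre n (fst y) (snd y)"
      unfolding jump_fibre_def by auto
    moreover have "(\<Sum>z\<in>{z \<in> ?W \<times> ?P. ?h z = y}. G (snd (?h z)) (fst (?h z)))
       = (\<Sum>z\<in>{z \<in> ?W \<times> ?P. ?h z = y}. G (snd y) (fst y))"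
      by (intro sum.cong) auto
    ultimately show "(\<Sum>z\<in>{z \<in> ?W \<times> ?P. ?h z = y}. G (snd (?h z)) (fst (?h z)))
       = of_nat (card (jump_fibre n (fst y) (snd y))) * G (snd y) (fst y)" by simp
  qed
  also have "\<dots> \<le> (\<Sum>y\<in>?W \<times> {1..n-1}. of_nat (2 * snd y) * G (snd y) (fst y))"
    using card_jump_fibre[OF assms]
    by (intro sum_mono mult_right_mono of_nat_mono) auto
  also have "\<dots> = (\<Sum>B\<in>?W. \<Sum>r=1..n-1. of_nat (2 * r) * G r B)"
    by (simp add: sum.cartesian_product case_prod_beta)
  finally show ?thesis .
qed

definition state_set :: "nat \<Rightarrow> ((nat \<Rightarrow> nat set set) \<times> (nat \<Rightarrow> real)) set" where
  "state_set n = ranked_trees n \<times> ({1..<n} \<rightarrow>\<^sub>E {0..})"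

lemma mgp_flow_state_set:
  assumes "x \<in> state_set n" "h \<ge> 0" "n \<ge> 2"
  shows "mgp_flow n h x \<in> state_set n"
proof -
  have x: "fst x \<in> ranked_trees n" "snd x \<in> {1..<n} \<rightarrow>\<^sub>E {0..}"
    using assms(1) unfolding state_set_def by auto
  have "(snd x)(n - 1 := snd x (n - 1) + h) \<in> insert (n - 1) {1..<n} \<rightarrow>\<^sub>E {0..}"
  proof (rule PiE_fun_upd)
    show "snd x (n - 1) + h \<in> {0..}" using PiE_mem[OF x(2), of "n - 1"] assms(2,3) by auto
    show "snd x \<in> {1..<n} \<rightarrow>\<^sub>E {0..}" by (rule x(2))
  qed
  moreover have "insert (n - 1) {1..<n} = {1..<n}" using assms(3) by auto
  ultimately show ?thesis using x(1) unfolding state_set_def mgp_flow_def by simp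
qed

lemma jump_times_nonneg:
  assumes "s \<in> {1..<n} \<rightarrow>\<^sub>E {0..}" "n \<ge> 2" "r \<le> n - 1"
  shows "jump_times n r s \<in> {1..<n} \<rightarrow>\<^sub>E {0..}"
proof -
  have "0 \<le> s m" if "1 \<le> m" "m < n" for m using assms(1) that by (auto simp: PiE_iff)
  then show ?thesis using assms(2,3) unfolding jump_times_def by (auto simp: PiE_iff extensional_def)
qed

lemma moran_jump_state_set:
  assumes "x \<in> state_set n" "n \<ge> 2" "p \<in> moran_pairs n"
  shows "moran_jump n p x \<in> state_set n"
proof -
  obtain u v where p: "p = (u, v)" by (cases p)
  have x: "fst x \<in> ranked_trees n" "snd x \<in> {1..<n} \<rightarrow>\<^sub>E {0..}"
    using assms(1) unfolding state_set_def by auto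
  have "u \<in> {1..n}" using assms(3) p unfolding moran_pairs_def by auto
  then show ?thesis
    using jump_tree_ranked_trees[OF x(1) assms(2), of u v] assms(3) p
      jump_times_nonneg[OF x(2) assms(2), of "par_rank u (fst x)"] par_rank_props(2)[OF x(1) assms(2)]
    unfolding moran_jump_eq state_set_def by auto
qed

text \<open>The two states share the \<open>c - 1\<close> most recent nodes, and these only involve the leaves
  \<open>1, \<dots>, c\<close>; the event \<open>(c + 1, 1)\<close> then adds one more shared node. At \<open>c = n\<close> the states
  coincide.\<close>

definition agree :: "nat \<Rightarrow> nat \<Rightarrow> (nat \<Rightarrow> nat set set) \<times> (nat \<Rightarrow> real)
    \<Rightarrow> (nat \<Rightarrow> nat set set) \<times> (nat \<Rightarrow> real) \<Rightarrow> bool" where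
  "agree n c x y \<longleftrightarrow> (\<forall>m\<ge>n - c. fst x m = fst y m) \<and> (\<forall>u\<in>{c<..n}. {u} \<in> fst x (n - c))
     \<and> (\<forall>m. n - c < m \<longrightarrow> m < n \<longrightarrow> snd x m = snd y m)"

lemma agree_1:
  assumes "x \<in> state_set n" "y \<in> state_set n" "n \<ge> 2"
  shows "agree n 1 x y"
proof -
  have B: "fst x \<in> ranked_trees n" "fst y \<in> ranked_trees n"
    using assms unfolding state_set_def by auto
  have "fst x m = fst y m" if "m \<ge> n - 1" for m
  proof (cases "m = n - 1")
    case True then show ?thesis using ranked_trees_last[OF B(1)] ranked_trees_last[OF B(2)] assms(3) by simp
  next
    case False
    then have "m \<ge> n" using that assms(3) by simp
    then show ?thesis using B unfolding ranked_trees_def by simp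
  qed
  moreover have "{u} \<in> fst x (n - 1)" if "u \<in> {1<..n}" for u
    using ranked_trees_last[OF B(1)] assms(3) that by simp
  ultimately show ?thesis unfolding agree_def by auto
qed

lemma agree_n:
  assumes "x \<in> state_set n" "y \<in> state_set n" "agree n n x y"
  shows "x = y"
proof (rule prod_eqI)
  show "fst x = fst y" using assms(3) unfolding agree_def by auto
  show "snd x = snd y"
  proof (rule PiE_ext)
    show "snd x \<in> {1..<n} \<rightarrow>\<^sub>E {0..}" "snd y \<in> {1..<n} \<rightarrow>\<^sub>E {0..}"
      using assms unfolding state_set_def by auto
    show "\<And>m. m \<in> {1..<n} \<Longrightarrow> snd x m = snd y m" using assms(3) unfolding agree_def by auto
  qed
qed

lemma agree_step:
  assumes "x \<in> state_set n" "y \<in> state_set n" "agree n c x y" "1 \<le> c" "c < n"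
  shows "agree n (Suc c) (moran_jump n (Suc c, 1) (mgp_flow n h x)) (moran_jump n (Suc c, 1) (mgp_flow n h y))"
proof -
  have n: "n \<ge> 2" using assms(4,5) by simp
  have B: "fst x \<in> ranked_trees n" "fst y \<in> ranked_trees n"
    using assms unfolding state_set_def by auto
  have p: "(Suc c, 1) \<in> moran_pairs n" using assms(4,5) unfolding moran_pairs_def by auto
  have mem: "{Suc c} \<in> fst x (n - c)" "{Suc c} \<in> fst y (n - c)"
    using assms(3,5) unfolding agree_def by auto
  have r: "par_rank (Suc c) (fst x) \<le> n - c" "par_rank (Suc c) (fst y) \<le> n - c"
    unfolding par_rank_def using mem by (auto intro: Least_le)
  have eq: "fst x m = fst y m" if "m \<ge> n - c" for m using assms(3) that unfolding agree_def by auto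
  have J: "jump_tree n (Suc c, 1) (fst x) m = add_leaf (Suc c) 1 (del_leaf (Suc c) (fst x (Suc m)))"
     "jump_tree n (Suc c, 1) (fst y) m = add_leaf (Suc c) 1 (del_leaf (Suc c) (fst x (Suc m)))"
    if "m \<ge> n - Suc c" "m < n - 1" for m
    using that r assms(4,5) eq[of "Suc m"] jump_tree_eq_Suc[OF B(1) n p, of m] jump_tree_eq_Suc[OF B(2) n p, of m]
    by auto
  have 1: "jump_tree n (Suc c, 1) (fst x) m = jump_tree n (Suc c, 1) (fst y) m" if "m \<ge> n - Suc c" for m
    using J[OF that] by (cases "m < n - 1") (auto simp: jump_tree_def)
  have 2: "{u} \<in> jump_tree n (Suc c, 1) (fst x) (n - Suc c)" if "u \<in> {Suc c<..n}" for u
  proof -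
    have "{u} \<in> fst x (n - c)" using that assms(3) unfolding agree_def by auto
    then have "{u} \<in> del_leaf (Suc c) (fst x (n - c))"
      using that unfolding del_leaf_def by (auto simp: image_iff intro!: bexI[of _ "{u}"])
    then have "{u} \<in> add_leaf (Suc c) 1 (del_leaf (Suc c) (fst x (n - c)))"
      using that unfolding add_leaf_def by (auto simp: image_iff intro!: bexI[of _ "{u}"])
    then show ?thesis using J(1)[of "n - Suc c"] assms(4,5) by (simp add: Suc_diff_Suc)
  qed
  have 3: "jump_times n (par_rank (Suc c) (fst x)) (snd (mgp_flow n h x)) m
      = jump_times n (par_rank (Suc c) (fst y)) (snd (mgp_flow n h y)) m"
    if "n - Suc c < m" "m < n" for m
  proof -
    have "snd x (Suc m) = snd y (Suc m)" if "m \<noteq> n - 1"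
      using assms(3) that \<open>n - Suc c < m\<close> \<open>m < n\<close> unfolding agree_def by auto
    moreover have "\<not> Suc m < par_rank (Suc c) (fst x)" "Suc m \<noteq> par_rank (Suc c) (fst x)"
       "\<not> Suc m < par_rank (Suc c) (fst y)" "Suc m \<noteq> par_rank (Suc c) (fst y)"
      using r that by auto
    ultimately show ?thesis using that unfolding jump_times_def mgp_flow_def by auto
  qed
  show ?thesis
    using 1 2 3 unfolding agree_def moran_jump_eq by (auto simp: mgp_flow_def)
qed

subsection \<open>Exponential interval lengths\<close>

definition half_lborel :: "real measure" where
  "half_lborel = restrict_space lborel {0..}"

definition exp_measure :: "real \<Rightarrow> real measure" where
  "exp_measure l = density half_lborel (\<lambda>x. ennreal (l * exp (- l * x)))"

lemma sets_half_lborel: "sets half_lborel = sets (restrict_space borel {0..})"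
  unfolding half_lborel_def by (intro sets_restrict_space_cong) simp

lemma space_half_lborel [simp]: "space half_lborel = {0..}"
  unfolding half_lborel_def by (simp add: space_restrict_space)

lemma sets_exp_measure [measurable_cong]: "sets (exp_measure l) = sets half_lborel"
  unfolding exp_measure_def by simp

lemma space_exp_measure [simp]: "space (exp_measure l) = {0..}"
  unfolding exp_measure_def by simp

lemma measurable_half_lborel: "f \<in> borel \<rightarrow>\<^sub>M N \<Longrightarrow> f \<in> half_lborel \<rightarrow>\<^sub>M N"
  using measurable_restrict_space1 measurable_cong_sets[OF sets_half_lborel refl] by blast

lemma measurable_exp_measure: "f \<in> borel \<rightarrow>\<^sub>M N \<Longrightarrow> f \<in> exp_measure l \<rightarrow>\<^sub>M N"
  using measurable_half_lborel measurable_cong_sets[OF sets_exp_measure refl] by blast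

lemma nn_integral_half_lborel:
  "(\<integral>\<^sup>+x. f x \<partial>half_lborel) = (\<integral>\<^sup>+x. f x * indicator {0..} x \<partial>lborel)"
  unfolding half_lborel_def by (rule nn_integral_restrict_space) simp

lemma nn_integral_exp_measure:
  assumes "f \<in> borel_measurable borel"
  shows "(\<integral>\<^sup>+x. f x \<partial>exp_measure l) = (\<integral>\<^sup>+x. ennreal (l * exp (- l * x)) * f x * indicator {0..} x \<partial>lborel)"
  unfolding exp_measure_def
  by (subst nn_integral_density) (auto simp: nn_integral_half_lborel intro!: measurable_half_lborel assms)

lemma emeasure_space_exp_measure:
  assumes "0 < l"
  shows "emeasure (exp_measure l) {0..} = 1"
proof -
  have "emeasure (exp_measure l) (space (exp_measure l)) = (\<integral>\<^sup>+x. 1 \<partial>exp_measure l)" by simp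
  also have "\<dots> = (\<integral>\<^sup>+x. ennreal (l * exp (- l * x)) * indicator {0..} x \<partial>lborel)"
    by (subst nn_integral_exp_measure) auto
  also have "\<dots> = ennreal (0 - (- exp (- l * 0)))"
  proof (rule nn_integral_FTC_atLeast)
    show "((\<lambda>x. - exp (- l * x)) has_real_derivative l * exp (- l * x)) (at x)" for x
      by (auto intro!: derivative_eq_intros)
    have "((\<lambda>x. exp (- l * x)) \<longlongrightarrow> 0) at_top"
    proof (rule filterlim_compose[OF exp_at_bot])
      show "LIM x at_top. - l * x :> at_bot"
        using assms by (intro filterlim_tendsto_neg_mult_at_bot[OF tendsto_const] filterlim_ident) auto
    qed
    then show "((\<lambda>x. - exp (- l * x)) \<longlongrightarrow> 0) at_top"
      using tendsto_minus by fastforce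
  qed (use assms in auto)
  finally show ?thesis by simp
qed

lemma prob_space_exp_measure: "0 < l \<Longrightarrow> prob_space (exp_measure l)"
  by (intro prob_spaceI) (simp add: emeasure_space_exp_measure)

lemma sigma_finite_half_lborel: "sigma_finite_measure half_lborel"
  unfolding half_lborel_def
  by (rule sigma_finite_measure_restrict_space[OF lborel.sigma_finite_measure_axioms]) simp

lemma nn_integral_exp_measure_convolution:
  assumes [measurable]: "F \<in> borel_measurable borel" and ab: "0 < a" "a < b"
  shows "(\<integral>\<^sup>+y. \<integral>\<^sup>+x. F (x + y) \<partial>exp_measure a \<partial>exp_measure b)
    = (\<integral>\<^sup>+z. ennreal (a * b / (b - a) * (exp (- a * z) - exp (- b * z))) * F z * indicator {0..} z \<partial>lborel)"
proof -
  let ?q = "\<lambda>z y. ennreal (a * b * (exp (- a * z) * exp (- (b - a) * y)))"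
  let ?c = "\<lambda>z. ennreal (a * b / (b - a) * (exp (- a * z) - exp (- b * z)))"
  let ?I = "\<lambda>y. \<integral>\<^sup>+z. ennreal (a * exp (- a * (z - y))) * F z * indicator {0..} (z - y) \<partial>lborel"
  have "(\<integral>\<^sup>+y. \<integral>\<^sup>+x. F (x + y) \<partial>exp_measure a \<partial>exp_measure b)
    = (\<integral>\<^sup>+y. \<integral>\<^sup>+x. ennreal (a * exp (- a * x)) * F (x + y) * indicator {0..} x \<partial>lborel \<partial>exp_measure b)"
    by (intro nn_integral_cong nn_integral_exp_measure) simp
  also have "\<dots> = (\<integral>\<^sup>+y. \<integral>\<^sup>+z. ennreal (a * exp (- a * (z - y))) * F z * indicator {0..} (z - y) \<partial>lborel \<partial>exp_measure b)"
  proof (rule nn_integral_cong)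
    fix y :: real
    show "(\<integral>\<^sup>+x. ennreal (a * exp (- a * x)) * F (x + y) * indicator {0..} x \<partial>lborel)
      = ?I y"
      by (subst nn_integral_real_affine[of _ 1 "-y"]) (simp_all add: algebra_simps)
  qed
  also have "\<dots> = (\<integral>\<^sup>+y. ennreal (b * exp (- b * y)) *
      ?I y * indicator {0..} y \<partial>lborel)"
    by (rule nn_integral_exp_measure) measurable
  also have "\<dots> = (\<integral>\<^sup>+y. \<integral>\<^sup>+z. ?q z y * F z * indicator {0..z} y \<partial>lborel \<partial>lborel)"
  proof (rule nn_integral_cong)
    fix y :: real
    have "ennreal (b * exp (- b * y)) *
      ?I y * indicator {0..} y
      = (\<integral>\<^sup>+z. ennreal (b * exp (- b * y)) * (ennreal (a * exp (- a * (z - y))) * F z * indicator {0..} (z - y)) * indicator {0..} y \<partial>lborel)"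
      by (simp add: nn_integral_cmult nn_integral_multc)
    also have "\<dots> = (\<integral>\<^sup>+z. ?q z y * F z * indicator {0..z} y \<partial>lborel)"
    proof (rule nn_integral_cong)
      fix z :: real
      have "?q z y = ennreal (b * exp (- b * y)) * ennreal (a * exp (- a * (z - y)))"
        using ab by (subst ennreal_mult[symmetric]) (auto simp: mult_exp_exp algebra_simps)
      then show "ennreal (b * exp (- b * y)) * (ennreal (a * exp (- a * (z - y))) * F z * indicator {0..} (z - y)) * indicator {0..} y
         = ?q z y * F z * indicator {0..z} y"
        by (auto split: split_indicator simp: mult.assoc)
    qed
    finally show "ennreal (b * exp (- b * y)) *
      ?I y * indicator {0..} y
      = (\<integral>\<^sup>+z. ?q z y * F z * indicator {0..z} y \<partial>lborel)" .
  qed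
  also have "\<dots> = (\<integral>\<^sup>+z. \<integral>\<^sup>+y. ?q z y * F z * indicator {0..z} y \<partial>lborel \<partial>lborel)"
    by (rule lborel_pair.Fubini') (measurable, simp)
  also have "\<dots> = (\<integral>\<^sup>+z. ?c z * F z * indicator {0..} z \<partial>lborel)"
  proof (rule nn_integral_cong)
    fix z :: real
    have "(\<integral>\<^sup>+y. ?q z y * F z * indicator {0..z} y \<partial>lborel)
       = (\<integral>\<^sup>+y. (?q z y * indicator {0..z} y) * F z \<partial>lborel)"
      by (intro nn_integral_cong) (simp add: mult_ac)
    also have "\<dots> = (\<integral>\<^sup>+y. ?q z y * indicator {0..z} y \<partial>lborel) * F z"
      by (rule nn_integral_multc) simp
    also have "(\<integral>\<^sup>+y. ?q z y * indicator {0..z} y \<partial>lborel)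
      = ?c z * indicator {0..} z"
    proof (cases "0 \<le> z")
      case True
      have "(\<integral>\<^sup>+y. ?q z y * indicator {0..z} y \<partial>lborel)
        = ennreal ((- (a * b / (b - a) * (exp (- a * z) * exp (- (b - a) * z)))) - (- (a * b / (b - a) * (exp (- a * z) * exp (- (b - a) * 0)))))"
      proof (rule nn_integral_FTC_Icc)
        fix y
        have D: "((\<lambda>y. - (a * b / d * (exp (- a * z) * exp (- d * y)))) has_real_derivative
            a * b * (exp (- a * z) * exp (- d * y))) (at y)" if "d > 0" for d
          using that by (auto intro!: derivative_eq_intros)
        show "((\<lambda>y. - (a * b / (b - a) * (exp (- a * z) * exp (- (b - a) * y)))) has_real_derivative
            a * b * (exp (- a * z) * exp (- (b - a) * y))) (at y)" by (rule D) (use ab in simp)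
      qed (use ab True in auto)
      also have "exp (- a * z) * exp (- (b - a) * z) = exp (- b * z)"
        by (simp add: mult_exp_exp algebra_simps)
      finally show ?thesis using True by (simp add: algebra_simps)
    qed (auto simp: indicator_def)
    finally show "(\<integral>\<^sup>+y. ?q z y * F z * indicator {0..z} y \<partial>lborel)
      = ?c z * F z * indicator {0..} z"
      by (simp add: mult_ac)
  qed
  finally show ?thesis .
qed

text \<open>The rates of consecutive coalescent intervals are \<open>(r - 1) r \<kappa>\<close> and \<open>r (r + 1) \<kappa>\<close>.\<close>

lemma exp_measure_merge:
  fixes r :: nat
  assumes [measurable]: "F \<in> borel_measurable borel" and r: "2 \<le> r" and k: "0 < \<kappa>"
    and a: "a = (real r - 1) * real r * \<kappa>" and b: "b = real r * (real r + 1) * \<kappa>"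
  shows "2 * (\<integral>\<^sup>+y. \<integral>\<^sup>+x. F (x + y) \<partial>exp_measure a \<partial>exp_measure b) + of_nat (r - 1) * (\<integral>\<^sup>+y. F y \<partial>exp_measure b)
    = of_nat (r + 1) * (\<integral>\<^sup>+x. F x \<partial>exp_measure a)"
proof -
  have ab: "0 < a" "a < b" using r k unfolding a b by (auto intro!: mult_strict_right_mono simp: algebra_simps)
  have ba: "b - a = 2 * real r * \<kappa>" unfolding a b by (simp add: algebra_simps)
  have c: "2 * (a * b / (b - a)) = (real r - 1) * b" "(real r + 1) * a = (real r - 1) * b"
    using r k unfolding ba by (simp_all add: a b field_simps)
  have r1: "of_nat (r - 1) = ennreal (real r - 1)" "of_nat (r + 1) = ennreal (real r + 1)"
    using r by (simp_all add: ennreal_of_nat_eq_real_of_nat of_nat_diff)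
  have "2 * (\<integral>\<^sup>+y. \<integral>\<^sup>+x. F (x + y) \<partial>exp_measure a \<partial>exp_measure b) + of_nat (r - 1) * (\<integral>\<^sup>+y. F y \<partial>exp_measure b)
    = (\<integral>\<^sup>+z. 2 * (ennreal (a * b / (b - a) * (exp (- a * z) - exp (- b * z))) * F z * indicator {0..} z)
       + of_nat (r - 1) * (ennreal (b * exp (- b * z)) * F z * indicator {0..} z) \<partial>lborel)"
    unfolding nn_integral_exp_measure_convolution[OF assms(1) ab] nn_integral_exp_measure[OF assms(1)]
    by (subst nn_integral_add) (auto simp: nn_integral_cmult)
  also have "\<dots> = (\<integral>\<^sup>+z. of_nat (r + 1) * (ennreal (a * exp (- a * z)) * F z * indicator {0..} z) \<partial>lborel)"
  proof (rule nn_integral_cong)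
    fix z :: real
    show "2 * (ennreal (a * b / (b - a) * (exp (- a * z) - exp (- b * z))) * F z * indicator {0..} z)
       + of_nat (r - 1) * (ennreal (b * exp (- b * z)) * F z * indicator {0..} z)
      = of_nat (r + 1) * (ennreal (a * exp (- a * z)) * F z * indicator {0..} z)"
    proof (cases "0 \<le> z")
      case True
      let ?u = "a * b / (b - a) * (exp (- a * z) - exp (- b * z))"
      have le: "exp (- b * z) \<le> exp (- a * z)" using ab True by (simp add: mult_right_mono)
      have u: "0 \<le> ?u" using ab le by (intro mult_nonneg_nonneg) auto
      have "2 * ?u + (real r - 1) * (b * exp (- b * z)) = (2 * (a * b / (b - a))) * (exp (- a * z) - exp (- b * z)) + (real r - 1) * b * exp (- b * z)"
        by simp
      also have "\<dots> = ((real r + 1) * a) * exp (- a * z)"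
        unfolding c by (simp add: algebra_simps)
      finally have "2 * ?u + (real r - 1) * (b * exp (- b * z)) = (real r + 1) * (a * exp (- a * z))" by simp
      moreover have "2 * ennreal ?u + ennreal (real r - 1) * ennreal (b * exp (- b * z))
          = ennreal (2 * ?u + (real r - 1) * (b * exp (- b * z)))"
      proof -
        have "2 * ennreal q + ennreal s * ennreal v = ennreal (2 * q + s * v)"
          if "0 \<le> q" "0 \<le> s" "0 \<le> v" for q s v
          using that by (simp add: ennreal_mult)
        then show ?thesis using u ab r by simp
      qed
      moreover have "ennreal (real r + 1) * ennreal (a * exp (- a * z)) = ennreal ((real r + 1) * (a * exp (- a * z)))"
        using ab by (subst ennreal_mult) auto
      ultimately have "(2 * ennreal ?u + ennreal (real r - 1) * ennreal (b * exp (- b * z))) * F z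
          = (ennreal (real r + 1) * ennreal (a * exp (- a * z))) * F z" by simp
      then show ?thesis using True unfolding r1 by (simp add: distrib_right mult.assoc)
    qed simp
  qed
  also have "\<dots> = of_nat (r + 1) * (\<integral>\<^sup>+x. F x \<partial>exp_measure a)"
    by (simp add: nn_integral_cmult nn_integral_exp_measure)
  finally show ?thesis .
qed

lemma nn_integral_exponential_density:
  assumes [measurable]: "F \<in> borel_measurable borel" and "0 < l"
  shows "(\<integral>\<^sup>+h. F h \<partial>density lborel (exponential_density l)) = (\<integral>\<^sup>+h. F h \<partial>exp_measure l)"
proof -
  have "(\<integral>\<^sup>+h. F h \<partial>density lborel (exponential_density l)) = (\<integral>\<^sup>+h. ennreal (exponential_density l h) * F h \<partial>lborel)"
    by (rule nn_integral_density) auto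
  also have "\<dots> = (\<integral>\<^sup>+x. ennreal (l * exp (- l * x)) * F x * indicator {0..} x \<partial>lborel)"
    by (intro nn_integral_cong) (auto simp: exponential_density_def mult.commute split: split_indicator)
  finally show ?thesis by (simp add: nn_integral_exp_measure)
qed

lemma exp_measure_memoryless:
  assumes [measurable]: "F \<in> borel_measurable borel" and "0 < l" "0 \<le> t"
  shows "ennreal (exp (- l * t)) * (\<integral>\<^sup>+a. F (a + t) \<partial>exp_measure l) + (\<integral>\<^sup>+h. indicator {..t} h * F h \<partial>exp_measure l)
     = (\<integral>\<^sup>+a. F a \<partial>exp_measure l)"
proof -
  have "ennreal (exp (- l * t)) * (\<integral>\<^sup>+a. F (a + t) \<partial>exp_measure l)
    = (\<integral>\<^sup>+a. ennreal (exp (- l * t)) * (ennreal (l * exp (- l * a)) * F (a + t) * indicator {0..} a) \<partial>lborel)"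
    by (simp add: nn_integral_exp_measure nn_integral_cmult)
  also have "\<dots> = (\<integral>\<^sup>+a. ennreal (l * exp (- l * (a + t))) * F (a + t) * indicator {t..} (a + t) \<partial>lborel)"
  proof (rule nn_integral_cong)
    fix a :: real
    have "ennreal (l * exp (- l * (a + t))) = ennreal (exp (- l * t)) * ennreal (l * exp (- l * a))"
      using assms by (subst ennreal_mult[symmetric]) (auto simp: mult_exp_exp algebra_simps)
    then show "ennreal (exp (- l * t)) * (ennreal (l * exp (- l * a)) * F (a + t) * indicator {0..} a)
       = ennreal (l * exp (- l * (a + t))) * F (a + t) * indicator {t..} (a + t)"
      by (auto simp: mult.assoc split: split_indicator)
  qed
  also have "\<dots> = (\<integral>\<^sup>+a. ennreal (l * exp (- l * a)) * F a * indicator {t..} a \<partial>lborel)"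
    by (subst (2) nn_integral_real_affine[of _ 1 t]) (simp_all add: add.commute)
  finally have 1: "ennreal (exp (- l * t)) * (\<integral>\<^sup>+a. F (a + t) \<partial>exp_measure l)
     = (\<integral>\<^sup>+a. ennreal (l * exp (- l * a)) * F a * indicator {t..} a \<partial>lborel)" .
  have 2: "(\<integral>\<^sup>+h. indicator {..t} h * F h \<partial>exp_measure l)
     = (\<integral>\<^sup>+h. ennreal (l * exp (- l * h)) * (indicator {..t} h * F h) * indicator {0..} h \<partial>lborel)"
    by (rule nn_integral_exp_measure) simp
  have "(\<integral>\<^sup>+a. ennreal (l * exp (- l * a)) * F a * indicator {t..} a \<partial>lborel)
     + (\<integral>\<^sup>+h. ennreal (l * exp (- l * h)) * (indicator {..t} h * F h) * indicator {0..} h \<partial>lborel)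
     = (\<integral>\<^sup>+a. ennreal (l * exp (- l * a)) * F a * indicator {t..} a
          + ennreal (l * exp (- l * a)) * (indicator {..t} a * F a) * indicator {0..} a \<partial>lborel)"
    by (rule nn_integral_add[symmetric]) auto
  also have "\<dots> = (\<integral>\<^sup>+a. ennreal (l * exp (- l * a)) * F a * indicator {0..} a \<partial>lborel)"
  proof (rule nn_integral_cong_AE)
    have "AE a in lborel. a \<noteq> t" by (rule AE_lborel_singleton)
    then show "AE a in lborel. ennreal (l * exp (- l * a)) * F a * indicator {t..} a
          + ennreal (l * exp (- l * a)) * (indicator {..t} a * F a) * indicator {0..} a
        = ennreal (l * exp (- l * a)) * F a * indicator {0..} a"
      by eventually_elim (use assms in \<open>auto split: split_indicator\<close>)
  qed
  finally show ?thesis unfolding 1 2 by (simp add: nn_integral_exp_measure)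
qed

subsection \<open>The stationary measure\<close>

definition coal_rate :: "nat \<Rightarrow> real \<Rightarrow> nat \<Rightarrow> real" where
  "coal_rate n \<mu> j = real (Suc j choose 2) / real (n choose 2) * \<mu>"

lemma real_choose_two: "real (m choose 2) = real m * (real m - 1) / 2"
  by (cases m) (auto simp: choose_two field_simps real_of_nat_div even_mult_iff)

lemma coal_rate_eq:
  assumes "n \<ge> 2"
  shows "coal_rate n \<mu> j = real j * (real j + 1) * (\<mu> / (real n * (real n - 1)))"
  using assms unfolding coal_rate_def real_choose_two by (simp add: field_simps)

lemma coal_rate_pos:
  assumes "n \<ge> 2" "\<mu> > 0" "j \<ge> 1"
  shows "coal_rate n \<mu> j > 0"
  using assms unfolding coal_rate_eq[OF assms(1)] by (intro mult_pos_pos divide_pos_pos) auto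

lemma coal_rate_last:
  assumes "n \<ge> 2"
  shows "coal_rate n \<mu> (n - 1) = \<mu>"
  using assms unfolding coal_rate_eq[OF assms(1)] by (simp add: of_nat_diff)

definition stat_times :: "nat \<Rightarrow> real \<Rightarrow> (nat \<Rightarrow> real) measure" where
  "stat_times n \<mu> = (\<Pi>\<^sub>M j\<in>{1..<n}. exp_measure (coal_rate n \<mu> j))"

text \<open>Unlike \<open>state_space\<close>, this space is preserved by \<open>mgp_flow\<close> and \<open>moran_jump\<close> for all values
  of the noise, including the null set of negative waiting times and invalid pairs.\<close>

definition big_space :: "nat \<Rightarrow> ((nat \<Rightarrow> nat set set) \<times> (nat \<Rightarrow> real)) measure" where
  "big_space n = count_space UNIV \<Otimes>\<^sub>M (\<Pi>\<^sub>M j\<in>{1..<n}. borel)"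

lemma space_state_space: "space (state_space n) = state_set n"
  unfolding state_space_def state_set_def
  by (simp add: space_pair_measure space_PiM space_restrict_space)

lemma state_space_half: "state_space n = count_space (ranked_trees n) \<Otimes>\<^sub>M (\<Pi>\<^sub>M i\<in>{1..<n}. half_lborel)"
  unfolding state_space_def half_lborel_def ..

lemma measurable_component_half:
  assumes "j \<in> I" "f \<in> borel_measurable borel"
  shows "(\<lambda>s. f (s j)) \<in> borel_measurable (\<Pi>\<^sub>M i\<in>I. half_lborel)"
proof -
  have "(\<lambda>s. s j) \<in> (\<Pi>\<^sub>M i\<in>I. half_lborel) \<rightarrow>\<^sub>M half_lborel" using assms(1) by simp
  from measurable_compose[OF this measurable_half_lborel[OF assms(2)]] show ?thesis .
qed

lemma measurable_PiM_half_borel: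
  "(\<lambda>s. s) \<in> (\<Pi>\<^sub>M i\<in>I. half_lborel) \<rightarrow>\<^sub>M (\<Pi>\<^sub>M i\<in>I. borel)"
proof (rule measurable_PiM_single')
  show "(\<lambda>s. s j) \<in> borel_measurable (\<Pi>\<^sub>M i\<in>I. half_lborel)" if "j \<in> I" for j
    using measurable_component_half[OF that, of "\<lambda>x. x"] by simp
qed (auto simp: space_PiM)

lemma measurable_state_big: "(\<lambda>x. x) \<in> state_space n \<rightarrow>\<^sub>M big_space n"
proof -
  have "(\<lambda>x. (fst x, snd x)) \<in> state_space n \<rightarrow>\<^sub>M big_space n"
    unfolding state_space_half big_space_def
  proof (rule measurable_Pair)
    have "(\<lambda>B. B) \<in> count_space (ranked_trees n) \<rightarrow>\<^sub>M count_space UNIV" by simp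
    then show "fst \<in> count_space (ranked_trees n) \<Otimes>\<^sub>M (\<Pi>\<^sub>M i\<in>{1..<n}. half_lborel) \<rightarrow>\<^sub>M count_space UNIV"
      using measurable_compose[OF measurable_fst] by blast
    show "snd \<in> count_space (ranked_trees n) \<Otimes>\<^sub>M (\<Pi>\<^sub>M i\<in>{1..<n}. half_lborel) \<rightarrow>\<^sub>M (\<Pi>\<^sub>M j\<in>{1..<n}. borel)"
      using measurable_compose[OF measurable_snd measurable_PiM_half_borel] by blast
  qed
  then show ?thesis by simp
qed

lemma measurable_big_state: "f \<in> big_space n \<rightarrow>\<^sub>M N \<Longrightarrow> f \<in> state_space n \<rightarrow>\<^sub>M N"
  using measurable_compose[OF measurable_state_big] by blast

lemma sets_stat_times: "sets (stat_times n \<mu>) = sets (\<Pi>\<^sub>M i\<in>{1..<n}. half_lborel)"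
  unfolding stat_times_def by (rule sets_PiM_cong) (simp_all add: sets_exp_measure)

lemma measurable_stat_times: "f \<in> (\<Pi>\<^sub>M j\<in>{1..<n}. borel) \<rightarrow>\<^sub>M N \<Longrightarrow> f \<in> stat_times n \<mu> \<rightarrow>\<^sub>M N"
  using measurable_compose[OF measurable_PiM_half_borel]
  by (subst measurable_cong_sets[OF sets_stat_times refl]) blast

lemma stat_times_density:
  assumes "n \<ge> 2" "\<mu> > 0"
  shows "density (\<Pi>\<^sub>M i\<in>{1..<n}. half_lborel)
     (\<lambda>s. \<Prod>j\<in>{1..<n}. ennreal (coal_rate n \<mu> j * exp (- coal_rate n \<mu> j * s j))) = stat_times n \<mu>"
proof -
  let ?l = "coal_rate n \<mu>"
  let ?M = "\<lambda>j. exp_measure (if j \<ge> 1 then ?l j else 1)"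
  interpret P: product_sigma_finite "\<lambda>_::nat. half_lborel"
    by (intro product_sigma_finite.intro sigma_finite_half_lborel)
  interpret E: product_sigma_finite ?M
    using coal_rate_pos[OF assms]
    by (intro product_sigma_finite.intro prob_space_imp_sigma_finite prob_space_exp_measure) auto
  have eq: "stat_times n \<mu> = PiM {1..<n} ?M" unfolding stat_times_def by (rule PiM_cong) auto
  have [measurable]: "(\<lambda>x. ennreal (?l j * exp (- ?l j * x))) \<in> borel_measurable half_lborel" for j
    by (rule measurable_half_lborel) measurable
  show ?thesis unfolding eq
  proof (rule E.PiM_eqI)
    show "sets (density (\<Pi>\<^sub>M i\<in>{1..<n}. half_lborel) (\<lambda>s. \<Prod>j\<in>{1..<n}. ennreal (?l j * exp (- ?l j * s j))))
       = sets (PiM {1..<n} ?M)"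
      unfolding eq[symmetric] sets_stat_times by simp
  next
    fix A assume A: "\<And>j. j \<in> {1..<n} \<Longrightarrow> A j \<in> sets (?M j)"
    then have A': "A j \<in> sets half_lborel" if "j \<in> {1..<n}" for j using that by (auto simp: sets_exp_measure)
    have "emeasure (density (\<Pi>\<^sub>M i\<in>{1..<n}. half_lborel) (\<lambda>s. \<Prod>j\<in>{1..<n}. ennreal (?l j * exp (- ?l j * s j)))) (Pi\<^sub>E {1..<n} A)
       = (\<integral>\<^sup>+s. (\<Prod>j\<in>{1..<n}. ennreal (?l j * exp (- ?l j * s j))) * indicator (Pi\<^sub>E {1..<n} A) s \<partial>(\<Pi>\<^sub>M i\<in>{1..<n}. half_lborel))"
      using A' by (intro emeasure_density borel_measurable_prod_ennreal sets_PiM_I_finite measurable_component_half) auto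
    also have "\<dots> = (\<integral>\<^sup>+s. (\<Prod>j\<in>{1..<n}. ennreal (?l j * exp (- ?l j * s j)) * indicator (A j) (s j)) \<partial>(\<Pi>\<^sub>M i\<in>{1..<n}. half_lborel))"
    proof (rule nn_integral_cong)
      fix s assume "s \<in> space (\<Pi>\<^sub>M i\<in>{1..<n}. half_lborel)"
      then have s: "s \<in> extensional {1..<n}" by (auto simp: space_PiM PiE_def)
      have "indicator (Pi\<^sub>E {1..<n} A) s = (\<Prod>j\<in>{1..<n}. indicator (A j) (s j) :: ennreal)"
      proof (cases "s \<in> Pi\<^sub>E {1..<n} A")
        case True
        then show ?thesis by (auto simp: PiE_iff intro!: prod.neutral[symmetric])
      next
        case False
        then obtain j where "j \<in> {1..<n}" "s j \<notin> A j" using s by (auto simp: PiE_iff)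
        then show ?thesis using False by (auto simp: prod_zero_iff intro!: bexI[of _ j])
      qed
      then show "(\<Prod>j\<in>{1..<n}. ennreal (?l j * exp (- ?l j * s j))) * indicator (Pi\<^sub>E {1..<n} A) s
        = (\<Prod>j\<in>{1..<n}. ennreal (?l j * exp (- ?l j * s j)) * indicator (A j) (s j))"
        by (simp add: prod.distrib)
    qed
    also have "\<dots> = (\<Prod>j\<in>{1..<n}. \<integral>\<^sup>+x. ennreal (?l j * exp (- ?l j * x)) * indicator (A j) x \<partial>half_lborel)"
      using A' by (intro P.product_nn_integral_prod borel_measurable_times_ennreal borel_measurable_indicator
          measurable_half_lborel) auto
    also have "\<dots> = (\<Prod>j\<in>{1..<n}. emeasure (?M j) (A j))"
    proof (rule prod.cong[OF refl])
      fix j assume j: "j \<in> {1..<n}"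
      have m: "(\<lambda>x. ennreal (?l j * exp (- ?l j * x))) \<in> borel_measurable half_lborel"
        by (rule measurable_half_lborel) simp
      show "(\<integral>\<^sup>+x. ennreal (?l j * exp (- ?l j * x)) * indicator (A j) x \<partial>half_lborel) = emeasure (?M j) (A j)"
        using emeasure_density[OF m A'[OF j]] j by (simp add: exp_measure_def)
    qed
    finally show "emeasure (density (\<Pi>\<^sub>M i\<in>{1..<n}. half_lborel) (\<lambda>s. \<Prod>j\<in>{1..<n}. ennreal (?l j * exp (- ?l j * s j)))) (Pi\<^sub>E {1..<n} A)
        = (\<Prod>j\<in>{1..<n}. emeasure (?M j) (A j))" .
  qed simp
qed

lemma nn_integral_mgp_stationary:
  assumes "n \<ge> 2" "\<mu> > 0" and [measurable]: "f \<in> borel_measurable (state_space n)"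
  shows "(\<integral>\<^sup>+x. f x \<partial>mgp_stationary n \<mu>)
     = (\<Sum>B\<in>ranked_trees n. ennreal (1 / card (ranked_trees n)) * (\<integral>\<^sup>+s. f (B, s) \<partial>stat_times n \<mu>))"
proof -
  let ?l = "coal_rate n \<mu>" and ?W = "ranked_trees n"
  let ?H = "\<Pi>\<^sub>M i\<in>{1..<n}. half_lborel"
  let ?d = "\<lambda>s. (\<mu> / real (n choose 2)) ^ (n - 1) *
        exp (- (\<Sum>j=1..n-1. real (Suc j choose 2) / real (n choose 2) * \<mu> * s j))"
  let ?p = "\<lambda>s. \<Prod>j\<in>{1..<n}. ennreal (?l j * exp (- ?l j * s j))"
  interpret P: product_sigma_finite "\<lambda>_::nat. half_lborel"
    by (intro product_sigma_finite.intro sigma_finite_half_lborel)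
  interpret H: sigma_finite_measure ?H by (rule P.sigma_finite) simp
  have W: "finite ?W" "card ?W = (\<Prod>j=1..n-1. Suc j choose 2)"
    using card_ranked_trees assms(1) by auto
  have I: "{1..n-1} = {1..<n}" using assms(1) by auto
  have [measurable]: "(\<lambda>s. \<Sum>j\<in>{1..<n}. real (Suc j choose 2) / real (n choose 2) * \<mu> * s j) \<in> borel_measurable ?H"
    by (intro borel_measurable_sum measurable_component_half) auto
  have [measurable]: "?d \<in> borel_measurable ?H" unfolding I by measurable
  have cpos: "card ?W > 0" unfolding W(2) by (intro prod_pos) (auto simp: zero_less_binomial_iff)
  have d: "ennreal (?d s) = ennreal (1 / card ?W) * ?p s" for s
  proof -
    have "?p s = ennreal (\<Prod>j\<in>{1..<n}. ?l j * exp (- ?l j * s j))"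
      using coal_rate_pos[OF assms(1,2)] by (intro prod_ennreal mult_nonneg_nonneg) (auto intro: less_imp_le)
    also have "(\<Prod>j\<in>{1..<n}. ?l j * exp (- ?l j * s j)) = (\<Prod>j\<in>{1..<n}. ?l j) * exp (- (\<Sum>j\<in>{1..<n}. ?l j * s j))"
      by (simp add: prod.distrib exp_sum sum_negf[symmetric])
    also have "(\<Prod>j\<in>{1..<n}. ?l j) = card ?W * (\<mu> / real (n choose 2)) ^ (n - 1)"
    proof -
      have "(\<Prod>j\<in>{1..<n}. ?l j) = (\<Prod>j\<in>{1..<n}. real (Suc j choose 2) * (\<mu> / real (n choose 2)))"
        unfolding coal_rate_def by (intro prod.cong) auto
      also have "\<dots> = real (card ?W) * (\<mu> / real (n choose 2)) ^ (n - 1)"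
        unfolding W(2) I by (simp only: prod.distrib prod_constant card_atLeastLessThan of_nat_prod)
      finally show ?thesis .
    qed
    also have "ennreal (1 / card ?W) * ennreal (card ?W * (\<mu> / real (n choose 2)) ^ (n - 1) * exp (- (\<Sum>j\<in>{1..<n}. ?l j * s j)))
        = ennreal (?d s)"
      using cpos assms(2) unfolding I coal_rate_def by (subst ennreal_mult[symmetric]) (auto simp: mult.assoc)
    finally show ?thesis by simp
  qed
  have "(\<integral>\<^sup>+x. f x \<partial>mgp_stationary n \<mu>) = (\<integral>\<^sup>+x. ennreal (?d (snd x)) * f x \<partial>state_space n)"
    unfolding mgp_stationary_def
  proof (rule nn_integral_density)
    show "(\<lambda>x. ennreal (?d (snd x))) \<in> borel_measurable (state_space n)"
      unfolding state_space_half by measurable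
  qed measurable
  also have "\<dots> = (\<integral>\<^sup>+B. \<integral>\<^sup>+s. ennreal (?d s) * f (B, s) \<partial>?H \<partial>count_space ?W)"
  proof -
    have "(\<lambda>x. ennreal (?d (snd x)) * f x) \<in> borel_measurable (count_space ?W \<Otimes>\<^sub>M ?H)"
      using assms(3) unfolding state_space_half by measurable
    from H.nn_integral_fst[OF this] show ?thesis unfolding state_space_half by simp
  qed
  also have "\<dots> = (\<Sum>B\<in>?W. \<integral>\<^sup>+s. ennreal (?d s) * f (B, s) \<partial>?H)"
    by (rule nn_integral_count_space_finite[OF W(1)])
  also have "\<dots> = (\<Sum>B\<in>?W. ennreal (1 / card ?W) * (\<integral>\<^sup>+s. f (B, s) \<partial>stat_times n \<mu>))"
  proof (rule sum.cong[OF refl])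
    fix B assume B: "B \<in> ?W"
    have [measurable]: "(\<lambda>s. f (B, s)) \<in> borel_measurable ?H"
      using measurable_compose[OF measurable_Pair1'[of B "count_space ?W" ?H] assms(3)[unfolded state_space_half]] B
      by simp
    have [measurable]: "?p \<in> borel_measurable ?H"
      by (intro borel_measurable_prod_ennreal measurable_component_half) auto
    have "(\<integral>\<^sup>+s. ennreal (?d s) * f (B, s) \<partial>?H) = (\<integral>\<^sup>+s. ennreal (1 / card ?W) * (?p s * f (B, s)) \<partial>?H)"
      unfolding d by (simp add: mult.assoc)
    also have "\<dots> = ennreal (1 / card ?W) * (\<integral>\<^sup>+s. ?p s * f (B, s) \<partial>?H)"
      by (rule nn_integral_cmult) measurable
    also have "(\<integral>\<^sup>+s. ?p s * f (B, s) \<partial>?H) = (\<integral>\<^sup>+s. f (B, s) \<partial>stat_times n \<mu>)"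
      unfolding stat_times_density[OF assms(1,2), symmetric] by (rule nn_integral_density[symmetric]) measurable
    finally show "(\<integral>\<^sup>+s. ennreal (?d s) * f (B, s) \<partial>?H) = ennreal (1 / card ?W) * (\<integral>\<^sup>+s. f (B, s) \<partial>stat_times n \<mu>)" .
  qed
  finally show ?thesis .
qed

lemma prob_space_stat_times:
  assumes "n \<ge> 2" "\<mu> > 0"
  shows "prob_space (stat_times n \<mu>)"
  unfolding stat_times_def using coal_rate_pos[OF assms]
  by (intro prob_space_PiM prob_space_exp_measure) auto

lemma sets_mgp_stationary: "sets (mgp_stationary n \<mu>) = sets (state_space n)"
  unfolding mgp_stationary_def by simp

lemma prob_space_mgp_stationary:
  assumes "n \<ge> 2" "\<mu> > 0"
  shows "prob_space (mgp_stationary n \<mu>)"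
proof (rule prob_spaceI)
  interpret T: prob_space "stat_times n \<mu>" by (rule prob_space_stat_times[OF assms])
  have W: "finite (ranked_trees n)" "card (ranked_trees n) = (\<Prod>j=1..n-1. Suc j choose 2)"
    using card_ranked_trees assms(1) by auto
  have cpos: "card (ranked_trees n) > 0" unfolding W(2) by (intro prod_pos) (auto simp: zero_less_binomial_iff)
  have "emeasure (mgp_stationary n \<mu>) (space (mgp_stationary n \<mu>)) = (\<integral>\<^sup>+x. 1 \<partial>mgp_stationary n \<mu>)" by simp
  also have "\<dots> = (\<Sum>B\<in>ranked_trees n. ennreal (1 / card (ranked_trees n)) * (\<integral>\<^sup>+s. 1 \<partial>stat_times n \<mu>))"
    by (rule nn_integral_mgp_stationary[OF assms]) simp
  also have "\<dots> = of_nat (card (ranked_trees n)) * ennreal (1 / card (ranked_trees n))"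
    by (simp add: T.emeasure_space_1)
  also have "\<dots> = 1" using cpos
    by (simp add: ennreal_of_nat_eq_real_of_nat ennreal_mult[symmetric] del: of_nat_prod)
  finally show "emeasure (mgp_stationary n \<mu>) (space (mgp_stationary n \<mu>)) = 1" .
qed

definition skip_times :: "nat \<Rightarrow> nat \<Rightarrow> (nat \<Rightarrow> real) \<Rightarrow> nat \<Rightarrow> real" where
  "skip_times n r s = restrict (\<lambda>m. if m = n - 1 then 0 else if m < r then s m else s (Suc m)) {1..<n}"

lemma measurable_jump_times:
  "jump_times n r \<in> (\<Pi>\<^sub>M j\<in>{1..<n}. borel) \<rightarrow>\<^sub>M (\<Pi>\<^sub>M j\<in>{1..<n}. borel)"
  unfolding jump_times_def
proof (rule measurable_restrict)
  fix m assume m: "m \<in> {1..<n}"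
  have c: "(\<lambda>s. s j :: real) \<in> borel_measurable (\<Pi>\<^sub>M j\<in>{1..<n}. borel)" if "1 \<le> j" "j < n" for j :: nat
    using that by (intro measurable_component_singleton) auto
  consider "m = n - 1" | "m \<noteq> n - 1" "Suc m < r" | "m \<noteq> n - 1" "Suc m = r" | "m \<noteq> n - 1" "Suc m > r" by linarith
  then show "(\<lambda>s. if m = n - 1 then (0::real) else if Suc m < r then s m else if Suc m = r then s m + s (Suc m) else s (Suc m))
     \<in> borel_measurable (\<Pi>\<^sub>M j\<in>{1..<n}. borel)"
  proof cases
    case 3
    then have "1 \<le> m" "m < n" "1 \<le> Suc m" "Suc m < n" using m by auto
    from borel_measurable_add[OF c[OF this(1,2)] c[OF this(3,4)]] show ?thesis using 3 by simp
  qed (use m in \<open>auto intro!: c\<close>)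
qed

lemma measurable_skip_times:
  "skip_times n r \<in> (\<Pi>\<^sub>M j\<in>{1..<n}. borel) \<rightarrow>\<^sub>M (\<Pi>\<^sub>M j\<in>{1..<n}. borel)"
  unfolding skip_times_def
proof (rule measurable_restrict)
  fix m assume m: "m \<in> {1..<n}"
  have c: "(\<lambda>s. s j :: real) \<in> borel_measurable (\<Pi>\<^sub>M j\<in>{1..<n}. borel)" if "1 \<le> j" "j < n" for j :: nat
    using that by (intro measurable_component_singleton) auto
  consider "m = n - 1" | "m \<noteq> n - 1" "m < r" | "m \<noteq> n - 1" "m \<ge> r" by linarith
  then show "(\<lambda>s. if m = n - 1 then (0::real) else if m < r then s m else s (Suc m))
     \<in> borel_measurable (\<Pi>\<^sub>M j\<in>{1..<n}. borel)"
    using m by cases (auto intro!: c)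
qed

lemma stat_times_merge:
  assumes n: "n \<ge> 2" "\<mu> > 0" and r: "2 \<le> r" "r \<le> n - 1"
    and G [measurable]: "G \<in> borel_measurable (\<Pi>\<^sub>M j\<in>{1..<n}. borel)"
  shows "2 * (\<integral>\<^sup>+s. G (jump_times n r s) \<partial>stat_times n \<mu>)
      + of_nat (r - 1) * (\<integral>\<^sup>+s. G (skip_times n (r - 1) s) \<partial>stat_times n \<mu>)
    = of_nat (r + 1) * (\<integral>\<^sup>+s. G (skip_times n r s) \<partial>stat_times n \<mu>)"
proof -
  let ?l = "coal_rate n \<mu>"
  let ?M = "\<lambda>j. exp_measure (if j \<ge> 1 then ?l j else 1)"
  let ?I = "{1..<n} - {r - 1, r}"
  define K where "K s z = restrict (\<lambda>m. if m = n - 1 then 0 else if m < r - 1 then s m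
      else if m = r - 1 then z else s (Suc m)) {1..<n}" for s :: "nat \<Rightarrow> real" and z :: real
  interpret E: product_sigma_finite ?M
    using coal_rate_pos[OF n]
    by (intro product_sigma_finite.intro prob_space_imp_sigma_finite prob_space_exp_measure) auto
  have eq: "stat_times n \<mu> = PiM {1..<n} ?M" unfolding stat_times_def by (rule PiM_cong) auto
  have I: "{1..<n} = insert (r - 1) (insert r ?I)" using r by auto
  have ne: "r - 1 \<noteq> r" "r - 1 \<notin> insert r ?I" "r \<notin> ?I" "finite ?I" "finite (insert r ?I)" using r by auto
  have split: "(\<integral>\<^sup>+s. H s \<partial>stat_times n \<mu>)
      = (\<integral>\<^sup>+s. \<integral>\<^sup>+y. \<integral>\<^sup>+x. H (s(r := y, r - 1 := x)) \<partial>?M (r - 1) \<partial>?M r \<partial>PiM ?I ?M)"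
    if H: "H \<in> borel_measurable (\<Pi>\<^sub>M j\<in>{1..<n}. borel)" for H
  proof -
    have H': "H \<in> borel_measurable (PiM (insert (r - 1) (insert r ?I)) ?M)"
      using measurable_stat_times[OF H, of \<mu>] unfolding eq I[symmetric] .
    have H'': "(\<lambda>s. \<integral>\<^sup>+x. H (s(r - 1 := x)) \<partial>?M (r - 1)) \<in> borel_measurable (PiM (insert r ?I) ?M)"
    proof -
      have "(\<lambda>p. (fst p)(r - 1 := snd p)) \<in> PiM (insert r ?I) ?M \<Otimes>\<^sub>M ?M (r - 1) \<rightarrow>\<^sub>M PiM (insert (r - 1) (insert r ?I)) ?M"
        using measurable_add_dim[of "r - 1" "insert r ?I" ?M] by (simp add: case_prod_beta')
      from measurable_compose[OF this H'] show ?thesis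
        by (intro sigma_finite_measure.borel_measurable_nn_integral[OF E.sigma_finite_measures]) (simp add: case_prod_beta')
    qed
    have "(\<integral>\<^sup>+s. H s \<partial>stat_times n \<mu>) = (\<integral>\<^sup>+s. H s \<partial>PiM (insert (r - 1) (insert r ?I)) ?M)"
      unfolding eq I[symmetric] ..
    also have "\<dots> = (\<integral>\<^sup>+s. \<integral>\<^sup>+x. H (s(r - 1 := x)) \<partial>?M (r - 1) \<partial>PiM (insert r ?I) ?M)"
      by (rule E.product_nn_integral_insert[OF ne(5,2) H'])
    also have "\<dots> = (\<integral>\<^sup>+s. \<integral>\<^sup>+y. \<integral>\<^sup>+x. H (s(r := y, r - 1 := x)) \<partial>?M (r - 1) \<partial>?M r \<partial>PiM ?I ?M)"
      by (rule E.product_nn_integral_insert[OF ne(4,3) H''])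
    finally show ?thesis .
  qed
  have K: "jump_times n r (s(r := y, r - 1 := x)) = K s (x + y)"
    "skip_times n (r - 1) (s(r := y, r - 1 := x)) = K s y"
    "skip_times n r (s(r := y, r - 1 := x)) = K s x" for s x y
    using r unfolding jump_times_def skip_times_def K_def by (auto simp: restrict_def fun_eq_iff)
  have one: "(\<integral>\<^sup>+x. c \<partial>?M j) = c" for c :: ennreal and j
    using coal_rate_pos[OF n, of j] prob_space.emeasure_space_1[OF prob_space_exp_measure] by auto
  have mK: "(\<lambda>p. K (fst p) (snd p)) \<in> PiM ?I ?M \<Otimes>\<^sub>M borel \<rightarrow>\<^sub>M (\<Pi>\<^sub>M j\<in>{1..<n}. borel)"
    unfolding K_def
  proof (rule measurable_restrict)
    fix m assume m: "m \<in> {1..<n}"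
    have comp: "(\<lambda>p. fst p j) \<in> borel_measurable (PiM ?I ?M \<Otimes>\<^sub>M borel)" if "j \<in> ?I" for j
    proof -
      have "(\<lambda>s. s j) \<in> PiM ?I ?M \<rightarrow>\<^sub>M ?M j" using that by (rule measurable_component_singleton)
      moreover have "(\<lambda>x. x) \<in> ?M j \<rightarrow>\<^sub>M borel"
        by (rule measurable_exp_measure) simp
      ultimately have "(\<lambda>s. s j) \<in> PiM ?I ?M \<rightarrow>\<^sub>M borel" using measurable_compose by blast
      then show ?thesis using measurable_compose[OF measurable_fst] by blast
    qed
    consider "m = n - 1" | "m \<noteq> n - 1" "m < r - 1" | "m \<noteq> n - 1" "m = r - 1" | "m \<noteq> n - 1" "m > r - 1" by linarith
    then show "(\<lambda>p. if m = n - 1 then 0 else if m < r - 1 then fst p m else if m = r - 1 then snd p else fst p (Suc m))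
      \<in> borel_measurable (PiM ?I ?M \<Otimes>\<^sub>M borel)"
    proof cases
      case 2
      then have "m \<in> ?I" using m by simp
      from comp[OF this] show ?thesis using 2 by simp
    next
      case 4
      then have "Suc m \<in> ?I" using m by simp linarith
      from comp[OF this] show ?thesis using 4 by simp
    qed simp_all
  qed
  have GK [measurable]: "(\<lambda>p. G (K (fst p) (snd p))) \<in> borel_measurable (PiM ?I ?M \<Otimes>\<^sub>M borel)"
    using measurable_compose[OF mK G] .
  have FK: "(\<lambda>z. G (K s z)) \<in> borel_measurable borel" if "s \<in> space (PiM ?I ?M)" for s
    using measurable_compose[OF measurable_Pair1'[OF that] GK] by simp
  have idM: "(\<lambda>x. x) \<in> ?M j \<rightarrow>\<^sub>M borel" for j
    by (rule measurable_exp_measure) simp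
  have M1: "(\<lambda>s. \<integral>\<^sup>+x. G (K s x) \<partial>?M j) \<in> borel_measurable (PiM ?I ?M)" for j
  proof -
    have "(\<lambda>p. (fst p, snd p)) \<in> PiM ?I ?M \<Otimes>\<^sub>M ?M j \<rightarrow>\<^sub>M PiM ?I ?M \<Otimes>\<^sub>M borel"
      by (intro measurable_Pair measurable_fst measurable_compose[OF measurable_snd idM])
    from measurable_compose[OF this GK] show ?thesis
      by (intro sigma_finite_measure.borel_measurable_nn_integral[OF E.sigma_finite_measures]) (simp add: case_prod_beta')
  qed
  have M2: "(\<lambda>s. \<integral>\<^sup>+y. \<integral>\<^sup>+x. G (K s (x + y)) \<partial>?M (r - 1) \<partial>?M r) \<in> borel_measurable (PiM ?I ?M)"
  proof -
    have "(\<lambda>p. (fst (fst p), snd p + snd (fst p))) \<in> (PiM ?I ?M \<Otimes>\<^sub>M ?M r) \<Otimes>\<^sub>M ?M (r - 1) \<rightarrow>\<^sub>M PiM ?I ?M \<Otimes>\<^sub>M borel"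
      by (intro measurable_Pair borel_measurable_add measurable_compose[OF measurable_snd idM]
          measurable_compose[OF measurable_fst measurable_fst]
          measurable_compose[OF measurable_fst measurable_compose[OF measurable_snd idM]])
    from measurable_compose[OF this GK]
    have "(\<lambda>p. \<integral>\<^sup>+x. G (K (fst p) (x + snd p)) \<partial>?M (r - 1)) \<in> borel_measurable (PiM ?I ?M \<Otimes>\<^sub>M ?M r)"
      by (intro sigma_finite_measure.borel_measurable_nn_integral[OF E.sigma_finite_measures])
        (simp only: case_prod_beta' fst_conv snd_conv)
    then show ?thesis
      by (intro sigma_finite_measure.borel_measurable_nn_integral[OF E.sigma_finite_measures])
        (simp only: case_prod_beta' fst_conv snd_conv)
  qed
  have rates: "(if r \<ge> 1 then ?l r else 1) = real r * (real r + 1) * (\<mu> / (real n * (real n - 1)))"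
    "(if r - 1 \<ge> 1 then ?l (r - 1) else 1) = (real r - 1) * real r * (\<mu> / (real n * (real n - 1)))"
    using r coal_rate_eq[OF n(1)] by (auto simp: of_nat_diff)
  have kpos: "0 < \<mu> / (real n * (real n - 1))" using n by auto
  have mj: "(\<lambda>s. G (jump_times n r s)) \<in> borel_measurable (\<Pi>\<^sub>M j\<in>{1..<n}. borel)"
    using measurable_compose[OF measurable_jump_times G] .
  have ms: "(\<lambda>s. G (skip_times n q s)) \<in> borel_measurable (\<Pi>\<^sub>M j\<in>{1..<n}. borel)" for q
    using measurable_compose[OF measurable_skip_times G] .
  have L1: "(\<integral>\<^sup>+s. G (jump_times n r s) \<partial>stat_times n \<mu>)
      = (\<integral>\<^sup>+s. \<integral>\<^sup>+y. \<integral>\<^sup>+x. G (K s (x + y)) \<partial>?M (r - 1) \<partial>?M r \<partial>PiM ?I ?M)"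
    unfolding split[OF mj] K ..
  have L2: "(\<integral>\<^sup>+s. G (skip_times n (r - 1) s) \<partial>stat_times n \<mu>) = (\<integral>\<^sup>+s. \<integral>\<^sup>+y. G (K s y) \<partial>?M r \<partial>PiM ?I ?M)"
    using split[OF ms[of "r - 1"]] unfolding K one .
  have L3: "(\<integral>\<^sup>+s. G (skip_times n r s) \<partial>stat_times n \<mu>) = (\<integral>\<^sup>+s. \<integral>\<^sup>+x. G (K s x) \<partial>?M (r - 1) \<partial>PiM ?I ?M)"
    using split[OF ms[of r]] unfolding K one .
  have "2 * (\<integral>\<^sup>+s. \<integral>\<^sup>+y. \<integral>\<^sup>+x. G (K s (x + y)) \<partial>?M (r - 1) \<partial>?M r \<partial>PiM ?I ?M)
      + of_nat (r - 1) * (\<integral>\<^sup>+s. \<integral>\<^sup>+y. G (K s y) \<partial>?M r \<partial>PiM ?I ?M)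
     = (\<integral>\<^sup>+s. 2 * (\<integral>\<^sup>+y. \<integral>\<^sup>+x. G (K s (x + y)) \<partial>?M (r - 1) \<partial>?M r)
           + of_nat (r - 1) * (\<integral>\<^sup>+y. G (K s y) \<partial>?M r) \<partial>PiM ?I ?M)"
    using M1 M2 by (subst nn_integral_add) (auto simp: nn_integral_cmult)
  also have "\<dots> = (\<integral>\<^sup>+s. of_nat (r + 1) * (\<integral>\<^sup>+x. G (K s x) \<partial>?M (r - 1)) \<partial>PiM ?I ?M)"
    by (rule nn_integral_cong, rule exp_measure_merge[OF FK r(1) kpos rates(2) rates(1)])
  also have "\<dots> = of_nat (r + 1) * (\<integral>\<^sup>+s. \<integral>\<^sup>+x. G (K s x) \<partial>?M (r - 1) \<partial>PiM ?I ?M)"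
    using M1 by (rule nn_integral_cmult)
  finally show ?thesis unfolding L1 L2 L3 .
qed

lemma stat_times_jump_sum:
  assumes n: "n \<ge> 2" "\<mu> > 0" and G: "G \<in> borel_measurable (\<Pi>\<^sub>M j\<in>{1..<n}. borel)"
  shows "(\<Sum>r=1..n-1. of_nat (2 * r) * (\<integral>\<^sup>+s. G (jump_times n r s) \<partial>stat_times n \<mu>))
    = of_nat (n * (n - 1)) * (\<integral>\<^sup>+s. G (s(n - 1 := 0)) \<partial>stat_times n \<mu>)"
proof -
  let ?J = "\<lambda>r. \<integral>\<^sup>+s. G (jump_times n r s) \<partial>stat_times n \<mu>"
  let ?S = "\<lambda>r. \<integral>\<^sup>+s. G (skip_times n r s) \<partial>stat_times n \<mu>"
  have "(\<Sum>r=1..q. of_nat (2 * r) * ?J r) = of_nat (q * (q + 1)) * ?S q" if "1 \<le> q" "q \<le> n - 1" for q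
    using that
  proof (induction q rule: dec_induct)
    case base
    have "jump_times n 1 s = skip_times n 1 s" for s
      unfolding jump_times_def skip_times_def by (auto simp: restrict_def fun_eq_iff)
    then show ?case by (simp add: numeral_eq_Suc)
  next
    case (step q)
    let ?r = "Suc q"
    have "2 * ?J ?r + of_nat (?r - 1) * ?S (?r - 1) = of_nat (?r + 1) * ?S ?r"
      using step by (intro stat_times_merge[OF n _ _ G]) auto
    then have m: "of_nat ?r * (2 * ?J ?r + of_nat q * ?S q) = of_nat ?r * (of_nat (?r + 1) * ?S ?r)" by simp
    have "(\<Sum>r=1..?r. of_nat (2 * r) * ?J r) = of_nat (2 * ?r) * ?J ?r + of_nat (q * (q + 1)) * ?S q"
      using step.IH step.prems by (subst sum.nat_ivl_Suc') (auto simp del: of_nat_mult of_nat_Suc)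
    also have "\<dots> = of_nat ?r * (2 * ?J ?r + of_nat q * ?S q)"
    proof -
      have "of_nat (2 * a) * x + of_nat (q * a) * y = of_nat a * (2 * x + of_nat q * y)" for a and x y :: ennreal
        by (simp add: distrib_left mult_ac)
      then show ?thesis unfolding Suc_eq_plus1 .
    qed
    also have "\<dots> = of_nat (?r * (?r + 1)) * ?S ?r"
      unfolding m by (simp only: of_nat_mult mult.assoc)
    finally show ?case .
  qed
  from this[of "n - 1"] have "(\<Sum>r=1..n-1. of_nat (2 * r) * ?J r) = of_nat ((n - 1) * (n - 1 + 1)) * ?S (n - 1)"
    using n(1) by simp
  also have "?S (n - 1) = (\<integral>\<^sup>+s. G (s(n - 1 := 0)) \<partial>stat_times n \<mu>)"
  proof (rule nn_integral_cong)
    fix s assume "s \<in> space (stat_times n \<mu>)"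
    then have "s m = undefined" if "m \<notin> {1..<n}" for m
      using that unfolding stat_times_def space_PiM by (auto simp: PiE_def extensional_def)
    then have "skip_times n (n - 1) s = s(n - 1 := 0)"
      using n(1) unfolding skip_times_def by (auto simp: restrict_def fun_eq_iff)
    then show "G (skip_times n (n - 1) s) = G (s(n - 1 := 0))" by simp
  qed
  also have "(n - 1) * (n - 1 + 1) = n * (n - 1)" using n(1) by simp
  finally show ?thesis .
qed


lemma measurable_moran_jump: "moran_jump n p \<in> big_space n \<rightarrow>\<^sub>M big_space n"
proof -
  have 1: "(\<lambda>x. jump_tree n p (fst x)) \<in> big_space n \<rightarrow>\<^sub>M count_space UNIV"
    unfolding big_space_def by (rule measurable_compose[OF measurable_fst]) simp
  have r: "(\<lambda>x. par_rank (fst p) (fst x)) \<in> big_space n \<rightarrow>\<^sub>M count_space UNIV"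
    unfolding big_space_def by (rule measurable_compose[OF measurable_fst]) simp
  have s: "(\<lambda>x. jump_times n i (snd x)) \<in> big_space n \<rightarrow>\<^sub>M (\<Pi>\<^sub>M j\<in>{1..<n}. borel)" for i
    unfolding big_space_def by (rule measurable_compose[OF measurable_snd measurable_jump_times])
  have 2: "(\<lambda>x. jump_times n (par_rank (fst p) (fst x)) (snd x)) \<in> big_space n \<rightarrow>\<^sub>M (\<Pi>\<^sub>M j\<in>{1..<n}. borel)"
    by (rule measurable_compose_countable[OF s r])
  have "(\<lambda>x. (jump_tree n p (fst x), jump_times n (par_rank (fst p) (fst x)) (snd x))) \<in> big_space n \<rightarrow>\<^sub>M big_space n"
    by (subst (2) big_space_def) (rule measurable_Pair[OF 1 2])
  then show ?thesis unfolding moran_jump_eq[symmetric] .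
qed

lemma measurable_mgp_flow:
  assumes "n \<ge> 2" "h \<in> borel_measurable N" "x \<in> N \<rightarrow>\<^sub>M big_space n"
  shows "(\<lambda>w. mgp_flow n (h w) (x w)) \<in> N \<rightarrow>\<^sub>M big_space n"
proof -
  have f: "(\<lambda>w. fst (x w)) \<in> N \<rightarrow>\<^sub>M count_space UNIV"
    using measurable_compose[OF assms(3)[unfolded big_space_def] measurable_fst] .
  have s: "(\<lambda>w. snd (x w)) \<in> N \<rightarrow>\<^sub>M (\<Pi>\<^sub>M j\<in>{1..<n}. borel)"
    using measurable_compose[OF assms(3)[unfolded big_space_def] measurable_snd] .
  have c: "(\<lambda>w. snd (x w) (n - 1)) \<in> borel_measurable N"
    using assms(1) by (intro measurable_compose[OF s measurable_component_singleton]) auto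
  have "(\<lambda>w. (snd (x w))(n - 1 := snd (x w) (n - 1) + h w)) \<in> N \<rightarrow>\<^sub>M (\<Pi>\<^sub>M j\<in>{1..<n}. borel)"
    using assms(1) c assms(2) s by (intro measurable_fun_upd[of _ "{1..<n}"]) auto
  from measurable_Pair[OF f this] show ?thesis unfolding mgp_flow_def big_space_def .
qed

definition reset_last :: "nat \<Rightarrow> (nat \<Rightarrow> nat set set) \<times> (nat \<Rightarrow> real) \<Rightarrow> (nat \<Rightarrow> nat set set) \<times> (nat \<Rightarrow> real)" where
  "reset_last n x = (fst x, (snd x)(n - 1 := 0))"

lemma measurable_reset_last:
  assumes "n \<ge> 2"
  shows "reset_last n \<in> big_space n \<rightarrow>\<^sub>M big_space n"
proof -
  have "(\<lambda>x. (snd x)(n - 1 := 0)) \<in> big_space n \<rightarrow>\<^sub>M (\<Pi>\<^sub>M j\<in>{1..<n}. borel)"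
    using assms unfolding big_space_def by (intro measurable_fun_upd[of _ "{1..<n}"]) auto
  moreover have "fst \<in> big_space n \<rightarrow>\<^sub>M count_space UNIV" unfolding big_space_def by simp
  ultimately have "(\<lambda>x. (fst x, (snd x)(n - 1 := 0))) \<in> big_space n \<rightarrow>\<^sub>M big_space n"
    by (subst (2) big_space_def) (rule measurable_Pair)
  then show ?thesis unfolding reset_last_def .
qed

definition jump_avg :: "nat \<Rightarrow> ((nat \<Rightarrow> nat set set) \<times> (nat \<Rightarrow> real) \<Rightarrow> ennreal)
    \<Rightarrow> (nat \<Rightarrow> nat set set) \<times> (nat \<Rightarrow> real) \<Rightarrow> ennreal" where
  "jump_avg n f x = (\<Sum>p\<in>moran_pairs n. ennreal (1 / (real n * real (n - 1))) * f (moran_jump n p x))"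

lemma section_big_space:
  assumes "f \<in> borel_measurable (big_space n)"
  shows "(\<lambda>s. f (B, s)) \<in> borel_measurable (\<Pi>\<^sub>M j\<in>{1..<n}. borel)"
  using measurable_compose[OF measurable_Pair1'[of B "count_space UNIV" "\<Pi>\<^sub>M j\<in>{1..<n}. borel"] assms[unfolded big_space_def]]
  by simp

lemma stationary_jump_le:
  assumes n: "n \<ge> 2" "\<mu> > 0" and f: "f \<in> borel_measurable (big_space n)"
  shows "(\<integral>\<^sup>+x. jump_avg n f x \<partial>mgp_stationary n \<mu>) \<le> (\<integral>\<^sup>+x. f (reset_last n x) \<partial>mgp_stationary n \<mu>)"
proof -
  let ?W = "ranked_trees n" and ?P = "moran_pairs n" and ?Q = "stat_times n \<mu>"
  let ?c = "ennreal (1 / card ?W)" and ?d = "ennreal (1 / (real n * real (n - 1)))"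
  define G where "G r B = (\<integral>\<^sup>+s. f (B, jump_times n r s) \<partial>?Q)" for r B
  have mj: "(\<lambda>x. f (moran_jump n p x)) \<in> borel_measurable (big_space n)" for p
    by (rule measurable_compose[OF measurable_moran_jump f])
  have "(\<integral>\<^sup>+x. jump_avg n f x \<partial>mgp_stationary n \<mu>) = (\<Sum>B\<in>?W. ?c * (\<integral>\<^sup>+s. jump_avg n f (B, s) \<partial>?Q))"
    unfolding jump_avg_def using mj
    by (intro nn_integral_mgp_stationary n measurable_big_state borel_measurable_sum borel_measurable_times_ennreal) auto
  also have "\<dots> = (\<Sum>B\<in>?W. ?c * (\<Sum>p\<in>?P. ?d * G (par_rank (fst p) B) (jump_tree n p B)))"
  proof (intro sum.cong refl arg_cong2[where f="(*)"])
    fix B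
    have m: "(\<lambda>s. f (moran_jump n p (B, s))) \<in> borel_measurable ?Q" for p
      by (rule measurable_stat_times[OF section_big_space[OF mj]])
    have "(\<integral>\<^sup>+s. jump_avg n f (B, s) \<partial>?Q) = (\<Sum>p\<in>?P. \<integral>\<^sup>+s. ?d * f (moran_jump n p (B, s)) \<partial>?Q)"
      unfolding jump_avg_def using m by (intro nn_integral_sum borel_measurable_times_ennreal) auto
    also have "\<dots> = (\<Sum>p\<in>?P. ?d * (\<integral>\<^sup>+s. f (moran_jump n p (B, s)) \<partial>?Q))"
      using m by (intro sum.cong refl nn_integral_cmult)
    finally show "(\<integral>\<^sup>+s. jump_avg n f (B, s) \<partial>?Q) = (\<Sum>p\<in>?P. ?d * G (par_rank (fst p) B) (jump_tree n p B))"
      unfolding moran_jump_eq G_def by simp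
  qed
  also have "\<dots> = ?c * ?d * (\<Sum>B\<in>?W. \<Sum>p\<in>?P. G (par_rank (fst p) B) (jump_tree n p B))"
    by (simp only: sum_distrib_left mult.assoc)
  also have "\<dots> \<le> ?c * ?d * (\<Sum>B\<in>?W. \<Sum>r=1..n-1. of_nat (2 * r) * G r B)"
    by (intro mult_left_mono sum_jump_tree_le n) auto
  also have "\<dots> = ?c * ?d * (\<Sum>B\<in>?W. of_nat (n * (n - 1)) * (\<integral>\<^sup>+s. f (B, s(n - 1 := 0)) \<partial>?Q))"
    unfolding G_def stat_times_jump_sum[OF n section_big_space[OF f]] ..
  also have "\<dots> = ?c * (?d * of_nat (n * (n - 1))) * (\<Sum>B\<in>?W. \<integral>\<^sup>+s. f (B, s(n - 1 := 0)) \<partial>?Q)"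
    by (simp only: sum_distrib_left[symmetric] mult.assoc)
  also have "?d * of_nat (n * (n - 1)) = 1"
    using n(1) unfolding ennreal_of_nat_eq_real_of_nat by (subst ennreal_mult[symmetric]) auto
  also have "?c * 1 * (\<Sum>B\<in>?W. \<integral>\<^sup>+s. f (B, s(n - 1 := 0)) \<partial>?Q) = (\<Sum>B\<in>?W. ?c * (\<integral>\<^sup>+s. f (reset_last n (B, s)) \<partial>?Q))"
    by (simp add: sum_distrib_left reset_last_def)
  also have "\<dots> = (\<integral>\<^sup>+x. f (reset_last n x) \<partial>mgp_stationary n \<mu>)"
    by (intro nn_integral_mgp_stationary[symmetric] n measurable_big_state measurable_compose[OF measurable_reset_last f])
  finally show ?thesis .
qed

lemma stationary_flow:
  assumes n: "n \<ge> 2" "\<mu> > 0" and f: "f \<in> borel_measurable (big_space n)" and t: "0 \<le> t"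
  shows "ennreal (exp (- \<mu> * t)) * (\<integral>\<^sup>+x. f (mgp_flow n t x) \<partial>mgp_stationary n \<mu>)
     + (\<integral>\<^sup>+h. indicator {..t} h * (\<integral>\<^sup>+x. f (mgp_flow n h (reset_last n x)) \<partial>mgp_stationary n \<mu>)
           \<partial>density lborel (exponential_density \<mu>))
     = (\<integral>\<^sup>+x. f x \<partial>mgp_stationary n \<mu>)"
proof -
  let ?r = "\<lambda>B h. \<integral>\<^sup>+s. f (mgp_flow n h (reset_last n (B, s))) \<partial>stat_times n \<mu>"
  let ?R = "\<lambda>B. \<integral>\<^sup>+h. indicator {..t} h * ?r B h \<partial>density lborel (exponential_density \<mu>)"
  let ?W = "ranked_trees n" and ?Q = "stat_times n \<mu>" and ?l = "coal_rate n \<mu>"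
  let ?c = "ennreal (1 / card ?W)" and ?I = "{1..<n - 1}"
  let ?M = "\<lambda>j. exp_measure (if j \<ge> 1 then ?l j else 1)"
  let ?E = "density lborel (exponential_density \<mu>)"
  interpret E: product_sigma_finite ?M
    using coal_rate_pos[OF n]
    by (intro product_sigma_finite.intro prob_space_imp_sigma_finite prob_space_exp_measure) auto
  interpret Ex: prob_space ?E by (rule prob_space_exponential_density[OF n(2)])
  interpret PI: sigma_finite_measure "PiM ?I ?M" by (rule E.sigma_finite) simp
  interpret PE: pair_sigma_finite "PiM ?I ?M" ?E ..
  have eq: "?Q = PiM {1..<n} ?M" unfolding stat_times_def by (rule PiM_cong) auto
  have I: "{1..<n} = insert (n - 1) ?I" using n by auto
  have "1 \<le> n - 1" using n by simp
  then have M: "?M (n - 1) = exp_measure \<mu>" using coal_rate_last[OF n(1)] by simp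
  have split: "(\<integral>\<^sup>+s. H s \<partial>?Q) = (\<integral>\<^sup>+s. \<integral>\<^sup>+y. H (s(n - 1 := y)) \<partial>exp_measure \<mu> \<partial>PiM ?I ?M)"
    if H: "H \<in> borel_measurable (\<Pi>\<^sub>M j\<in>{1..<n}. borel)" for H
  proof -
    have H': "H \<in> borel_measurable (PiM (insert (n - 1) ?I) ?M)"
      using measurable_stat_times[OF H, of \<mu>] unfolding eq I[symmetric] .
    have "(\<integral>\<^sup>+s. H s \<partial>?Q) = (\<integral>\<^sup>+s. H s \<partial>PiM (insert (n - 1) ?I) ?M)" unfolding eq I[symmetric] ..
    also have "\<dots> = (\<integral>\<^sup>+s. \<integral>\<^sup>+y. H (s(n - 1 := y)) \<partial>?M (n - 1) \<partial>PiM ?I ?M)"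
      by (rule E.product_nn_integral_insert[OF _ _ H']) auto
    finally show ?thesis unfolding M .
  qed
  have mflow: "(\<lambda>x. f (mgp_flow n h x)) \<in> borel_measurable (big_space n)" for h
    by (intro measurable_compose[OF measurable_mgp_flow f] n) auto
  have mreset: "(\<lambda>x. f (mgp_flow n h (reset_last n x))) \<in> borel_measurable (big_space n)" for h
    by (intro measurable_compose[OF measurable_reset_last mflow] n)
  have upd: "(\<lambda>p. f (B, (fst p)(n - 1 := snd p))) \<in> borel_measurable (PiM ?I ?M \<Otimes>\<^sub>M borel)" for B
  proof -
    have "(\<lambda>s. s) \<in> PiM ?I ?M \<rightarrow>\<^sub>M (\<Pi>\<^sub>M j\<in>?I. borel)"
    proof (rule measurable_PiM_single')
      fix j assume "j \<in> ?I"
      then have "(\<lambda>s. s j) \<in> PiM ?I ?M \<rightarrow>\<^sub>M ?M j" by (rule measurable_component_singleton)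
      moreover have "(\<lambda>x. x) \<in> ?M j \<rightarrow>\<^sub>M borel"
        by (rule measurable_exp_measure) simp
      ultimately show "(\<lambda>s. s j) \<in> PiM ?I ?M \<rightarrow>\<^sub>M borel" using measurable_compose by blast
    qed (auto simp: space_PiM)
    from measurable_compose[OF measurable_fst this]
    have "(\<lambda>p. (fst p)(n - 1 := snd p)) \<in> PiM ?I ?M \<Otimes>\<^sub>M borel \<rightarrow>\<^sub>M (\<Pi>\<^sub>M j\<in>{1..<n}. borel)"
      unfolding I by (intro measurable_fun_upd[of _ ?I]) auto
    from measurable_compose[OF this section_big_space[OF f]] show ?thesis .
  qed
  have upd1: "(\<lambda>y. f (B, s(n - 1 := y))) \<in> borel_measurable borel" if "s \<in> space (PiM ?I ?M)" for B s
    using measurable_compose[OF measurable_Pair1'[OF that] upd] by simp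
  have updE: "(\<lambda>p. indicator {..t} (snd p) * f (B, (fst p)(n - 1 := snd p))) \<in> borel_measurable (PiM ?I ?M \<Otimes>\<^sub>M ?E)" for B
  proof -
    have m: "(\<lambda>p. indicator {..t} (snd p) * f (B, (fst p)(n - 1 := snd p))) \<in> borel_measurable (PiM ?I ?M \<Otimes>\<^sub>M borel)"
      using upd by (intro borel_measurable_times_ennreal) auto
    have c: "sets (PiM ?I ?M \<Otimes>\<^sub>M ?E) = sets (PiM ?I ?M \<Otimes>\<^sub>M borel)"
      by (intro sets_pair_measure_cong) auto
    show ?thesis by (subst measurable_cong_sets[OF c refl]) (rule m)
  qed
  have tree: "ennreal (exp (- \<mu> * t)) * (\<integral>\<^sup>+s. f (mgp_flow n t (B, s)) \<partial>?Q)
     + ?R B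
     = (\<integral>\<^sup>+s. f (B, s) \<partial>?Q)" for B
  proof -
    have a: "(\<integral>\<^sup>+s. f (mgp_flow n t (B, s)) \<partial>?Q) = (\<integral>\<^sup>+s. \<integral>\<^sup>+y. f (B, s(n - 1 := y + t)) \<partial>exp_measure \<mu> \<partial>PiM ?I ?M)"
      by (subst split[OF section_big_space[OF mflow]]) (simp add: mgp_flow_def)
    have b: "?r B h = (\<integral>\<^sup>+s. f (B, s(n - 1 := h)) \<partial>PiM ?I ?M)" for h
      by (subst split[OF section_big_space[OF mreset]]) (simp add: mgp_flow_def reset_last_def emeasure_space_exp_measure[OF n(2)])
    have "(\<integral>\<^sup>+h. indicator {..t} h * (\<integral>\<^sup>+s. f (B, s(n - 1 := h)) \<partial>PiM ?I ?M) \<partial>?E)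
       = (\<integral>\<^sup>+h. \<integral>\<^sup>+s. indicator {..t} h * f (B, s(n - 1 := h)) \<partial>PiM ?I ?M \<partial>?E)"
    proof (rule nn_integral_cong)
      fix h
      have "(\<lambda>s. f (B, s(n - 1 := h))) \<in> borel_measurable (PiM ?I ?M)"
        using measurable_compose[OF measurable_Pair2'[of h borel "PiM ?I ?M"] upd] by simp
      then show "indicator {..t} h * (\<integral>\<^sup>+s. f (B, s(n - 1 := h)) \<partial>PiM ?I ?M)
          = (\<integral>\<^sup>+s. indicator {..t} h * f (B, s(n - 1 := h)) \<partial>PiM ?I ?M)"
        by (rule nn_integral_cmult[symmetric])
    qed
    also have "\<dots> = (\<integral>\<^sup>+s. \<integral>\<^sup>+h. indicator {..t} h * f (B, s(n - 1 := h)) \<partial>?E \<partial>PiM ?I ?M)"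
      using updE by (intro PE.Fubini') (simp add: case_prod_beta')
    also have "\<dots> = (\<integral>\<^sup>+s. \<integral>\<^sup>+h. indicator {..t} h * f (B, s(n - 1 := h)) \<partial>exp_measure \<mu> \<partial>PiM ?I ?M)"
      using upd1 n(2) by (intro nn_integral_cong nn_integral_exponential_density borel_measurable_times_ennreal) auto
    finally have b': "(\<integral>\<^sup>+h. indicator {..t} h * (\<integral>\<^sup>+s. f (B, s(n - 1 := h)) \<partial>PiM ?I ?M) \<partial>?E) = \<dots>" .
    have sf: "sigma_finite_measure (exp_measure \<mu>)"
      by (rule prob_space_imp_sigma_finite[OF prob_space_exp_measure[OF n(2)]])
    have idM: "(\<lambda>x. x) \<in> exp_measure \<mu> \<rightarrow>\<^sub>M borel"
      by (rule measurable_exp_measure) simp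
    have m1: "(\<lambda>s. \<integral>\<^sup>+y. f (B, s(n - 1 := y + t)) \<partial>exp_measure \<mu>) \<in> borel_measurable (PiM ?I ?M)"
    proof -
      have "(\<lambda>p. (fst p, snd p + t)) \<in> PiM ?I ?M \<Otimes>\<^sub>M exp_measure \<mu> \<rightarrow>\<^sub>M PiM ?I ?M \<Otimes>\<^sub>M borel"
        by (intro measurable_Pair measurable_fst borel_measurable_add measurable_compose[OF measurable_snd idM] measurable_const) simp
      from measurable_compose[OF this upd] show ?thesis
        by (intro sigma_finite_measure.borel_measurable_nn_integral[OF sf]) (simp only: case_prod_beta' fst_conv snd_conv)
    qed
    have m2: "(\<lambda>s. \<integral>\<^sup>+h. indicator {..t} h * f (B, s(n - 1 := h)) \<partial>exp_measure \<mu>) \<in> borel_measurable (PiM ?I ?M)"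
    proof -
      have u: "(\<lambda>p. indicator {..t} (snd p) * f (B, (fst p)(n - 1 := snd p))) \<in> borel_measurable (PiM ?I ?M \<Otimes>\<^sub>M borel)"
        using upd by (intro borel_measurable_times_ennreal) auto
      have "(\<lambda>p. (fst p, snd p)) \<in> PiM ?I ?M \<Otimes>\<^sub>M exp_measure \<mu> \<rightarrow>\<^sub>M PiM ?I ?M \<Otimes>\<^sub>M borel"
        by (intro measurable_Pair measurable_fst measurable_compose[OF measurable_snd idM])
      from measurable_compose[OF this u] show ?thesis
        by (intro sigma_finite_measure.borel_measurable_nn_integral[OF sf]) (simp only: case_prod_beta' fst_conv snd_conv)
    qed
    have "ennreal (exp (- \<mu> * t)) * (\<integral>\<^sup>+s. \<integral>\<^sup>+y. f (B, s(n - 1 := y + t)) \<partial>exp_measure \<mu> \<partial>PiM ?I ?M)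
        + (\<integral>\<^sup>+s. \<integral>\<^sup>+h. indicator {..t} h * f (B, s(n - 1 := h)) \<partial>exp_measure \<mu> \<partial>PiM ?I ?M)
       = (\<integral>\<^sup>+s. ennreal (exp (- \<mu> * t)) * (\<integral>\<^sup>+y. f (B, s(n - 1 := y + t)) \<partial>exp_measure \<mu>)
        + (\<integral>\<^sup>+h. indicator {..t} h * f (B, s(n - 1 := h)) \<partial>exp_measure \<mu>) \<partial>PiM ?I ?M)"
      using m1 m2 by (subst nn_integral_add) (auto simp: nn_integral_cmult)
    also have "\<dots> = (\<integral>\<^sup>+s. \<integral>\<^sup>+y. f (B, s(n - 1 := y)) \<partial>exp_measure \<mu> \<partial>PiM ?I ?M)"
      by (rule nn_integral_cong, rule exp_measure_memoryless[OF upd1 n(2) t])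
    also have "\<dots> = (\<integral>\<^sup>+s. f (B, s) \<partial>?Q)"
      by (rule split[OF section_big_space[OF f], symmetric])
    finally show ?thesis unfolding a b b' .
  qed
  have mh: "(\<lambda>h. indicator {..t} h * ?r B h) \<in> borel_measurable ?E" for B
  proof -
    interpret Q: prob_space ?Q by (rule prob_space_stat_times[OF n])
    have "(\<lambda>p. (B, snd p)) \<in> borel \<Otimes>\<^sub>M (\<Pi>\<^sub>M j\<in>{1..<n}. borel) \<rightarrow>\<^sub>M big_space n"
      unfolding big_space_def by simp
    then have a: "(\<lambda>p. f (mgp_flow n (fst p) (reset_last n (B, snd p)))) \<in> borel_measurable (borel \<Otimes>\<^sub>M (\<Pi>\<^sub>M j\<in>{1..<n}. borel))"
      by (intro measurable_compose[OF measurable_mgp_flow f] n measurable_compose[OF _ measurable_reset_last]) auto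
    have b: "(\<lambda>p. (fst p, snd p)) \<in> borel \<Otimes>\<^sub>M ?Q \<rightarrow>\<^sub>M borel \<Otimes>\<^sub>M (\<Pi>\<^sub>M j\<in>{1..<n}. borel)"
      by (intro measurable_Pair measurable_fst measurable_compose[OF measurable_snd measurable_stat_times]) simp
    from measurable_compose[OF b a]
    have "(\<lambda>p. f (mgp_flow n (fst p) (reset_last n (B, snd p)))) \<in> borel_measurable (borel \<Otimes>\<^sub>M ?Q)"
      by (simp only: fst_conv snd_conv)
    then have "(\<lambda>h. \<integral>\<^sup>+s. f (mgp_flow n h (reset_last n (B, s))) \<partial>?Q) \<in> borel_measurable borel"
      by (intro Q.borel_measurable_nn_integral) (simp only: case_prod_beta')
    then have "(\<lambda>h. indicator {..t} h * ?r B h) \<in> borel_measurable borel"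
      by (intro borel_measurable_times_ennreal) auto
    then show ?thesis by simp
  qed
  have "(\<integral>\<^sup>+h. indicator {..t} h * (\<integral>\<^sup>+x. f (mgp_flow n h (reset_last n x)) \<partial>mgp_stationary n \<mu>) \<partial>?E)
     = (\<integral>\<^sup>+h. (\<Sum>B\<in>?W. ?c * (indicator {..t} h * ?r B h)) \<partial>?E)"
    by (simp only: nn_integral_mgp_stationary[OF n measurable_big_state[OF mreset]] sum_distrib_left mult_ac)
  also have "\<dots> = (\<Sum>B\<in>?W. ?c * ?R B)"
    using mh by (subst nn_integral_sum) (auto simp: nn_integral_cmult)
  finally have 2: "(\<integral>\<^sup>+h. indicator {..t} h * (\<integral>\<^sup>+x. f (mgp_flow n h (reset_last n x)) \<partial>mgp_stationary n \<mu>) \<partial>?E) = \<dots>" .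
  have "ennreal (exp (- \<mu> * t)) * (\<integral>\<^sup>+x. f (mgp_flow n t x) \<partial>mgp_stationary n \<mu>)
     + (\<Sum>B\<in>?W. ?c * ?R B)
     = (\<Sum>B\<in>?W. ?c * (ennreal (exp (- \<mu> * t)) * (\<integral>\<^sup>+s. f (mgp_flow n t (B, s)) \<partial>?Q)
     + ?R B))"
    unfolding nn_integral_mgp_stationary[OF n measurable_big_state[OF mflow]]
    by (simp only: distrib_left sum.distrib sum_distrib_left mult_ac)
  also have "\<dots> = (\<integral>\<^sup>+x. f x \<partial>mgp_stationary n \<mu>)"
    unfolding tree nn_integral_mgp_stationary[OF n measurable_big_state[OF f]] ..
  finally show ?thesis unfolding 2 .
qed

subsection \<open>Decomposition by the number of events\<close>

abbreviation exp_clock :: "real \<Rightarrow> real measure" where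
  "exp_clock \<mu> \<equiv> density lborel (exponential_density \<mu>)"

text \<open>The contribution to \<open>E (f (X t))\<close> of the paths from \<open>x\<close> with exactly \<open>k\<close> events in \<open>[0, t]\<close>,
  by conditioning on the first event.\<close>

primrec mgp_term :: "nat \<Rightarrow> real \<Rightarrow> nat \<Rightarrow> real \<Rightarrow> ((nat \<Rightarrow> nat set set) \<times> (nat \<Rightarrow> real) \<Rightarrow> ennreal)
    \<Rightarrow> (nat \<Rightarrow> nat set set) \<times> (nat \<Rightarrow> real) \<Rightarrow> ennreal" where
  "mgp_term n \<mu> 0 t f x = indicator {0..} t * ennreal (exp (- \<mu> * t)) * f (mgp_flow n t x)"
| "mgp_term n \<mu> (Suc k) t f x = (\<integral>\<^sup>+h. jump_avg n (mgp_term n \<mu> k (t - h) f) (mgp_flow n h x) \<partial>exp_clock \<mu>)"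

definition pois_weight :: "real \<Rightarrow> real \<Rightarrow> nat \<Rightarrow> real \<Rightarrow> ennreal" where
  "pois_weight \<mu> \<theta> k t = indicator {0..} t * ennreal (exp (- \<mu> * t) * (\<theta> * \<mu> * t) ^ k / fact k)"

lemma measurable_pois_weight [measurable]: "pois_weight \<mu> \<theta> k \<in> borel_measurable borel"
  unfolding pois_weight_def by measurable

lemma AE_exp_clock_nonneg: "AE h in exp_clock \<mu>. 0 \<le> h"
  by (subst AE_density) (auto simp: exponential_density_def)

lemma pois_weight_Suc:
  assumes "0 < \<mu>" "0 \<le> \<theta>"
  shows "(\<integral>\<^sup>+h. ennreal \<theta> * pois_weight \<mu> \<theta> k (t - h) \<partial>exp_clock \<mu>) = pois_weight \<mu> \<theta> (Suc k) t"
proof -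
  let ?g = "\<lambda>h. \<theta> * \<mu> * exp (- \<mu> * t) * (\<theta> * \<mu> * (t - h)) ^ k / fact k"
  have "(\<integral>\<^sup>+h. ennreal \<theta> * pois_weight \<mu> \<theta> k (t - h) \<partial>exp_clock \<mu>)
     = (\<integral>\<^sup>+h. ennreal (\<mu> * exp (- \<mu> * h)) * (ennreal \<theta> * pois_weight \<mu> \<theta> k (t - h)) * indicator {0..} h \<partial>lborel)"
    using assms by (subst nn_integral_exponential_density) (auto simp: nn_integral_exp_measure)
  also have "\<dots> = (\<integral>\<^sup>+h. ennreal (?g h) * indicator {0..t} h \<partial>lborel)"
  proof (rule nn_integral_cong)
    fix h :: real
    show "ennreal (\<mu> * exp (- \<mu> * h)) * (ennreal \<theta> * pois_weight \<mu> \<theta> k (t - h)) * indicator {0..} h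
      = ennreal (?g h) * indicator {0..t} h"
    proof (cases "h \<in> {0..t}")
      case True
      have "?g h = \<mu> * exp (- \<mu> * h) * (\<theta> * (exp (- \<mu> * (t - h)) * (\<theta> * \<mu> * (t - h)) ^ k / fact k))"
        by (simp add: mult_exp_exp algebra_simps)
      moreover have "0 \<le> \<mu> * exp (- \<mu> * h)" "0 \<le> \<theta>" "0 \<le> exp (- \<mu> * (t - h)) * (\<theta> * \<mu> * (t - h)) ^ k / fact k"
        using True assms by auto
      ultimately show ?thesis using True unfolding pois_weight_def
        by (simp only: ennreal_mult mult_nonneg_nonneg) auto
    qed (auto simp: pois_weight_def split: split_indicator)
  qed
  also have "\<dots> = pois_weight \<mu> \<theta> (Suc k) t"
  proof (cases "0 \<le> t")
    case True
    have "(\<integral>\<^sup>+h. ennreal (?g h) * indicator {0..t} h \<partial>lborel)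
       = ennreal ((- (exp (- \<mu> * t) * (\<theta> * \<mu> * (t - t)) ^ Suc k / fact (Suc k)))
            - (- (exp (- \<mu> * t) * (\<theta> * \<mu> * (t - 0)) ^ Suc k / fact (Suc k))))"
    proof (rule nn_integral_FTC_Icc)
      fix h assume "h \<in> {0..t}"
      show "((\<lambda>h. - (exp (- \<mu> * t) * (\<theta> * \<mu> * (t - h)) ^ Suc k / fact (Suc k))) has_real_derivative ?g h) (at h)"
        by (rule derivative_eq_intros refl | simp)+
      show "0 \<le> ?g h" using \<open>h \<in> {0..t}\<close> assms by auto
    qed (use True in auto)
    then show ?thesis using True unfolding pois_weight_def by simp
  qed (auto simp: pois_weight_def)
  finally show ?thesis .
qed

lemma suminf_pois_weight:
  assumes "0 < \<mu>" "0 \<le> \<theta>" "0 \<le> t"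
  shows "(\<Sum>k. pois_weight \<mu> \<theta> k t) = ennreal (exp (- \<mu> * t) * exp (\<theta> * \<mu> * t))"
proof -
  have "(\<lambda>k. (\<theta> * \<mu> * t) ^ k /\<^sub>R fact k) sums exp (\<theta> * \<mu> * t)" by (rule exp_converges)
  then have "(\<lambda>k. exp (- \<mu> * t) * ((\<theta> * \<mu> * t) ^ k / fact k)) sums (exp (- \<mu> * t) * exp (\<theta> * \<mu> * t))"
    by (intro sums_mult) (simp add: divide_inverse mult.commute)
  then have "(\<Sum>k. ennreal (exp (- \<mu> * t) * ((\<theta> * \<mu> * t) ^ k / fact k))) = ennreal (exp (- \<mu> * t) * exp (\<theta> * \<mu> * t))"
    using assms by (intro suminf_ennreal_eq) auto
  then show ?thesis using assms unfolding pois_weight_def by simp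
qed

lemma jump_avg_const:
  assumes "n \<ge> 2"
  shows "jump_avg n (\<lambda>_. c) x = c"
proof -
  have "jump_avg n (\<lambda>_. c) x = (of_nat (n * (n - 1)) * ennreal (1 / (real n * real (n - 1)))) * c"
    unfolding jump_avg_def by (simp add: card_moran_pairs mult.assoc)
  also have "of_nat (n * (n - 1)) * ennreal (1 / (real n * real (n - 1))) = 1"
    using assms unfolding ennreal_of_nat_eq_real_of_nat by (subst ennreal_mult[symmetric]) auto
  finally show ?thesis by simp
qed

lemma mgp_term_one:
  assumes "n \<ge> 2" "0 < \<mu>"
  shows "mgp_term n \<mu> k t (\<lambda>_. 1) x = pois_weight \<mu> 1 k t"
proof (induction k arbitrary: t x)
  case 0
  then show ?case by (simp add: pois_weight_def)
next
  case (Suc k)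
  have "mgp_term n \<mu> k s (\<lambda>_. 1) = (\<lambda>_. pois_weight \<mu> 1 k s)" for s using Suc by auto
  then have "mgp_term n \<mu> (Suc k) t (\<lambda>_. 1) x = (\<integral>\<^sup>+h. ennreal 1 * pois_weight \<mu> 1 k (t - h) \<partial>exp_clock \<mu>)"
    by (simp add: jump_avg_const[OF assms(1)])
  also have "\<dots> = pois_weight \<mu> 1 (Suc k) t" using assms by (intro pois_weight_Suc) auto
  finally show ?case .
qed

lemma suminf_mgp_term_one:
  assumes "n \<ge> 2" "0 < \<mu>" "0 \<le> t"
  shows "(\<Sum>k. mgp_term n \<mu> k t (\<lambda>_. 1) x) = 1"
  unfolding mgp_term_one[OF assms(1,2)] using suminf_pois_weight[OF assms(2) _ assms(3), of 1]
  by (simp add: mult_exp_exp)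

lemma mgp_term_neg:
  assumes "t < 0"
  shows "mgp_term n \<mu> k t f x = 0"
  using assms
proof (induction k arbitrary: t x)
  case (Suc k)
  have "(\<integral>\<^sup>+h. jump_avg n (mgp_term n \<mu> k (t - h) f) (mgp_flow n h x) \<partial>exp_clock \<mu>) = (\<integral>\<^sup>+h. 0 \<partial>exp_clock \<mu>)"
  proof (rule nn_integral_cong_AE)
    show "AE h in exp_clock \<mu>. jump_avg n (mgp_term n \<mu> k (t - h) f) (mgp_flow n h x) = 0"
      using AE_exp_clock_nonneg
    proof eventually_elim
      fix h :: real assume "0 \<le> h"
      then have "t - h < 0" using Suc.prems by simp
      then show "jump_avg n (mgp_term n \<mu> k (t - h) f) (mgp_flow n h x) = 0"
        using Suc.IH unfolding jump_avg_def by simp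
    qed
  qed
  then show ?case by simp
qed simp

lemma mgp_term_cong:
  assumes n: "n \<ge> 2" and fg: "\<And>y. y \<in> state_set n \<Longrightarrow> f y = g y" and x: "x \<in> state_set n"
  shows "mgp_term n \<mu> k t f x = mgp_term n \<mu> k t g x"
  using x
proof (induction k arbitrary: t x)
  case 0
  show ?case
  proof (cases "0 \<le> t")
    case True
    then show ?thesis using fg[OF mgp_flow_state_set[OF 0 _ n]] by simp
  qed simp
next
  case (Suc k)
  have "(\<integral>\<^sup>+h. jump_avg n (mgp_term n \<mu> k (t - h) f) (mgp_flow n h x) \<partial>exp_clock \<mu>)
     = (\<integral>\<^sup>+h. jump_avg n (mgp_term n \<mu> k (t - h) g) (mgp_flow n h x) \<partial>exp_clock \<mu>)"
  proof (rule nn_integral_cong_AE)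
    show "AE h in exp_clock \<mu>. jump_avg n (mgp_term n \<mu> k (t - h) f) (mgp_flow n h x)
        = jump_avg n (mgp_term n \<mu> k (t - h) g) (mgp_flow n h x)"
      using AE_exp_clock_nonneg
    proof eventually_elim
      fix h :: real assume "0 \<le> h"
      then show "jump_avg n (mgp_term n \<mu> k (t - h) f) (mgp_flow n h x)
        = jump_avg n (mgp_term n \<mu> k (t - h) g) (mgp_flow n h x)"
        unfolding jump_avg_def
        using Suc.IH moran_jump_state_set[OF mgp_flow_state_set[OF Suc.prems _ n] n] by (intro sum.cong) auto
    qed
  qed
  then show ?case by simp
qed

lemma measurable_jump_avg:
  assumes "\<And>p. (\<lambda>w. g w (moran_jump n p (x w))) \<in> borel_measurable N"
  shows "(\<lambda>w. jump_avg n (g w) (x w)) \<in> borel_measurable N"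
  unfolding jump_avg_def using assms by (intro borel_measurable_sum borel_measurable_times_ennreal) auto

lemma measurable_mgp_term_aux:
  assumes n: "n \<ge> 2" "0 < \<mu>"
    and F: "(\<lambda>w. F (fst w) (snd w)) \<in> borel_measurable (A \<Otimes>\<^sub>M big_space n)"
  shows "(\<lambda>w. mgp_term n \<mu> k (fst (snd w)) (F (fst w)) (snd (snd w))) \<in> borel_measurable (A \<Otimes>\<^sub>M (borel \<Otimes>\<^sub>M big_space n))"
proof (induction k)
  case 0
  have x: "(\<lambda>w. snd (snd w)) \<in> A \<Otimes>\<^sub>M (borel \<Otimes>\<^sub>M big_space n) \<rightarrow>\<^sub>M big_space n" by simp
  have t: "(\<lambda>w. fst (snd w)) \<in> borel_measurable (A \<Otimes>\<^sub>M (borel \<Otimes>\<^sub>M big_space n))" by simp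
  have "(\<lambda>w. (fst w, mgp_flow n (fst (snd w)) (snd (snd w)))) \<in> A \<Otimes>\<^sub>M (borel \<Otimes>\<^sub>M big_space n) \<rightarrow>\<^sub>M A \<Otimes>\<^sub>M big_space n"
    by (intro measurable_Pair measurable_fst measurable_mgp_flow n x t)
  from measurable_compose[OF this F]
  have f: "(\<lambda>w. F (fst w) (mgp_flow n (fst (snd w)) (snd (snd w)))) \<in> borel_measurable (A \<Otimes>\<^sub>M (borel \<Otimes>\<^sub>M big_space n))"
    by simp
  have i: "(\<lambda>t. indicator {0..} t * ennreal (exp (- \<mu> * t))) \<in> borel_measurable borel" by measurable
  show ?case
    unfolding mgp_term.simps by (intro borel_measurable_times_ennreal f measurable_compose[OF t i])
next
  case (Suc k)
  interpret prob_space "exp_clock \<mu>" by (rule prob_space_exponential_density[OF n(2)])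
  let ?N = "(A \<Otimes>\<^sub>M (borel \<Otimes>\<^sub>M big_space n)) \<Otimes>\<^sub>M exp_clock \<mu>"
  have x: "(\<lambda>w. snd (snd (fst w))) \<in> ?N \<rightarrow>\<^sub>M big_space n" by simp
  have t: "(\<lambda>w. fst (snd (fst w))) \<in> borel_measurable ?N" by simp
  have h: "(\<lambda>w. snd w) \<in> borel_measurable ?N"
  proof -
    have "(\<lambda>x. x) \<in> exp_clock \<mu> \<rightarrow>\<^sub>M borel" by simp
    from measurable_compose[OF measurable_snd this] show ?thesis .
  qed
  have "(\<lambda>w. mgp_term n \<mu> k (fst (snd (fst w)) - snd w) (F (fst (fst w)))
      (moran_jump n p (mgp_flow n (snd w) (snd (snd (fst w)))))) \<in> borel_measurable ?N" for p
  proof -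
    have "(\<lambda>w. (fst (fst w), (fst (snd (fst w)) - snd w, moran_jump n p (mgp_flow n (snd w) (snd (snd (fst w)))))))
        \<in> ?N \<rightarrow>\<^sub>M A \<Otimes>\<^sub>M (borel \<Otimes>\<^sub>M big_space n)"
      by (intro measurable_Pair borel_measurable_diff t h measurable_compose[OF measurable_fst measurable_fst]
          measurable_compose[OF _ measurable_moran_jump] measurable_mgp_flow n x)
    from measurable_compose[OF this Suc.IH] show ?thesis by simp
  qed
  then have "(\<lambda>w. jump_avg n (mgp_term n \<mu> k (fst (snd (fst w)) - snd w) (F (fst (fst w))))
      (mgp_flow n (snd w) (snd (snd (fst w))))) \<in> borel_measurable ?N"
    by (rule measurable_jump_avg)
  then show ?case unfolding mgp_term.simps
    by (intro borel_measurable_nn_integral) (simp only: case_prod_beta' fst_conv snd_conv)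
qed

lemma measurable_mgp_term:
  assumes n: "n \<ge> 2" "0 < \<mu>"
    and F: "(\<lambda>w. F (fst w) (snd w)) \<in> borel_measurable (A \<Otimes>\<^sub>M big_space n)"
    and a: "a \<in> N \<rightarrow>\<^sub>M A" and t: "t \<in> borel_measurable N" and x: "x \<in> N \<rightarrow>\<^sub>M big_space n"
  shows "(\<lambda>w. mgp_term n \<mu> k (t w) (F (a w)) (x w)) \<in> borel_measurable N"
  using measurable_compose[OF measurable_Pair[OF a measurable_Pair[OF t x]] measurable_mgp_term_aux[OF n F]]
  by simp

lemma measurable_mgp_term_fixed:
  assumes n: "n \<ge> 2" "0 < \<mu>" and f: "f \<in> borel_measurable (big_space n)"
    and t: "t \<in> borel_measurable N" and x: "x \<in> N \<rightarrow>\<^sub>M big_space n"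
  shows "(\<lambda>w. mgp_term n \<mu> k (t w) f (x w)) \<in> borel_measurable N"
proof -
  have "(\<lambda>w. f (snd w)) \<in> borel_measurable (count_space (UNIV::unit set) \<Otimes>\<^sub>M big_space n)"
    by (rule measurable_compose[OF measurable_snd f])
  from measurable_mgp_term[OF n this _ t x, of "\<lambda>_. ()"] show ?thesis by simp
qed

lemma moran_jump_flow_big:
  assumes "n \<ge> 2" "x \<in> space (big_space n)"
  shows "moran_jump n p (mgp_flow n h x) \<in> space (big_space n)"
proof -
  have "(\<lambda>h. mgp_flow n h x) \<in> borel \<rightarrow>\<^sub>M big_space n" using assms by (intro measurable_mgp_flow) auto
  from measurable_space[OF measurable_compose[OF this measurable_moran_jump]] show ?thesis by simp
qed

definition last_step :: "nat \<Rightarrow> ((nat \<Rightarrow> nat set set) \<times> (nat \<Rightarrow> real) \<Rightarrow> ennreal) \<Rightarrow> real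
    \<Rightarrow> (nat \<Rightarrow> nat set set) \<times> (nat \<Rightarrow> real) \<Rightarrow> ennreal" where
  "last_step n f h = jump_avg n (\<lambda>z. f (mgp_flow n h z))"

lemma measurable_last_step:
  assumes n: "n \<ge> 2" and f: "f \<in> borel_measurable (big_space n)"
  shows "(\<lambda>w. last_step n f (fst w) (snd w)) \<in> borel_measurable (borel \<Otimes>\<^sub>M big_space n)"
  unfolding last_step_def
proof (rule measurable_jump_avg)
  fix p
  show "(\<lambda>w. f (mgp_flow n (fst w) (moran_jump n p (snd w)))) \<in> borel_measurable (borel \<Otimes>\<^sub>M big_space n)"
    by (intro measurable_compose[OF _ f] measurable_mgp_flow n measurable_fst
        measurable_compose[OF measurable_snd measurable_moran_jump])
qed

lemma mgp_term_last_step: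
  assumes n: "n \<ge> 2" "0 < \<mu>" and f: "f \<in> borel_measurable (big_space n)" and x: "x \<in> space (big_space n)"
  shows "mgp_term n \<mu> (Suc k) t f x = (\<integral>\<^sup>+h. mgp_term n \<mu> k (t - h) (last_step n f h) x \<partial>exp_clock \<mu>)"
  using x
proof (induction k arbitrary: t x)
  case 0
  define G where "G h = jump_avg n (\<lambda>z. f (mgp_flow n (t - h) z)) (mgp_flow n h x)" for h
  let ?c = "ennreal (\<mu> * exp (- \<mu> * t))"
  have cx: "(\<lambda>h. x) \<in> borel \<rightarrow>\<^sub>M big_space n" using 0 by simp
  have G [measurable]: "G \<in> borel_measurable borel" unfolding G_def
    by (intro measurable_jump_avg measurable_compose[OF _ f] measurable_mgp_flow n
        measurable_compose[OF _ measurable_moran_jump] cx) auto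
  have weight: "ennreal (\<mu> * exp (- \<mu> * h)) * (indicator {0..} (t - h) * ennreal (exp (- \<mu> * (t - h))) * z) * indicator {0..} h
      = ?c * z * indicator {0..t} h" for h z
  proof -
    have "?c = ennreal (\<mu> * exp (- \<mu> * h)) * ennreal (exp (- \<mu> * (t - h)))"
      using n by (subst ennreal_mult[symmetric]) (auto simp: mult_exp_exp algebra_simps)
    then show ?thesis by (auto split: split_indicator simp: mult_ac)
  qed
  have W: "(\<integral>\<^sup>+h. indicator {0..} (t - h) * ennreal (exp (- \<mu> * (t - h))) * H h \<partial>exp_clock \<mu>)
      = (\<integral>\<^sup>+h. ?c * H h * indicator {0..t} h \<partial>lborel)" if [measurable]: "H \<in> borel_measurable borel" for H
  proof -
    have m: "(\<lambda>h. indicator {0..} (t - h) * ennreal (exp (- \<mu> * (t - h))) * H h) \<in> borel_measurable borel"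
      by measurable
    show ?thesis unfolding nn_integral_exponential_density[OF m n(2)] nn_integral_exp_measure[OF m] weight ..
  qed
  have avg0: "jump_avg n (mgp_term n \<mu> 0 s f) y = indicator {0..} s * ennreal (exp (- \<mu> * s)) * jump_avg n (\<lambda>z. f (mgp_flow n s z)) y" for s y
    unfolding jump_avg_def mgp_term.simps by (simp add: sum_distrib_left mult_ac)
  have "mgp_term n \<mu> (Suc 0) t f x
     = (\<integral>\<^sup>+h. indicator {0..} (t - h) * ennreal (exp (- \<mu> * (t - h))) * G h \<partial>exp_clock \<mu>)"
    unfolding mgp_term.simps(2) avg0 G_def ..
  also have "\<dots> = (\<integral>\<^sup>+h. ?c * G h * indicator {0..t} h \<partial>lborel)"
    by (rule W[OF G])
  also have "\<dots> = (\<integral>\<^sup>+h. ?c * G (t - h) * indicator {0..t} (t - h) \<partial>lborel)"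
    by (subst nn_integral_real_affine[of _ "-1" t]) auto
  also have "\<dots> = (\<integral>\<^sup>+h. ?c * G (t - h) * indicator {0..t} h \<partial>lborel)"
    by (intro nn_integral_cong) (auto split: split_indicator)
  also have "\<dots> = (\<integral>\<^sup>+h. indicator {0..} (t - h) * ennreal (exp (- \<mu> * (t - h))) * G (t - h) \<partial>exp_clock \<mu>)"
    by (rule W[symmetric]) measurable
  also have "\<dots> = (\<integral>\<^sup>+h. mgp_term n \<mu> 0 (t - h) (last_step n f h) x \<partial>exp_clock \<mu>)"
    unfolding mgp_term.simps last_step_def G_def by simp
  finally show ?case .
next
  case (Suc k)
  interpret E: prob_space "exp_clock \<mu>" by (rule prob_space_exponential_density[OF n(2)])
  interpret EE: pair_sigma_finite "exp_clock \<mu>" "exp_clock \<mu>" ..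
  let ?c = "ennreal (1 / (real n * real (n - 1)))"
  let ?T = "\<lambda>p h h'. mgp_term n \<mu> k (t - h - h') (last_step n f h') (moran_jump n p (mgp_flow n h x))"
  note inS = moran_jump_flow_big[OF n(1) Suc.prems]
  have id: "(\<lambda>x. x) \<in> exp_clock \<mu> \<rightarrow>\<^sub>M borel" by simp
  have mT: "(\<lambda>w. ?T p (fst w) (snd w)) \<in> borel_measurable (exp_clock \<mu> \<Otimes>\<^sub>M exp_clock \<mu>)" for p
    using Suc.prems
    by (intro measurable_mgp_term[OF n measurable_last_step[OF n(1) f]] borel_measurable_diff measurable_const
        measurable_compose[OF measurable_fst id] measurable_compose[OF measurable_snd id]
        measurable_compose[OF _ measurable_moran_jump] measurable_mgp_flow n) auto
  have mT1: "(\<lambda>h'. ?T p h h') \<in> borel_measurable (exp_clock \<mu>)" for p h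
    using measurable_compose[OF measurable_Pair1'[of h "exp_clock \<mu>" "exp_clock \<mu>"] mT[of p]] by simp
  have "mgp_term n \<mu> (Suc (Suc k)) t f x
     = (\<integral>\<^sup>+h. (\<Sum>p\<in>moran_pairs n. ?c * (\<integral>\<^sup>+h'. ?T p h h' \<partial>exp_clock \<mu>)) \<partial>exp_clock \<mu>)"
    unfolding mgp_term.simps(2)[of n \<mu> "Suc k"] jump_avg_def Suc.IH[OF inS] ..
  also have "\<dots> = (\<integral>\<^sup>+h. \<integral>\<^sup>+h'. (\<Sum>p\<in>moran_pairs n. ?c * ?T p h h') \<partial>exp_clock \<mu> \<partial>exp_clock \<mu>)"
    using mT1 by (intro nn_integral_cong) (subst nn_integral_sum, auto simp only: nn_integral_cmult space_borel intro!: borel_measurable_times_ennreal measurable_const)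
  also have "\<dots> = (\<integral>\<^sup>+h'. \<integral>\<^sup>+h. (\<Sum>p\<in>moran_pairs n. ?c * ?T p h h') \<partial>exp_clock \<mu> \<partial>exp_clock \<mu>)"
  proof (rule EE.Fubini'[symmetric])
    have "(\<lambda>w. \<Sum>p\<in>moran_pairs n. ?c * ?T p (fst w) (snd w)) \<in> borel_measurable (exp_clock \<mu> \<Otimes>\<^sub>M exp_clock \<mu>)"
      using mT by (intro borel_measurable_sum borel_measurable_times_ennreal) auto
    then show "(\<lambda>(h, h'). \<Sum>p\<in>moran_pairs n. ?c * ?T p h h') \<in> borel_measurable (exp_clock \<mu> \<Otimes>\<^sub>M exp_clock \<mu>)"
      by (simp only: case_prod_beta' fst_conv snd_conv)
  qed
  also have "\<dots> = (\<integral>\<^sup>+h'. mgp_term n \<mu> (Suc k) (t - h') (last_step n f h') x \<partial>exp_clock \<mu>)"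
    unfolding mgp_term.simps(2) jump_avg_def
  proof (intro nn_integral_cong)
    fix h' h
    have "t - h - h' = t - h' - h" by simp
    then show "(\<Sum>p\<in>moran_pairs n. ?c * ?T p h h') = (\<Sum>p\<in>moran_pairs n. ?c *
        mgp_term n \<mu> k (t - h' - h) (last_step n f h') (moran_jump n p (mgp_flow n h x)))"
      by (simp only:)
  qed
  finally show ?case .
qed


lemma sum_mgp_term_stationary_le:
  assumes n: "n \<ge> 2" "0 < \<mu>" and f: "f \<in> borel_measurable (big_space n)" and t: "0 \<le> t"
  shows "(\<Sum>j<k. \<integral>\<^sup>+x. mgp_term n \<mu> j t f x \<partial>mgp_stationary n \<mu>) \<le> (\<integral>\<^sup>+x. f x \<partial>mgp_stationary n \<mu>)"
  using f t
proof (induction k arbitrary: f t)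
  case 0
  then show ?case by simp
next
  case (Suc k)
  note f = Suc.prems(1)
  let ?\<pi> = "mgp_stationary n \<mu>" and ?E = "exp_clock \<mu>"
  let ?R = "\<integral>\<^sup>+h. indicator {..t} h * (\<integral>\<^sup>+x. f (mgp_flow n h (reset_last n x)) \<partial>?\<pi>) \<partial>?E"
  interpret P: prob_space ?\<pi> by (rule prob_space_mgp_stationary[OF n])
  interpret E: prob_space ?E by (rule prob_space_exponential_density[OF n(2)])
  interpret PE: pair_sigma_finite ?\<pi> ?E ..
  have idE: "(\<lambda>h. h) \<in> ?E \<rightarrow>\<^sub>M borel" by simp
  have idP: "(\<lambda>x. x) \<in> ?\<pi> \<rightarrow>\<^sub>M big_space n"
    using measurable_state_big measurable_cong_sets[OF sets_mgp_stationary refl] by blast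
  have sp: "x \<in> space (big_space n)" if "x \<in> space ?\<pi>" for x
    using measurable_space[OF idP that] .
  have mT: "(\<lambda>w. mgp_term n \<mu> j (t - snd w) (last_step n f (snd w)) (fst w)) \<in> borel_measurable (?\<pi> \<Otimes>\<^sub>M ?E)" for j
    by (intro measurable_mgp_term[OF n measurable_last_step[OF n(1) f]] borel_measurable_diff measurable_const
        measurable_compose[OF measurable_fst idP] measurable_compose[OF measurable_snd idE]) auto
  have step: "(\<integral>\<^sup>+x. mgp_term n \<mu> (Suc j) t f x \<partial>?\<pi>) = (\<integral>\<^sup>+h. \<integral>\<^sup>+x. mgp_term n \<mu> j (t - h) (last_step n f h) x \<partial>?\<pi> \<partial>?E)" for j
  proof -
    have "(\<integral>\<^sup>+x. mgp_term n \<mu> (Suc j) t f x \<partial>?\<pi>) = (\<integral>\<^sup>+x. \<integral>\<^sup>+h. mgp_term n \<mu> j (t - h) (last_step n f h) x \<partial>?E \<partial>?\<pi>)"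
      by (rule nn_integral_cong) (rule mgp_term_last_step[OF n f sp])
    also have "\<dots> = (\<integral>\<^sup>+h. \<integral>\<^sup>+x. mgp_term n \<mu> j (t - h) (last_step n f h) x \<partial>?\<pi> \<partial>?E)"
      using mT by (intro PE.Fubini'[symmetric]) (simp only: case_prod_beta')
    finally show ?thesis .
  qed
  have mS: "(\<lambda>h. \<integral>\<^sup>+x. mgp_term n \<mu> j (t - h) (last_step n f h) x \<partial>?\<pi>) \<in> borel_measurable ?E" for j
    using measurable_compose[OF measurable_pair_swap' mT]
    by (intro P.borel_measurable_nn_integral) (simp only: case_prod_beta' fst_conv snd_conv)
  have mls: "last_step n f h \<in> borel_measurable (big_space n)" for h
    using measurable_compose[OF measurable_Pair1'[of h borel "big_space n"] measurable_last_step[OF n(1) f]] by simp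
  have "(\<Sum>j<k. \<integral>\<^sup>+x. mgp_term n \<mu> (Suc j) t f x \<partial>?\<pi>)
     = (\<integral>\<^sup>+h. (\<Sum>j<k. \<integral>\<^sup>+x. mgp_term n \<mu> j (t - h) (last_step n f h) x \<partial>?\<pi>) \<partial>?E)"
    unfolding step using mS by (intro nn_integral_sum[symmetric])
  also have "\<dots> \<le> ?R"
  proof (rule nn_integral_mono)
    fix h
    show "(\<Sum>j<k. \<integral>\<^sup>+x. mgp_term n \<mu> j (t - h) (last_step n f h) x \<partial>?\<pi>)
      \<le> indicator {..t} h * (\<integral>\<^sup>+x. f (mgp_flow n h (reset_last n x)) \<partial>?\<pi>)"
    proof (cases "h \<le> t")
      case True
      have "(\<Sum>j<k. \<integral>\<^sup>+x. mgp_term n \<mu> j (t - h) (last_step n f h) x \<partial>?\<pi>) \<le> (\<integral>\<^sup>+x. last_step n f h x \<partial>?\<pi>)"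
        using True by (intro Suc.IH mls) auto
      also have "\<dots> \<le> (\<integral>\<^sup>+x. f (mgp_flow n h (reset_last n x)) \<partial>?\<pi>)"
        unfolding last_step_def
        by (intro stationary_jump_le n measurable_compose[OF measurable_mgp_flow f]) auto
      finally show ?thesis using True by simp
    next
      case False
      then show ?thesis using mgp_term_neg[of "t - h"] by simp
    qed
  qed
  finally have A: "(\<Sum>j<k. \<integral>\<^sup>+x. mgp_term n \<mu> (Suc j) t f x \<partial>?\<pi>)
     \<le> ?R" .
  have B: "(\<integral>\<^sup>+x. mgp_term n \<mu> 0 t f x \<partial>?\<pi>) = ennreal (exp (- \<mu> * t)) * (\<integral>\<^sup>+x. f (mgp_flow n t x) \<partial>?\<pi>)"
  proof -
    have "(\<lambda>x. f (mgp_flow n t x)) \<in> borel_measurable ?\<pi>"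
      by (intro measurable_compose[OF measurable_mgp_flow f] n idP) auto
    from nn_integral_cmult[OF this] show ?thesis using Suc.prems(2) by simp
  qed
  have "(\<Sum>j<Suc k. \<integral>\<^sup>+x. mgp_term n \<mu> j t f x \<partial>?\<pi>)
     \<le> ennreal (exp (- \<mu> * t)) * (\<integral>\<^sup>+x. f (mgp_flow n t x) \<partial>?\<pi>)
       + ?R"
    unfolding sum.lessThan_Suc_shift B by (rule add_left_mono[OF A])
  also have "\<dots> = (\<integral>\<^sup>+x. f x \<partial>?\<pi>)" by (rule stationary_flow[OF n f Suc.prems(2)])
  finally show ?case .
qed

definition pair_prob :: "nat \<Rightarrow> real" where
  "pair_prob n = 1 / (real n * real (n - 1))"

definition coupling_weight :: "nat \<Rightarrow> nat \<Rightarrow> real" where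
  "coupling_weight n c = 2 * (1 - (pair_prob n / 2) ^ (n - c))"

definition coupling_rate :: "nat \<Rightarrow> real" where
  "coupling_rate n = 1 - (pair_prob n / 2) ^ n"

lemma pair_prob_bounds:
  assumes "n \<ge> 2"
  shows "0 < pair_prob n" "pair_prob n \<le> 1"
proof -
  have "1 \<le> real n * real (n - 1)"
    using assms mult_mono[of 1 "real n" 1 "real (n - 1)"] by auto
  moreover from this have "0 < real n * real (n - 1)" by linarith
  ultimately show "0 < pair_prob n" "pair_prob n \<le> 1"
    unfolding pair_prob_def by (simp_all only: zero_less_divide_1_iff divide_le_eq_1_pos)
qed

lemma coupling_bounds:
  assumes "n \<ge> 2"
  shows "0 \<le> coupling_weight n c" "coupling_weight n c \<le> 2" "c < n \<Longrightarrow> 1 \<le> coupling_weight n c"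
    "0 \<le> coupling_rate n" "coupling_rate n < 1"
proof -
  let ?e = "pair_prob n / 2"
  have e: "0 < ?e" "?e \<le> 1 / 2" "?e \<le> 1" using pair_prob_bounds[OF assms] by auto
  show "0 \<le> coupling_weight n c" "coupling_weight n c \<le> 2"
    unfolding coupling_weight_def using e power_le_one[of ?e "n - c"] by auto
  show "1 \<le> coupling_weight n c" if "c < n"
  proof -
    have "?e ^ (n - c) \<le> ?e ^ 1" using e that by (intro power_decreasing) auto
    then show ?thesis using e unfolding coupling_weight_def by simp
  qed
  show "0 \<le> coupling_rate n" "coupling_rate n < 1"
    unfolding coupling_rate_def using e power_le_one[of ?e n] by auto
qed

text \<open>The weights solve the drift inequality of a counter that advances from \<open>c\<close> to \<open>c + 1\<close> with
  the probability of one prescribed pair and otherwise falls back to \<open>1\<close>.\<close>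

lemma coupling_drift:
  assumes n: "n \<ge> 2" and c: "1 \<le> c" "c < n"
  shows "pair_prob n * coupling_weight n (Suc c) + (1 - pair_prob n) * coupling_weight n 1
     \<le> coupling_rate n * coupling_weight n c"
proof -
  let ?p = "pair_prob n" and ?e = "pair_prob n / 2"
  have p: "0 < ?p" "?p \<le> 1" by (rule pair_prob_bounds[OF n])+
  have pow: "?e ^ (n - c) = ?e * ?e ^ (n - Suc c)" using c by (simp add: Suc_diff_Suc flip: power_Suc)
  have le: "?e ^ n \<le> ?e ^ (n - c)" using p by (intro power_decreasing) auto
  have "?p * coupling_weight n (Suc c) + (1 - ?p) * coupling_weight n 1
      = 2 * (1 - 2 * ?e ^ (n - c) - (1 - ?p) * ?e ^ (n - 1))"
    unfolding coupling_weight_def pow by (simp add: algebra_simps)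
  also have "\<dots> \<le> 2 * (1 - 2 * ?e ^ (n - c))" using p by simp
  also have "\<dots> \<le> 2 * (1 - ?e ^ (n - c) - ?e ^ n + ?e ^ n * ?e ^ (n - c))"
  proof -
    have "0 \<le> ?e ^ n * ?e ^ (n - c)" using p by (intro mult_nonneg_nonneg zero_le_power) auto
    moreover have "2 * (1 - 2 * b) \<le> 2 * (1 - b - a + z)" if "0 \<le> z" "a \<le> b" for a b z :: real
      using that by simp
    ultimately show ?thesis using le by blast
  qed
  also have "\<dots> = coupling_rate n * coupling_weight n c"
    unfolding coupling_weight_def coupling_rate_def by (simp add: algebra_simps)
  finally show ?thesis .
qed

lemma mgp_term_coupling:
  assumes n: "n \<ge> 2" "0 < \<mu>" and f: "f \<in> borel_measurable (big_space n)" and f1: "\<And>x. f x \<le> 1"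
    and "x \<in> state_set n" "y \<in> state_set n" "agree n c x y" "1 \<le> c" "c \<le> n"
  shows "mgp_term n \<mu> k t f x \<le> mgp_term n \<mu> k t f y
     + ennreal (coupling_weight n c) * pois_weight \<mu> (coupling_rate n) k t"
  using assms(5-)
proof (induction k arbitrary: t x y c)
  case 0
  show ?case
  proof (cases "c = n")
    case True
    then show ?thesis using agree_n[OF 0(1,2)] 0(3) by auto
  next
    case False
    then have "ennreal 1 \<le> ennreal (coupling_weight n c)" using coupling_bounds(3)[OF n(1), of c] 0 by (intro ennreal_leI) auto
    then have w: "1 \<le> ennreal (coupling_weight n c)" by simp
    have "mgp_term n \<mu> 0 t f x \<le> indicator {0..} t * ennreal (exp (- \<mu> * t)) * 1"
      unfolding mgp_term.simps by (intro mult_left_mono f1) auto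
    also have "\<dots> = 1 * pois_weight \<mu> (coupling_rate n) 0 t" by (simp add: pois_weight_def)
    also have "\<dots> \<le> ennreal (coupling_weight n c) * pois_weight \<mu> (coupling_rate n) 0 t"
      using w by (intro mult_right_mono) auto
    finally show ?thesis by (simp add: add_increasing)
  qed
next
  case (Suc k)
  let ?E = "exp_clock \<mu>" and ?W = "pois_weight \<mu> (coupling_rate n) k"
  let ?w = "coupling_weight n" and ?th = "coupling_rate n"
  show ?case
  proof (cases "c = n")
    case True
    then show ?thesis using agree_n[OF Suc.prems(1,2)] Suc.prems(3) by auto
  next
    case False
    then have c: "1 \<le> c" "c < n" using Suc.prems by auto
    have my: "(\<lambda>h. y) \<in> borel \<rightarrow>\<^sub>M big_space n"
      using measurable_space[OF measurable_state_big, of y n] Suc.prems(2) space_state_space by auto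
    have ptw: "jump_avg n (mgp_term n \<mu> k (t - h) f) (mgp_flow n h x)
       \<le> jump_avg n (mgp_term n \<mu> k (t - h) f) (mgp_flow n h y) + ennreal (?w c) * (ennreal ?th * ?W (t - h))"
      if h: "0 \<le> h" for h
    proof -
      let ?x = "mgp_flow n h x" and ?y = "mgp_flow n h y"
      have xy: "?x \<in> state_set n" "?y \<in> state_set n"
        using mgp_flow_state_set Suc.prems(1,2) h n(1) by auto
      define d where "d p = (if p = (Suc c, 1) then Suc c else 1)" for p :: "nat \<times> nat"
      have ag: "agree n (d p) (moran_jump n p ?x) (moran_jump n p ?y)" if "p \<in> moran_pairs n" for p
        using agree_step[OF Suc.prems(1-3) c] agree_1[OF moran_jump_state_set[OF xy(1) n(1) that]
            moran_jump_state_set[OF xy(2) n(1) that] n(1)]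
        unfolding d_def by simp
      have "(\<Sum>p\<in>moran_pairs n. ennreal (pair_prob n) * ennreal (?w (d p))) = ennreal (\<Sum>p\<in>moran_pairs n. pair_prob n * ?w (d p))"
        using pair_prob_bounds[OF n(1)] coupling_bounds(1)[OF n(1)]
        by (simp add: ennreal_mult sum_ennreal[symmetric])
      also have "\<dots> \<le> ennreal (?th * ?w c)"
      proof (rule ennreal_leI)
        let ?P = "moran_pairs n" and ?q = "(Suc c, 1::nat)"
        have q: "?q \<in> ?P" using c unfolding moran_pairs_def by auto
        have "(\<Sum>p\<in>?P. pair_prob n * ?w (d p)) = pair_prob n * ?w (Suc c) + (\<Sum>p\<in>?P - {?q}. pair_prob n * ?w (d p))"
          using q finite_moran_pairs by (subst sum.remove[of _ ?q]) (auto simp: d_def)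
        also have "(\<Sum>p\<in>?P - {?q}. pair_prob n * ?w (d p)) = (\<Sum>p\<in>?P - {?q}. pair_prob n * ?w 1)"
          by (intro sum.cong) (auto simp: d_def)
        also have "\<dots> = (real (n * (n - 1)) - 1) * (pair_prob n * ?w 1)"
        proof -
          have "card (?P - {?q}) = n * (n - 1) - 1" using q by (simp add: card_moran_pairs)
          moreover have "1 \<le> n * (n - 1)" using n(1) by (simp add: Suc_le_eq)
          ultimately have "real (card (?P - {?q})) = real (n * (n - 1)) - 1"
            by (simp only: of_nat_diff of_nat_1)
          then show ?thesis by (simp only: sum_constant)
        qed
        also have "\<dots> = (1 - pair_prob n) * ?w 1"
          using n(1) unfolding pair_prob_def by (simp add: field_simps)
        finally show "(\<Sum>p\<in>?P. pair_prob n * ?w (d p)) \<le> ?th * ?w c"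
          using coupling_drift[OF n(1) c] by simp
      qed
      finally have S: "(\<Sum>p\<in>moran_pairs n. ennreal (pair_prob n) * ennreal (?w (d p))) \<le> ennreal (?th * ?w c)" .
      have "jump_avg n (mgp_term n \<mu> k (t - h) f) ?x
        \<le> (\<Sum>p\<in>moran_pairs n. ennreal (pair_prob n) * (mgp_term n \<mu> k (t - h) f (moran_jump n p ?y) + ennreal (?w (d p)) * ?W (t - h)))"
        unfolding jump_avg_def pair_prob_def[symmetric]
      proof (intro sum_mono mult_left_mono)
        fix p assume p: "p \<in> moran_pairs n"
        show "mgp_term n \<mu> k (t - h) f (moran_jump n p ?x)
           \<le> mgp_term n \<mu> k (t - h) f (moran_jump n p ?y) + ennreal (?w (d p)) * ?W (t - h)"
          using c by (intro Suc.IH moran_jump_state_set xy n p ag) (auto simp: d_def)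
      qed simp
      also have "\<dots> = jump_avg n (mgp_term n \<mu> k (t - h) f) ?y + (\<Sum>p\<in>moran_pairs n. ennreal (pair_prob n) * ennreal (?w (d p))) * ?W (t - h)"
        unfolding jump_avg_def pair_prob_def[symmetric]
        by (simp only: distrib_left sum.distrib sum_distrib_right mult.assoc)
      also have "\<dots> \<le> jump_avg n (mgp_term n \<mu> k (t - h) f) ?y + ennreal (?th * ?w c) * ?W (t - h)"
        by (intro add_left_mono mult_right_mono S) simp
      also have "ennreal (?th * ?w c) * ?W (t - h) = ennreal (?w c) * (ennreal ?th * ?W (t - h))"
        using coupling_bounds[OF n(1)] by (simp add: ennreal_mult mult_ac)
      finally show ?thesis .
    qed
    have "(\<lambda>h. jump_avg n (mgp_term n \<mu> k (t - h) f) (mgp_flow n h y)) \<in> borel_measurable borel"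
      by (intro measurable_jump_avg measurable_mgp_term_fixed[OF n f] borel_measurable_diff
          measurable_compose[OF _ measurable_moran_jump] measurable_mgp_flow n my) auto
    then have m1: "(\<lambda>h. jump_avg n (mgp_term n \<mu> k (t - h) f) (mgp_flow n h y)) \<in> borel_measurable ?E"
      by simp
    have "mgp_term n \<mu> (Suc k) t f x \<le> (\<integral>\<^sup>+h. jump_avg n (mgp_term n \<mu> k (t - h) f) (mgp_flow n h y)
        + ennreal (?w c) * (ennreal ?th * ?W (t - h)) \<partial>?E)"
      unfolding mgp_term.simps
    proof (rule nn_integral_mono_AE)
      show "AE h in ?E. jump_avg n (mgp_term n \<mu> k (t - h) f) (mgp_flow n h x)
         \<le> jump_avg n (mgp_term n \<mu> k (t - h) f) (mgp_flow n h y) + ennreal (?w c) * (ennreal ?th * ?W (t - h))"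
        using AE_exp_clock_nonneg by eventually_elim (rule ptw)
    qed
    also have "\<dots> = mgp_term n \<mu> (Suc k) t f y + ennreal (?w c) * (\<integral>\<^sup>+h. ennreal ?th * ?W (t - h) \<partial>?E)"
      using m1 by (subst nn_integral_add) (auto simp: nn_integral_cmult)
    also have "(\<integral>\<^sup>+h. ennreal ?th * ?W (t - h) \<partial>?E) = pois_weight \<mu> ?th (Suc k) t"
      by (rule pois_weight_Suc[OF n(2) coupling_bounds(4)[OF n(1)]])
    finally show ?thesis .
  qed
qed

lemma suminf_mgp_term_coupling:
  assumes n: "n \<ge> 2" "0 < \<mu>" and f: "f \<in> borel_measurable (big_space n)" and f1: "\<And>x. f x \<le> 1"
    and xy: "x \<in> state_set n" "y \<in> state_set n" and t: "0 \<le> t"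
  shows "(\<Sum>k. mgp_term n \<mu> k t f x) \<le> (\<Sum>k. mgp_term n \<mu> k t f y)
     + ennreal (2 * exp (- (1 - coupling_rate n) * \<mu> * t))"
proof -
  let ?w = "coupling_weight n 1" and ?th = "coupling_rate n"
  have "(\<Sum>k. mgp_term n \<mu> k t f x) \<le> (\<Sum>k. mgp_term n \<mu> k t f y + ennreal ?w * pois_weight \<mu> ?th k t)"
    using n(1) by (intro suminf_le mgp_term_coupling n f f1 xy agree_1 summableI) auto
  also have "\<dots> = (\<Sum>k. mgp_term n \<mu> k t f y) + ennreal ?w * (\<Sum>k. pois_weight \<mu> ?th k t)"
    by (simp add: suminf_add[symmetric])
  also have "(\<Sum>k. pois_weight \<mu> ?th k t) = ennreal (exp (- (1 - ?th) * \<mu> * t))"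
    unfolding suminf_pois_weight[OF n(2) coupling_bounds(4)[OF n(1)] t]
    by (simp add: mult_exp_exp algebra_simps)
  also have "ennreal ?w * ennreal (exp (- (1 - ?th) * \<mu> * t)) = ennreal (?w * exp (- (1 - ?th) * \<mu> * t))"
    using coupling_bounds(1)[OF n(1)] by (simp add: ennreal_mult)
  also have "\<dots> \<le> ennreal (2 * exp (- (1 - ?th) * \<mu> * t))"
    using coupling_bounds(2)[OF n(1)] by (intro ennreal_leI mult_right_mono) auto
  finally show ?thesis by (simp add: add_left_mono)
qed

subsection \<open>The driving noise\<close>

abbreviation mark_measure :: "nat \<Rightarrow> real \<Rightarrow> (real \<times> (nat \<times> nat)) measure" where
  "mark_measure n \<mu> \<equiv> exp_clock \<mu> \<Otimes>\<^sub>M measure_pmf (pmf_of_set (moran_pairs n))"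

lemma moran_pairs_nonempty: "n \<ge> 2 \<Longrightarrow> moran_pairs n \<noteq> {}"
proof -
  assume "n \<ge> 2"
  then have "(1, 2) \<in> moran_pairs n" unfolding moran_pairs_def by auto
  then show ?thesis by blast
qed

lemma prob_space_mark_measure:
  assumes "0 < \<mu>"
  shows "prob_space (mark_measure n \<mu>)"
proof -
  interpret E: prob_space "exp_clock \<mu>" by (rule prob_space_exponential_density[OF assms])
  interpret P: pair_prob_space "exp_clock \<mu>" "measure_pmf (pmf_of_set (moran_pairs n))" ..
  show ?thesis by (rule P.prob_space_axioms)
qed

lemma prob_space_driving:
  assumes "0 < \<mu>"
  shows "prob_space (driving n \<mu>)"
  unfolding driving_def by (rule prob_space.prob_space_stream_space[OF prob_space_mark_measure[OF assms]])

lemma nn_integral_moran_pmf: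
  assumes "n \<ge> 2"
  shows "(\<integral>\<^sup>+p. g (moran_jump n p y) \<partial>measure_pmf (pmf_of_set (moran_pairs n))) = jump_avg n g y"
proof -
  have ne: "moran_pairs n \<noteq> {}" "finite (moran_pairs n)" using moran_pairs_nonempty[OF assms] finite_moran_pairs by auto
  have "(\<integral>\<^sup>+p. g (moran_jump n p y) \<partial>measure_pmf (pmf_of_set (moran_pairs n)))
     = (\<Sum>p\<in>moran_pairs n. g (moran_jump n p y) * ennreal (pmf (pmf_of_set (moran_pairs n)) p))"
    using ne by (subst nn_integral_measure_pmf_finite) auto
  also have "\<dots> = jump_avg n g y"
    unfolding jump_avg_def using ne
    by (intro sum.cong refl) (simp add: pmf_of_set card_moran_pairs mult.commute)
  finally show ?thesis .
qed

lemma nn_integral_mark_measure: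
  assumes n: "n \<ge> 2" "0 < \<mu>" and g: "g \<in> borel_measurable (mark_measure n \<mu>)"
  shows "(\<integral>\<^sup>+a. g a \<partial>mark_measure n \<mu>) = (\<integral>\<^sup>+h. \<integral>\<^sup>+p. g (h, p) \<partial>measure_pmf (pmf_of_set (moran_pairs n)) \<partial>exp_clock \<mu>)"
  by (rule measure_pmf.nn_integral_fst[OF g, symmetric])

lemma measurable_mark_time: "(\<lambda>\<omega>. fst (\<omega> !! k)) \<in> borel_measurable (driving n \<mu>)"
proof -
  have "fst \<in> mark_measure n \<mu> \<rightarrow>\<^sub>M exp_clock \<mu>" by simp
  moreover have "(\<lambda>x. x) \<in> exp_clock \<mu> \<rightarrow>\<^sub>M borel" by simp
  ultimately have "fst \<in> mark_measure n \<mu> \<rightarrow>\<^sub>M borel" using measurable_compose by blast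
  from measurable_compose[OF measurable_snth this] show ?thesis unfolding driving_def .
qed

lemma measurable_mark_pair: "(\<lambda>\<omega>. snd (\<omega> !! k)) \<in> driving n \<mu> \<rightarrow>\<^sub>M count_space UNIV"
proof -
  have "snd \<in> mark_measure n \<mu> \<rightarrow>\<^sub>M measure_pmf (pmf_of_set (moran_pairs n))" by simp
  moreover have "(\<lambda>x. x) \<in> measure_pmf (pmf_of_set (moran_pairs n)) \<rightarrow>\<^sub>M count_space UNIV" by simp
  ultimately have "snd \<in> mark_measure n \<mu> \<rightarrow>\<^sub>M count_space UNIV" using measurable_compose by blast
  from measurable_compose[OF measurable_snth this] show ?thesis unfolding driving_def .
qed

lemma measurable_ev_time [measurable]: "(\<lambda>\<omega>. ev_time \<omega> k) \<in> borel_measurable (driving n \<mu>)"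
  unfolding ev_time_def by (intro borel_measurable_sum measurable_mark_time)

lemma measurable_post_state:
  assumes "n \<ge> 2" "x \<in> space (big_space n)"
  shows "(\<lambda>\<omega>. post_state n x \<omega> k) \<in> driving n \<mu> \<rightarrow>\<^sub>M big_space n"
proof (induction k)
  case 0
  then show ?case using assms(2) by simp
next
  case (Suc k)
  have "(\<lambda>\<omega>. moran_jump n p (mgp_flow n (fst (\<omega> !! k)) (post_state n x \<omega> k))) \<in> driving n \<mu> \<rightarrow>\<^sub>M big_space n" for p
    by (intro measurable_compose[OF _ measurable_moran_jump] measurable_mgp_flow assms(1) measurable_mark_time Suc)
  from measurable_compose_countable[OF this measurable_mark_pair] show ?case by simp
qed

definition ev_window :: "nat \<Rightarrow> real \<Rightarrow> (real \<times> (nat \<times> nat)) stream set" where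
  "ev_window k t = {\<omega>. ev_time \<omega> k \<le> t \<and> t < ev_time \<omega> (Suc k)}"

lemma ev_time_Stream: "ev_time (a ## \<omega>) (Suc k) = fst a + ev_time \<omega> k"
  unfolding ev_time_def by (simp add: sum.lessThan_Suc_shift del: sum.lessThan_Suc)

lemma post_state_Stream:
  "post_state n x (a ## \<omega>) (Suc k) = post_state n (moran_jump n (snd a) (mgp_flow n (fst a) x)) \<omega> k"
  by (induction k) simp_all

lemma ev_window_Stream: "a ## \<omega> \<in> ev_window (Suc k) t \<longleftrightarrow> \<omega> \<in> ev_window k (t - fst a)"
  unfolding ev_window_def by (auto simp: ev_time_Stream)

lemma measurable_window_state:
  fixes f :: "_ \<Rightarrow> ennreal"
  assumes n: "n \<ge> 2" and f: "f \<in> borel_measurable (big_space n)" and x: "x \<in> space (big_space n)"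
  shows "(\<lambda>\<omega>. indicator (ev_window k t) \<omega> * f (mgp_flow n (t - ev_time \<omega> k) (post_state n x \<omega> k)))
    \<in> borel_measurable (driving n \<mu>)"
proof (rule borel_measurable_times_ennreal)
  have "Measurable.pred (driving n \<mu>) (\<lambda>\<omega>. ev_time \<omega> k \<le> t \<and> t < ev_time \<omega> (Suc k))" by measurable
  then show "(\<lambda>\<omega>. indicator (ev_window k t) \<omega> :: ennreal) \<in> borel_measurable (driving n \<mu>)"
    unfolding ev_window_def indicator_def by measurable
  show "(\<lambda>\<omega>. f (mgp_flow n (t - ev_time \<omega> k) (post_state n x \<omega> k))) \<in> borel_measurable (driving n \<mu>)"
    by (intro measurable_compose[OF _ f] measurable_mgp_flow n measurable_post_state x borel_measurable_diff
        measurable_ev_time measurable_const) simp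
qed

lemma exp_clock_tail:
  assumes "0 < \<mu>" "0 \<le> t"
  shows "(\<integral>\<^sup>+h. indicator {t<..} h \<partial>exp_clock \<mu>) = ennreal (exp (- \<mu> * t))"
proof -
  interpret E: prob_space "exp_measure \<mu>" by (rule prob_space_exp_measure[OF assms(1)])
  let ?a = "\<integral>\<^sup>+h. indicator {..t} h \<partial>exp_measure \<mu>"
  have "(\<integral>\<^sup>+h. indicator {t<..} h \<partial>exp_measure \<mu>) + ?a = (\<integral>\<^sup>+h. indicator {t<..} h + indicator {..t} h \<partial>exp_measure \<mu>)"
    by (rule nn_integral_add[symmetric]) (rule measurable_exp_measure, simp)+
  also have "\<dots> = (\<integral>\<^sup>+h. 1 \<partial>exp_measure \<mu>)" by (intro nn_integral_cong) (auto split: split_indicator)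
  also have "\<dots> = ennreal (exp (- \<mu> * t)) * (\<integral>\<^sup>+a. 1 \<partial>exp_measure \<mu>) + (\<integral>\<^sup>+h. indicator {..t} h * 1 \<partial>exp_measure \<mu>)"
    by (rule exp_measure_memoryless[symmetric]) (use assms in auto)
  also have "\<dots> = ennreal (exp (- \<mu> * t)) + ?a" using E.emeasure_space_1 by simp
  finally have eq: "(\<integral>\<^sup>+h. indicator {t<..} h \<partial>exp_measure \<mu>) + ?a = ennreal (exp (- \<mu> * t)) + ?a" .
  have "?a \<le> (\<integral>\<^sup>+h. 1 \<partial>exp_measure \<mu>)" by (intro nn_integral_mono) (auto split: split_indicator)
  then have "?a \<noteq> \<top>" using E.emeasure_space_1 by (auto simp: top_unique)
  then have "(\<integral>\<^sup>+h. indicator {t<..} h \<partial>exp_measure \<mu>) = ennreal (exp (- \<mu> * t))"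
    using eq by (simp add: ennreal_add_left_cancel add.commute[of _ ?a])
  moreover have "(\<integral>\<^sup>+h. indicator {t<..} h \<partial>exp_clock \<mu>) = (\<integral>\<^sup>+h. indicator {t<..} h \<partial>exp_measure \<mu>)"
    by (rule nn_integral_exponential_density) (use assms in auto)
  ultimately show ?thesis by (rule trans[rotated])
qed

lemma nn_integral_window:
  assumes n: "n \<ge> 2" "0 < \<mu>" and f: "f \<in> borel_measurable (big_space n)" and x: "x \<in> space (big_space n)"
  shows "(\<integral>\<^sup>+\<omega>. indicator (ev_window k t) \<omega> * f (mgp_flow n (t - ev_time \<omega> k) (post_state n x \<omega> k)) \<partial>driving n \<mu>)
    = mgp_term n \<mu> k t f x"
  using x
proof (induction k arbitrary: t x)
  case 0
  interpret M: prob_space "mark_measure n \<mu>" by (rule prob_space_mark_measure[OF n(2)])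
  interpret D: prob_space "driving n \<mu>" by (rule prob_space_driving[OF n(2)])
  let ?F = "f (mgp_flow n t x)"
  note m = measurable_window_state[OF n(1) f 0, of 0 t \<mu>, unfolded driving_def]
  have m1: "(\<lambda>a. indicator {0..} t * ?F * indicator {t<..} (fst a)) \<in> borel_measurable (mark_measure n \<mu>)"
  proof -
    have "indicator {t<..} \<in> borel_measurable (exp_clock \<mu>)" by simp
    from measurable_compose[OF measurable_fst this] show ?thesis by (intro borel_measurable_times_ennreal) auto
  qed
  have "(\<integral>\<^sup>+\<omega>. indicator (ev_window 0 t) \<omega> * f (mgp_flow n (t - ev_time \<omega> 0) (post_state n x \<omega> 0)) \<partial>driving n \<mu>)
     = (\<integral>\<^sup>+a. \<integral>\<^sup>+\<omega>. indicator (ev_window 0 t) (a ## \<omega>) * f (mgp_flow n (t - ev_time (a ## \<omega>) 0) (post_state n x (a ## \<omega>) 0))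
         \<partial>driving n \<mu> \<partial>mark_measure n \<mu>)"
    using M.nn_integral_stream_space[OF m] unfolding driving_def .
  also have "\<dots> = (\<integral>\<^sup>+a. \<integral>\<^sup>+\<omega>. indicator {0..} t * ?F * indicator {t<..} (fst a) \<partial>driving n \<mu> \<partial>mark_measure n \<mu>)"
    by (intro nn_integral_cong) (auto simp: ev_window_def ev_time_def split: split_indicator)
  also have "\<dots> = (\<integral>\<^sup>+a. indicator {0..} t * ?F * indicator {t<..} (fst a) \<partial>mark_measure n \<mu>)"
    using D.emeasure_space_1 by simp
  also have "\<dots> = (\<integral>\<^sup>+h. \<integral>\<^sup>+p. indicator {0..} t * ?F * indicator {t<..} h \<partial>measure_pmf (pmf_of_set (moran_pairs n)) \<partial>exp_clock \<mu>)"
    by (subst nn_integral_mark_measure[OF n m1]) simp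
  also have "\<dots> = (\<integral>\<^sup>+h. indicator {0..} t * ?F * indicator {t<..} h \<partial>exp_clock \<mu>)" by simp
  also have "\<dots> = indicator {0..} t * ?F * (\<integral>\<^sup>+h. indicator {t<..} h \<partial>exp_clock \<mu>)"
    by (rule nn_integral_cmult) simp
  also have "\<dots> = mgp_term n \<mu> 0 t f x"
    using exp_clock_tail[OF n(2), of t] by (auto split: split_indicator simp: mult.commute)
  finally show ?case .
next
  case (Suc k)
  interpret M: prob_space "mark_measure n \<mu>" by (rule prob_space_mark_measure[OF n(2)])
  note m = measurable_window_state[OF n(1) f Suc.prems, of "Suc k" t \<mu>, unfolded driving_def]
  note inS = moran_jump_flow_big[OF n(1) Suc.prems]
  have mt: "(\<lambda>a. mgp_term n \<mu> k (t - fst a) f (moran_jump n (snd a) (mgp_flow n (fst a) x))) \<in> borel_measurable (mark_measure n \<mu>)"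
  proof -
    have id: "(\<lambda>x. x) \<in> exp_clock \<mu> \<rightarrow>\<^sub>M borel" by simp
    have idp: "(\<lambda>x. x) \<in> measure_pmf (pmf_of_set (moran_pairs n)) \<rightarrow>\<^sub>M count_space UNIV" by simp
    have "(\<lambda>a. mgp_term n \<mu> k (t - fst a) f (moran_jump n p (mgp_flow n (fst a) x))) \<in> borel_measurable (mark_measure n \<mu>)" for p
      using Suc.prems
      by (intro measurable_mgp_term_fixed[OF n f] borel_measurable_diff measurable_const measurable_compose[OF measurable_fst id]
          measurable_compose[OF _ measurable_moran_jump] measurable_mgp_flow n) auto
    from measurable_compose_countable[OF this measurable_compose[OF measurable_snd idp]] show ?thesis .
  qed
  have "(\<integral>\<^sup>+\<omega>. indicator (ev_window (Suc k) t) \<omega> * f (mgp_flow n (t - ev_time \<omega> (Suc k)) (post_state n x \<omega> (Suc k))) \<partial>driving n \<mu>)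
     = (\<integral>\<^sup>+a. \<integral>\<^sup>+\<omega>. indicator (ev_window (Suc k) t) (a ## \<omega>) * f (mgp_flow n (t - ev_time (a ## \<omega>) (Suc k)) (post_state n x (a ## \<omega>) (Suc k)))
         \<partial>driving n \<mu> \<partial>mark_measure n \<mu>)"
    using M.nn_integral_stream_space[OF m] unfolding driving_def .
  also have "\<dots> = (\<integral>\<^sup>+a. \<integral>\<^sup>+\<omega>. indicator (ev_window k (t - fst a)) \<omega> * f (mgp_flow n ((t - fst a) - ev_time \<omega> k)
        (post_state n (moran_jump n (snd a) (mgp_flow n (fst a) x)) \<omega> k)) \<partial>driving n \<mu> \<partial>mark_measure n \<mu>)"
  proof (intro nn_integral_cong)
    fix a \<omega>
    have "indicator (ev_window (Suc k) t) (a ## \<omega>) = (indicator (ev_window k (t - fst a)) \<omega> :: ennreal)"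
      using ev_window_Stream[of a \<omega> k t] by (auto split: split_indicator)
    then show "indicator (ev_window (Suc k) t) (a ## \<omega>) * f (mgp_flow n (t - ev_time (a ## \<omega>) (Suc k)) (post_state n x (a ## \<omega>) (Suc k)))
       = indicator (ev_window k (t - fst a)) \<omega> * f (mgp_flow n ((t - fst a) - ev_time \<omega> k)
        (post_state n (moran_jump n (snd a) (mgp_flow n (fst a) x)) \<omega> k))"
      unfolding post_state_Stream ev_time_Stream by (simp add: diff_diff_eq)
  qed
  also have "\<dots> = (\<integral>\<^sup>+a. mgp_term n \<mu> k (t - fst a) f (moran_jump n (snd a) (mgp_flow n (fst a) x)) \<partial>mark_measure n \<mu>)"
    unfolding Suc.IH[OF inS] ..
  also have "\<dots> = (\<integral>\<^sup>+h. \<integral>\<^sup>+p. mgp_term n \<mu> k (t - h) f (moran_jump n p (mgp_flow n h x))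
       \<partial>measure_pmf (pmf_of_set (moran_pairs n)) \<partial>exp_clock \<mu>)"
    by (subst nn_integral_mark_measure[OF n mt]) simp
  also have "\<dots> = mgp_term n \<mu> (Suc k) t f x"
    unfolding nn_integral_moran_pmf[OF n(1), of "mgp_term n \<mu> k _ f"] by simp
  finally show ?case .
qed

lemma ev_time_mono:
  assumes "\<And>i. 0 \<le> fst (\<omega> !! i)" "j \<le> k"
  shows "ev_time \<omega> j \<le> ev_time \<omega> k"
  unfolding ev_time_def using assms by (intro sum_mono2) auto

lemma ev_window_unique:
  assumes "\<And>i. 0 \<le> fst (\<omega> !! i)" "\<omega> \<in> ev_window k t"
  shows "n_events \<omega> t = k" "\<And>j. \<omega> \<in> ev_window j t \<Longrightarrow> j = k"
proof -
  have w: "ev_time \<omega> k \<le> t" "t < ev_time \<omega> (Suc k)" using assms(2) unfolding ev_window_def by auto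
  have iff: "ev_time \<omega> j \<le> t \<longleftrightarrow> j \<le> k" for j
  proof
    assume j: "ev_time \<omega> j \<le> t"
    show "j \<le> k"
    proof (rule ccontr)
      assume "\<not> j \<le> k"
      then have "ev_time \<omega> (Suc k) \<le> ev_time \<omega> j" by (intro ev_time_mono[OF assms(1)]) simp
      then show False using w(2) j by linarith
    qed
  next
    assume "j \<le> k" then show "ev_time \<omega> j \<le> t" using w(1) ev_time_mono[OF assms(1), of j k] by simp
  qed
  have "{j. 0 < j \<and> ev_time \<omega> j \<le> t} = {1..k}" unfolding iff by auto
  then show "n_events \<omega> t = k" unfolding n_events_def by simp
  show "j = k" if "\<omega> \<in> ev_window j t" for j
    using that iff[of j] iff[of "Suc j"] unfolding ev_window_def by auto
qed

lemma sets_ev_window: "ev_window k t \<inter> space (driving n \<mu>) \<in> sets (driving n \<mu>)"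
proof -
  have "{\<omega> \<in> space (driving n \<mu>). ev_time \<omega> k \<le> t \<and> t < ev_time \<omega> (Suc k)} \<in> sets (driving n \<mu>)" by measurable
  moreover have "{\<omega> \<in> space (driving n \<mu>). ev_time \<omega> k \<le> t \<and> t < ev_time \<omega> (Suc k)} = ev_window k t \<inter> space (driving n \<mu>)"
    unfolding ev_window_def by auto
  ultimately show ?thesis by simp
qed

lemma AE_driving_nonneg:
  assumes "0 < \<mu>"
  shows "AE \<omega> in driving n \<mu>. \<forall>i. 0 \<le> fst (\<omega> !! i)"
proof -
  interpret E: prob_space "exp_clock \<mu>" by (rule prob_space_exponential_density[OF assms])
  interpret P: pair_prob_space "exp_clock \<mu>" "measure_pmf (pmf_of_set (moran_pairs n))" ..
  have p: "Measurable.pred (mark_measure n \<mu>) (\<lambda>a. 0 \<le> fst a)"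
  proof -
    have "Measurable.pred (exp_clock \<mu>) (\<lambda>h. 0 \<le> h)" by simp
    from measurable_compose[OF measurable_fst this] show ?thesis .
  qed
  have "AE a in mark_measure n \<mu>. 0 \<le> fst a"
  proof (rule P.AE_pair_measure)
    show "{a \<in> space (mark_measure n \<mu>). 0 \<le> fst a} \<in> sets (mark_measure n \<mu>)" using p by simp
    show "AE h in exp_clock \<mu>. AE q in measure_pmf (pmf_of_set (moran_pairs n)). 0 \<le> fst (h, q)"
      using AE_exp_clock_nonneg[of \<mu>] by eventually_elim simp
  qed
  from prob_space.AE_stream_all[OF prob_space_mark_measure[OF assms] p this]
  show ?thesis unfolding driving_def by (simp add: stream_all_def sset_range)
qed

lemma AE_ev_window:
  assumes n: "n \<ge> 2" "0 < \<mu>" and t: "0 \<le> t"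
  shows "AE \<omega> in driving n \<mu>. (\<forall>i. 0 \<le> fst (\<omega> !! i)) \<and> (\<exists>k. \<omega> \<in> ev_window k t)"
proof -
  let ?D = "driving n \<mu>"
  interpret D: prob_space ?D by (rule prob_space_driving[OF n(2)])
  let ?G = "{\<omega> \<in> space ?D. \<forall>i. 0 \<le> fst (\<omega> !! i)}"
  define A where "A k = ev_window k t \<inter> ?G" for k
  have G: "?G \<in> sets ?D"
    using measurable_mark_time[of _ n \<mu>] by measurable
  have A: "A k \<in> sets ?D" for k
  proof -
    have "A k = (ev_window k t \<inter> space ?D) \<inter> ?G" unfolding A_def by auto
    then show ?thesis using sets.Int[OF sets_ev_window G] by (simp only:)
  qed
  obtain x :: "(nat \<Rightarrow> nat set set) \<times> (nat \<Rightarrow> real)" where x: "x \<in> space (big_space n)"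
  proof -
    have "(\<lambda>_. {}, \<lambda>j. undefined) \<in> space (big_space n)"
      unfolding big_space_def by (auto simp: space_pair_measure space_PiM PiE_def extensional_def)
    then show ?thesis using that by blast
  qed
  have em: "emeasure ?D (A k) = mgp_term n \<mu> k t (\<lambda>_. 1) x" for k
  proof -
    have "emeasure ?D (A k) = emeasure ?D (ev_window k t \<inter> space ?D)"
    proof (rule emeasure_eq_AE)
      show "AE \<omega> in ?D. (\<omega> \<in> A k) = (\<omega> \<in> ev_window k t \<inter> space ?D)"
        using AE_driving_nonneg[OF n(2), of n] AE_space by eventually_elim (auto simp: A_def)
    qed (use A sets_ev_window in auto)
    also have "\<dots> = (\<integral>\<^sup>+\<omega>. indicator (ev_window k t \<inter> space ?D) \<omega> \<partial>?D)"
      using sets_ev_window by (rule nn_integral_indicator[symmetric])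
    also have "\<dots> = (\<integral>\<^sup>+\<omega>. indicator (ev_window k t) \<omega> * (\<lambda>_. 1) (mgp_flow n (t - ev_time \<omega> k) (post_state n x \<omega> k)) \<partial>?D)"
      by (intro nn_integral_cong) (auto split: split_indicator)
    also have "\<dots> = mgp_term n \<mu> k t (\<lambda>_. 1) x" by (rule nn_integral_window[OF n _ x]) simp
    finally show ?thesis .
  qed
  have disj: "disjoint_family A"
    unfolding disjoint_family_on_def A_def using ev_window_unique(2) by blast
  have "emeasure ?D (\<Union>k. A k) = (\<Sum>k. emeasure ?D (A k))"
    using A by (intro suminf_emeasure[symmetric] disj) auto
  also have "\<dots> = 1" unfolding em by (rule suminf_mgp_term_one[OF n t])
  finally have "D.prob (\<Union>k. A k) = 1" by (simp add: D.emeasure_eq_measure)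
  from D.AE_prob_1[OF this] show ?thesis by eventually_elim (auto simp: A_def)
qed

lemma measurable_mgp:
  assumes n: "n \<ge> 2" and x: "x \<in> space (big_space n)"
  shows "(\<lambda>\<omega>. mgp n x \<omega> t) \<in> driving n \<mu> \<rightarrow>\<^sub>M big_space n"
proof -
  have N: "(\<lambda>\<omega>. n_events \<omega> t) \<in> driving n \<mu> \<rightarrow>\<^sub>M count_space UNIV"
    unfolding n_events_def
  proof (rule measurable_card)
    fix k
    show "{\<omega> \<in> space (driving n \<mu>). k \<in> {k. 0 < k \<and> ev_time \<omega> k \<le> t}} \<in> sets (driving n \<mu>)"
      by (simp only: mem_Collect_eq) measurable
  qed
  have "(\<lambda>\<omega>. mgp_flow n (t - ev_time \<omega> k) (post_state n x \<omega> k)) \<in> driving n \<mu> \<rightarrow>\<^sub>M big_space n" for k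
    by (intro measurable_mgp_flow n measurable_post_state x borel_measurable_diff measurable_ev_time measurable_const) simp
  from measurable_compose_countable[OF this N] show ?thesis unfolding mgp_def Let_def .
qed

lemma nn_integral_mgp:
  assumes n: "n \<ge> 2" "0 < \<mu>" and f: "f \<in> borel_measurable (big_space n)" and x: "x \<in> space (big_space n)"
    and t: "0 \<le> t"
  shows "(\<integral>\<^sup>+\<omega>. f (mgp n x \<omega> t) \<partial>driving n \<mu>) = (\<Sum>k. mgp_term n \<mu> k t f x)"
proof -
  let ?g = "\<lambda>k \<omega>. indicator (ev_window k t) \<omega> * f (mgp_flow n (t - ev_time \<omega> k) (post_state n x \<omega> k))"
  have "(\<integral>\<^sup>+\<omega>. f (mgp n x \<omega> t) \<partial>driving n \<mu>) = (\<integral>\<^sup>+\<omega>. (\<Sum>k. ?g k \<omega>) \<partial>driving n \<mu>)"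
  proof (rule nn_integral_cong_AE)
    show "AE \<omega> in driving n \<mu>. f (mgp n x \<omega> t) = (\<Sum>k. ?g k \<omega>)"
      using AE_ev_window[OF n t]
    proof eventually_elim
      case (elim \<omega>)
      then obtain k where nn: "\<And>i. 0 \<le> fst (\<omega> !! i)" and k: "\<omega> \<in> ev_window k t" by auto
      have "?g j \<omega> = 0" if "j \<noteq> k" for j using ev_window_unique(2)[OF nn k, of j] that by (auto simp: indicator_def)
      then have "(\<Sum>j. ?g j \<omega>) = (\<Sum>j\<in>{k}. ?g j \<omega>)" by (intro suminf_finite) auto
      also have "\<dots> = f (mgp n x \<omega> t)"
        using k ev_window_unique(1)[OF nn k] unfolding mgp_def by simp
      finally show ?case by simp
    qed
  qed
  also have "\<dots> = (\<Sum>k. \<integral>\<^sup>+\<omega>. ?g k \<omega> \<partial>driving n \<mu>)"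
    by (rule nn_integral_suminf) (rule measurable_window_state[OF n(1) f x])
  also have "\<dots> = (\<Sum>k. mgp_term n \<mu> k t f x)" unfolding nn_integral_window[OF n f x] ..
  finally show ?thesis .
qed

subsection \<open>Invariance and ergodicity\<close>

definition clamp_state :: "nat \<Rightarrow> (nat \<Rightarrow> nat set set) \<times> (nat \<Rightarrow> real) \<Rightarrow> (nat \<Rightarrow> nat set set) \<times> (nat \<Rightarrow> real)" where
  "clamp_state n x = (if fst x \<in> ranked_trees n then fst x else (SOME B. B \<in> ranked_trees n),
     restrict (\<lambda>j. max 0 (snd x j)) {1..<n})"

lemma ranked_trees_nonempty: "n \<ge> 1 \<Longrightarrow> ranked_trees n \<noteq> {}"
proof -
  assume "n \<ge> 1"
  then have "card (ranked_trees n) > 0"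
    unfolding card_ranked_trees(2)[OF \<open>n \<ge> 1\<close>] by (intro prod_pos) (auto simp: zero_less_binomial_iff)
  then show ?thesis by auto
qed

lemma clamp_state_in:
  assumes "n \<ge> 2"
  shows "clamp_state n x \<in> state_set n"
proof -
  have "(SOME B. B \<in> ranked_trees n) \<in> ranked_trees n"
    using ranked_trees_nonempty[of n] assms by (simp add: some_in_eq)
  then show ?thesis unfolding clamp_state_def state_set_def by auto
qed

lemma clamp_state_id:
  assumes "x \<in> state_set n"
  shows "clamp_state n x = x"
proof (rule prod_eqI)
  have x: "fst x \<in> ranked_trees n" "snd x \<in> {1..<n} \<rightarrow>\<^sub>E {0..}" using assms unfolding state_set_def by auto
  show "fst (clamp_state n x) = fst x" using x unfolding clamp_state_def by simp
  have "restrict (\<lambda>j. max 0 (snd x j)) {1..<n} = restrict (snd x) {1..<n}"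
    using x(2) by (intro restrict_ext) (auto simp: PiE_iff max_def)
  also have "\<dots> = snd x" using x(2) by (rule PiE_restrict)
  finally show "snd (clamp_state n x) = snd x" unfolding clamp_state_def by simp
qed

lemma measurable_clamp_state:
  assumes "n \<ge> 2"
  shows "clamp_state n \<in> big_space n \<rightarrow>\<^sub>M state_space n"
proof -
  have W: "(SOME B. B \<in> ranked_trees n) \<in> ranked_trees n"
    using ranked_trees_nonempty[of n] assms by (simp add: some_in_eq)
  have 1: "(\<lambda>x. if fst x \<in> ranked_trees n then fst x else (SOME B. B \<in> ranked_trees n)) \<in> big_space n \<rightarrow>\<^sub>M count_space (ranked_trees n)"
    unfolding big_space_def using W by (intro measurable_compose[OF measurable_fst]) auto
  have "(\<lambda>s. restrict (\<lambda>j. max 0 (s j)) {1..<n}) \<in> (\<Pi>\<^sub>M j\<in>{1..<n}. borel) \<rightarrow>\<^sub>M (\<Pi>\<^sub>M j\<in>{1..<n}. half_lborel)"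
  proof (rule measurable_restrict)
    fix j assume j: "j \<in> {1..<n}"
    have "(\<lambda>x::real. max 0 x) \<in> borel \<rightarrow>\<^sub>M restrict_space borel {0..}" by (intro measurable_restrict_space2) auto
    then have "(\<lambda>x::real. max 0 x) \<in> borel \<rightarrow>\<^sub>M half_lborel"
      using measurable_cong_sets[OF refl sets_half_lborel] by blast
    from measurable_compose[OF measurable_component_singleton[OF j] this]
    show "(\<lambda>s. max 0 (s j)) \<in> (\<Pi>\<^sub>M j\<in>{1..<n}. borel) \<rightarrow>\<^sub>M half_lborel" by simp
  qed
  from measurable_compose[OF measurable_snd this]
  have 2: "(\<lambda>x. restrict (\<lambda>j. max 0 (snd x j)) {1..<n}) \<in> big_space n \<rightarrow>\<^sub>M (\<Pi>\<^sub>M j\<in>{1..<n}. half_lborel)"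
    unfolding big_space_def .
  from measurable_Pair[OF 1 2] show ?thesis unfolding clamp_state_def state_space_half .
qed

lemma sets_state_set: "state_set n \<in> sets (big_space n)"
  unfolding state_set_def big_space_def
  by (intro pair_measureI sets_PiM_I_finite) auto

lemma state_set_big: "x \<in> state_set n \<Longrightarrow> x \<in> space (big_space n)"
  using sets.sets_into_space[OF sets_state_set] by blast

lemma AE_mgp_state_set:
  assumes n: "n \<ge> 2" "0 < \<mu>" and x: "x \<in> state_set n" and t: "0 \<le> t"
  shows "AE \<omega> in driving n \<mu>. mgp n x \<omega> t \<in> state_set n"
proof -
  let ?D = "driving n \<mu>"
  interpret D: prob_space ?D by (rule prob_space_driving[OF n(2)])
  let ?A = "(\<lambda>\<omega>. mgp n x \<omega> t) -` state_set n \<inter> space ?D"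
  have A: "?A \<in> sets ?D"
    using measurable_sets[OF measurable_mgp[OF n(1) state_set_big[OF x]] sets_state_set] .
  have "emeasure ?D ?A = (\<integral>\<^sup>+\<omega>. indicator ?A \<omega> \<partial>?D)" using A by simp
  also have "\<dots> = (\<integral>\<^sup>+\<omega>. indicator (state_set n) (mgp n x \<omega> t) \<partial>?D)"
    by (intro nn_integral_cong) (auto split: split_indicator)
  also have "\<dots> = (\<Sum>k. mgp_term n \<mu> k t (indicator (state_set n)) x)"
    using sets_state_set by (intro nn_integral_mgp n state_set_big x t) simp
  also have "\<dots> = (\<Sum>k. mgp_term n \<mu> k t (\<lambda>_. 1) x)"
    using mgp_term_cong[OF n(1) _ x, of "indicator (state_set n)" "\<lambda>_. 1" \<mu> _ t] by simp
  also have "\<dots> = 1"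
    by (rule suminf_mgp_term_one[OF n t])
  finally have "D.prob ?A = 1" by (simp add: D.emeasure_eq_measure)
  from D.AE_prob_1[OF this] show ?thesis by eventually_elim auto
qed

text \<open>On a null set of noise \<open>mgp\<close> leaves the state space, so the map in \<open>mgp_kernel_def\<close> is not
  measurable into \<open>state_space\<close>; clamping it does not change the law.\<close>

lemma mgp_kernel_clamp:
  assumes n: "n \<ge> 2" "0 < \<mu>" and x: "x \<in> state_set n" and t: "0 \<le> t"
  shows "mgp_kernel n \<mu> t x = distr (driving n \<mu>) (state_space n) (\<lambda>\<omega>. clamp_state n (mgp n x \<omega> t))"
  unfolding mgp_kernel_def distr_def
proof (rule measure_of_eq)
  show "sets (state_space n) \<subseteq> Pow (space (state_space n))" by (rule sets.space_closed)
  fix A assume "A \<in> sigma_sets (space (state_space n)) (sets (state_space n))"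
  then have A: "A \<in> sets (state_space n)" by (simp add: sets.sigma_sets_eq)
  let ?D = "driving n \<mu>"
  note m = measurable_mgp[OF n(1) state_set_big[OF x], of t \<mu>]
  have c: "(\<lambda>\<omega>. clamp_state n (mgp n x \<omega> t)) -` A \<inter> space ?D \<in> sets ?D"
    by (rule measurable_sets[OF measurable_compose[OF m measurable_clamp_state[OF n(1)]] A])
  have sub: "A \<subseteq> state_set n" using sets.sets_into_space[OF A] space_state_space by simp
  have "(\<lambda>\<omega>. mgp n x \<omega> t) -` A \<inter> space ?D
     = ((\<lambda>\<omega>. clamp_state n (mgp n x \<omega> t)) -` A \<inter> space ?D) \<inter> ((\<lambda>\<omega>. mgp n x \<omega> t) -` state_set n \<inter> space ?D)"
    using sub clamp_state_id by auto
  then have d: "(\<lambda>\<omega>. mgp n x \<omega> t) -` A \<inter> space ?D \<in> sets ?D"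
    using sets.Int[OF c measurable_sets[OF m sets_state_set]] by (simp only:)
  show "emeasure ?D ((\<lambda>\<omega>. mgp n x \<omega> t) -` A \<inter> space ?D)
     = emeasure ?D ((\<lambda>\<omega>. clamp_state n (mgp n x \<omega> t)) -` A \<inter> space ?D)"
  proof (rule emeasure_eq_AE[OF _ d c])
    show "AE \<omega> in ?D. (\<omega> \<in> (\<lambda>\<omega>. mgp n x \<omega> t) -` A \<inter> space ?D)
        = (\<omega> \<in> (\<lambda>\<omega>. clamp_state n (mgp n x \<omega> t)) -` A \<inter> space ?D)"
      using AE_mgp_state_set[OF n x t] by eventually_elim (simp add: clamp_state_id)
  qed
qed

lemma nn_integral_mgp_kernel:
  assumes n: "n \<ge> 2" "0 < \<mu>" and x: "x \<in> state_set n" and t: "0 \<le> t"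
    and g: "g \<in> borel_measurable (state_space n)"
  shows "(\<integral>\<^sup>+y. g y \<partial>mgp_kernel n \<mu> t x) = (\<Sum>k. mgp_term n \<mu> k t (\<lambda>y. g (clamp_state n y)) x)"
proof -
  have "(\<integral>\<^sup>+y. g y \<partial>mgp_kernel n \<mu> t x) = (\<integral>\<^sup>+\<omega>. g (clamp_state n (mgp n x \<omega> t)) \<partial>driving n \<mu>)"
    unfolding mgp_kernel_clamp[OF n x t]
    using g by (intro nn_integral_distr measurable_compose[OF measurable_mgp measurable_clamp_state] n state_set_big x) simp
  also have "\<dots> = (\<Sum>k. mgp_term n \<mu> k t (\<lambda>y. g (clamp_state n y)) x)"
    by (rule nn_integral_mgp[OF n measurable_compose[OF measurable_clamp_state[OF n(1)] g] state_set_big[OF x] t])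
  finally show ?thesis .
qed

lemma sets_mgp_kernel: "sets (mgp_kernel n \<mu> t x) = sets (state_space n)"
  unfolding mgp_kernel_def by simp

lemma prob_space_mgp_kernel:
  assumes n: "n \<ge> 2" "0 < \<mu>" and x: "x \<in> state_set n" and t: "0 \<le> t"
  shows "prob_space (mgp_kernel n \<mu> t x)"
  unfolding mgp_kernel_clamp[OF n x t]
  by (rule prob_space.prob_space_distr[OF prob_space_driving[OF n(2)]
        measurable_compose[OF measurable_mgp[OF n(1) state_set_big[OF x]] measurable_clamp_state[OF n(1)]]])

lemma measurable_suminf_mgp_term:
  assumes n: "n \<ge> 2" "0 < \<mu>" and g: "g \<in> borel_measurable (state_space n)"
  shows "(\<lambda>x. \<Sum>k. mgp_term n \<mu> k t (\<lambda>y. g (clamp_state n y)) x) \<in> borel_measurable (state_space n)"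
  by (intro borel_measurable_suminf_order measurable_mgp_term_fixed n
      measurable_compose[OF measurable_clamp_state[OF n(1)] g] measurable_state_big) simp

lemma measurable_mgp_kernel:
  assumes n: "n \<ge> 2" "0 < \<mu>" and t: "0 \<le> t"
  shows "mgp_kernel n \<mu> t \<in> state_space n \<rightarrow>\<^sub>M subprob_algebra (state_space n)"
proof (rule measurable_subprob_algebra)
  fix x assume "x \<in> space (state_space n)"
  then have x: "x \<in> state_set n" using space_state_space by simp
  show "subprob_space (mgp_kernel n \<mu> t x)"
    by (rule prob_space_imp_subprob_space[OF prob_space_mgp_kernel[OF n x t]])
  show "sets (mgp_kernel n \<mu> t x) = sets (state_space n)" by (rule sets_mgp_kernel)
next
  fix A assume A: "A \<in> sets (state_space n)"
  have "emeasure (mgp_kernel n \<mu> t x) A = (\<Sum>k. mgp_term n \<mu> k t (\<lambda>y. indicator A (clamp_state n y)) x)"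
    if "x \<in> space (state_space n)" for x
  proof -
    have x: "x \<in> state_set n" using that space_state_space by simp
    have "emeasure (mgp_kernel n \<mu> t x) A = (\<integral>\<^sup>+y. indicator A y \<partial>mgp_kernel n \<mu> t x)"
      using A sets_mgp_kernel by simp
    also have "\<dots> = (\<Sum>k. mgp_term n \<mu> k t (\<lambda>y. indicator A (clamp_state n y)) x)"
      using A by (intro nn_integral_mgp_kernel n x t) simp
    finally show ?thesis .
  qed
  then show "(\<lambda>x. emeasure (mgp_kernel n \<mu> t x) A) \<in> borel_measurable (state_space n)"
    using measurable_suminf_mgp_term[OF n, of "indicator A" t] A by (subst measurable_cong) auto
qed

lemma mgp_evolve_props:
  assumes n: "n \<ge> 2" "0 < \<mu>" and t: "0 \<le> t" and \<nu>: "prob_space \<nu>" "sets \<nu> = sets (state_space n)"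
  shows "sets (mgp_evolve n \<mu> \<nu> t) = sets (state_space n)" "prob_space (mgp_evolve n \<mu> \<nu> t)"
    "g \<in> borel_measurable (state_space n) \<Longrightarrow> (\<integral>\<^sup>+y. g y \<partial>mgp_evolve n \<mu> \<nu> t)
       = (\<integral>\<^sup>+x. (\<Sum>k. mgp_term n \<mu> k t (\<lambda>y. g (clamp_state n y)) x) \<partial>\<nu>)"
proof -
  have K: "mgp_kernel n \<mu> t \<in> \<nu> \<rightarrow>\<^sub>M subprob_algebra (state_space n)"
    using measurable_mgp_kernel[OF n t] measurable_cong_sets[OF \<nu>(2) refl] by blast
  have sp: "space \<nu> = state_set n" using sets_eq_imp_space_eq[OF \<nu>(2)] space_state_space by simp
  have ne: "space \<nu> \<noteq> {}" by (rule prob_space.not_empty[OF \<nu>(1)])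
  show s: "sets (mgp_evolve n \<mu> \<nu> t) = sets (state_space n)"
    unfolding mgp_evolve_def by (rule sets_bind[OF sets_mgp_kernel ne])
  show int: "(\<integral>\<^sup>+y. g y \<partial>mgp_evolve n \<mu> \<nu> t)
       = (\<integral>\<^sup>+x. (\<Sum>k. mgp_term n \<mu> k t (\<lambda>y. g (clamp_state n y)) x) \<partial>\<nu>)"
    if g: "g \<in> borel_measurable (state_space n)" for g
  proof -
    have "(\<integral>\<^sup>+y. g y \<partial>mgp_evolve n \<mu> \<nu> t) = (\<integral>\<^sup>+x. \<integral>\<^sup>+y. g y \<partial>mgp_kernel n \<mu> t x \<partial>\<nu>)"
      unfolding mgp_evolve_def by (rule nn_integral_bind[OF g K])
    also have "\<dots> = (\<integral>\<^sup>+x. (\<Sum>k. mgp_term n \<mu> k t (\<lambda>y. g (clamp_state n y)) x) \<partial>\<nu>)"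
      using sp by (intro nn_integral_cong nn_integral_mgp_kernel n t g) simp
    finally show ?thesis .
  qed
  show "prob_space (mgp_evolve n \<mu> \<nu> t)"
  proof (rule prob_spaceI)
    interpret prob_space \<nu> by (rule \<nu>(1))
    have "emeasure (mgp_evolve n \<mu> \<nu> t) (space (mgp_evolve n \<mu> \<nu> t)) = (\<integral>\<^sup>+y. 1 \<partial>mgp_evolve n \<mu> \<nu> t)" by simp
    also have "\<dots> = (\<integral>\<^sup>+x. 1 \<partial>\<nu>)"
    proof -
      have "(\<integral>\<^sup>+y. 1 \<partial>mgp_evolve n \<mu> \<nu> t) = (\<integral>\<^sup>+x. (\<Sum>k. mgp_term n \<mu> k t (\<lambda>y. 1) x) \<partial>\<nu>)"
        by (rule int) simp
      then show ?thesis unfolding suminf_mgp_term_one[OF n t] .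
    qed
    also have "\<dots> = 1" using emeasure_space_1 by simp
    finally show "emeasure (mgp_evolve n \<mu> \<nu> t) (space (mgp_evolve n \<mu> \<nu> t)) = 1" .
  qed
qed

lemma prob_measure_eqI_le:
  assumes "prob_space M" "prob_space N" "sets M = sets N"
    and le: "\<And>A. A \<in> sets M \<Longrightarrow> emeasure M A \<le> emeasure N A"
  shows "M = N"
proof (rule measure_eqI[OF assms(3)])
  interpret M: prob_space M by fact
  interpret N: prob_space N by fact
  fix A assume A: "A \<in> sets M"
  have sp: "space M = space N" by (rule sets_eq_imp_space_eq[OF assms(3)])
  have le': "M.prob A \<le> N.prob A" if "A \<in> sets M" for A
    using le[OF that] by (simp add: M.emeasure_eq_measure N.emeasure_eq_measure)
  have "M.prob (space M - A) \<le> N.prob (space N - A)" using le'[OF sets.compl_sets[OF A]] sp by simp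
  then have "N.prob A \<le> M.prob A" using M.prob_compl[OF A] N.prob_compl[of A] A assms(3) by simp
  then show "emeasure M A = emeasure N A"
    using le'[OF A] by (simp add: M.emeasure_eq_measure N.emeasure_eq_measure)
qed

lemma mgp_stationary_invariant:
  assumes n: "n \<ge> 2" "0 < \<mu>" and t: "0 \<le> t"
  shows "mgp_evolve n \<mu> (mgp_stationary n \<mu>) t = mgp_stationary n \<mu>"
proof (rule prob_measure_eqI_le)
  let ?\<pi> = "mgp_stationary n \<mu>"
  note ev = mgp_evolve_props[OF n t prob_space_mgp_stationary[OF n] sets_mgp_stationary]
  show "prob_space (mgp_evolve n \<mu> ?\<pi> t)" by (rule ev(2))
  show "prob_space ?\<pi>" by (rule prob_space_mgp_stationary[OF n])
  show "sets (mgp_evolve n \<mu> ?\<pi> t) = sets ?\<pi>" using ev(1) sets_mgp_stationary by simp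
  fix A assume "A \<in> sets (mgp_evolve n \<mu> ?\<pi> t)"
  then have A: "A \<in> sets (state_space n)" using ev(1) by simp
  let ?g = "\<lambda>y. indicator A (clamp_state n y) :: ennreal"
  have gm: "?g \<in> borel_measurable (big_space n)"
    using A by (intro measurable_compose[OF measurable_clamp_state[OF n(1)]]) simp
  have "emeasure (mgp_evolve n \<mu> ?\<pi> t) A = (\<integral>\<^sup>+y. indicator A y \<partial>mgp_evolve n \<mu> ?\<pi> t)"
    using A ev(1) by simp
  also have "\<dots> = (\<integral>\<^sup>+x. (\<Sum>k. mgp_term n \<mu> k t ?g x) \<partial>?\<pi>)"
    using A by (intro ev(3)) simp
  also have "\<dots> = (\<Sum>k. \<integral>\<^sup>+x. mgp_term n \<mu> k t ?g x \<partial>?\<pi>)"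
  proof (rule nn_integral_suminf)
    fix k
    have "(\<lambda>x. mgp_term n \<mu> k t ?g x) \<in> borel_measurable (state_space n)"
      by (intro measurable_mgp_term_fixed n gm measurable_state_big) simp
    then show "(\<lambda>x. mgp_term n \<mu> k t ?g x) \<in> borel_measurable ?\<pi>"
      using measurable_cong_sets[OF sets_mgp_stationary refl] by blast
  qed
  also have "\<dots> \<le> (\<integral>\<^sup>+x. ?g x \<partial>?\<pi>)"
    by (intro suminf_le_const summableI sum_mgp_term_stationary_le n gm t)
  also have "\<dots> = (\<integral>\<^sup>+x. indicator A x \<partial>?\<pi>)"
  proof (rule nn_integral_cong)
    fix x assume "x \<in> space ?\<pi>"
    then have "x \<in> state_set n"
      using sets_eq_imp_space_eq[OF sets_mgp_stationary[of n \<mu>]] space_state_space by simp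
    then show "?g x = indicator A x" by (simp add: clamp_state_id)
  qed
  also have "\<dots> = emeasure ?\<pi> A" using A sets_mgp_stationary by simp
  finally show "emeasure (mgp_evolve n \<mu> ?\<pi> t) A \<le> emeasure ?\<pi> A" .
qed

lemma nn_integral_le_oscillation:
  assumes "prob_space M" "prob_space N" "space M = S" "space N = S"
    and m: "\<Phi> \<in> borel_measurable M" "\<Phi> \<in> borel_measurable N"
    and osc: "\<And>x y. x \<in> S \<Longrightarrow> y \<in> S \<Longrightarrow> \<Phi> x \<le> \<Phi> y + e"
  shows "(\<integral>\<^sup>+x. \<Phi> x \<partial>M) \<le> (\<integral>\<^sup>+y. \<Phi> y \<partial>N) + e"
proof -
  interpret M: prob_space M by fact
  interpret N: prob_space N by fact
  have 1: "(\<integral>\<^sup>+x. \<Phi> x \<partial>M) \<le> \<Phi> y + e" if "y \<in> S" for y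
  proof -
    have "(\<integral>\<^sup>+x. \<Phi> x \<partial>M) \<le> (\<integral>\<^sup>+x. \<Phi> y + e \<partial>M)"
      using osc that assms(3) by (intro nn_integral_mono) auto
    then show ?thesis using M.emeasure_space_1 by simp
  qed
  have "(\<integral>\<^sup>+x. \<Phi> x \<partial>M) = (\<integral>\<^sup>+y. (\<integral>\<^sup>+x. \<Phi> x \<partial>M) \<partial>N)" using N.emeasure_space_1 by simp
  also have "\<dots> \<le> (\<integral>\<^sup>+y. \<Phi> y + e \<partial>N)" using 1 assms(4) by (intro nn_integral_mono) auto
  also have "\<dots> = (\<integral>\<^sup>+y. \<Phi> y \<partial>N) + e" using m N.emeasure_space_1 by (subst nn_integral_add) auto
  finally show ?thesis .
qed

lemma mgp_evolve_contraction:
  assumes n: "n \<ge> 2" "0 < \<mu>" and t: "0 \<le> t" and \<nu>: "prob_space \<nu>" "sets \<nu> = sets (state_space n)"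
    and g: "g \<in> borel_measurable (state_space n)" "\<And>x. x \<in> state_set n \<Longrightarrow> g x \<le> 1"
  defines "e \<equiv> ennreal (2 * exp (- (1 - coupling_rate n) * \<mu> * t))"
  shows "(\<integral>\<^sup>+y. g y \<partial>mgp_evolve n \<mu> \<nu> t) \<le> (\<integral>\<^sup>+y. g y \<partial>mgp_stationary n \<mu>) + e"
    "(\<integral>\<^sup>+y. g y \<partial>mgp_stationary n \<mu>) \<le> (\<integral>\<^sup>+y. g y \<partial>mgp_evolve n \<mu> \<nu> t) + e"
proof -
  let ?\<pi> = "mgp_stationary n \<mu>"
  let ?\<Phi> = "\<lambda>x. \<Sum>k. mgp_term n \<mu> k t (\<lambda>y. g (clamp_state n y)) x"
  have \<pi>: "prob_space ?\<pi>" "sets ?\<pi> = sets (state_space n)"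
    by (rule prob_space_mgp_stationary[OF n], rule sets_mgp_stationary)
  have sp: "space \<nu> = state_set n" "space ?\<pi> = state_set n"
    using sets_eq_imp_space_eq[OF \<nu>(2)] sets_eq_imp_space_eq[OF \<pi>(2)] space_state_space by simp_all
  have m: "?\<Phi> \<in> borel_measurable \<nu>" "?\<Phi> \<in> borel_measurable ?\<pi>"
    using measurable_suminf_mgp_term[OF n g(1)] measurable_cong_sets[OF \<nu>(2) refl] measurable_cong_sets[OF \<pi>(2) refl]
    by blast+
  have osc: "?\<Phi> x \<le> ?\<Phi> y + e" if "x \<in> state_set n" "y \<in> state_set n" for x y
    unfolding e_def
    by (intro suminf_mgp_term_coupling n measurable_compose[OF measurable_clamp_state[OF n(1)] g(1)] g(2)
        clamp_state_in that t)
  have 1: "(\<integral>\<^sup>+y. g y \<partial>mgp_evolve n \<mu> \<nu> t) = (\<integral>\<^sup>+x. ?\<Phi> x \<partial>\<nu>)"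
    by (rule mgp_evolve_props(3)[OF n t \<nu> g(1)])
  have 2: "(\<integral>\<^sup>+y. g y \<partial>?\<pi>) = (\<integral>\<^sup>+x. ?\<Phi> x \<partial>?\<pi>)"
    using mgp_evolve_props(3)[OF n t \<pi> g(1)] unfolding mgp_stationary_invariant[OF n t] .
  show "(\<integral>\<^sup>+y. g y \<partial>mgp_evolve n \<mu> \<nu> t) \<le> (\<integral>\<^sup>+y. g y \<partial>?\<pi>) + e"
    unfolding 1 2 by (rule nn_integral_le_oscillation[OF \<nu>(1) \<pi>(1) sp m osc])
  show "(\<integral>\<^sup>+y. g y \<partial>?\<pi>) \<le> (\<integral>\<^sup>+y. g y \<partial>mgp_evolve n \<mu> \<nu> t) + e"
    unfolding 1 2 by (rule nn_integral_le_oscillation[OF \<pi>(1) \<nu>(1) sp(2,1) m(2,1) osc])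
qed

lemma tv_norm_diff_le:
  assumes M: "prob_space M" "sets M = sets S" and N: "prob_space N" "sets N = sets S" and e: "0 \<le> e"
    and le: "\<And>g. g \<in> borel_measurable S \<Longrightarrow> (\<And>x. x \<in> space S \<Longrightarrow> g x \<le> 1) \<Longrightarrow>
      (\<integral>\<^sup>+x. g x \<partial>M) \<le> (\<integral>\<^sup>+x. g x \<partial>N) + ennreal e \<and> (\<integral>\<^sup>+x. g x \<partial>N) \<le> (\<integral>\<^sup>+x. g x \<partial>M) + ennreal e"
  shows "tv_norm_diff S M N \<le> 2 * e"
  unfolding tv_norm_diff_def
proof (rule cSUP_least)
  show "{f \<in> borel_measurable S. \<forall>x\<in>space S. \<bar>f x\<bar> \<le> 1} \<noteq> ({} :: ('a \<Rightarrow> real) set)"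
    by (auto intro!: exI[of _ "\<lambda>_. 0"])
next
  fix f :: "'a \<Rightarrow> real" assume "f \<in> {f \<in> borel_measurable S. \<forall>x\<in>space S. \<bar>f x\<bar> \<le> 1}"
  then have f: "f \<in> borel_measurable S" "\<And>x. x \<in> space S \<Longrightarrow> \<bar>f x\<bar> \<le> 1" by auto
  let ?g = "\<lambda>x. ennreal ((f x + 1) / 2)"
  have key: "(\<integral>\<^sup>+x. ?g x \<partial>P) = ennreal (((\<integral>x. f x \<partial>P) + 1) / 2) \<and> 0 \<le> ((\<integral>x. f x \<partial>P) + 1) / 2"
    if P: "prob_space P" "sets P = sets S" for P
  proof -
    interpret P: prob_space P by (rule P(1))
    have fm: "f \<in> borel_measurable P" using f(1) measurable_cong_sets[OF P(2) refl] by blast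
    have sp: "space P = space S" by (rule sets_eq_imp_space_eq[OF P(2)])
    have int: "integrable P f"
      using fm f(2) sp by (intro P.integrable_const_bound[of _ 1]) auto
    have nn: "0 \<le> (f x + 1) / 2" if "x \<in> space P" for x using f(2)[of x] that sp by auto
    have "(\<integral>\<^sup>+x. ?g x \<partial>P) = ennreal (\<integral>x. (f x + 1) / 2 \<partial>P)"
      using int nn by (intro nn_integral_eq_integral) auto
    moreover have "(\<integral>x. (f x + 1) / 2 \<partial>P) = ((\<integral>x. f x \<partial>P) + 1) / 2"
      using int by (simp add: P.prob_space)
    moreover have "0 \<le> (\<integral>x. (f x + 1) / 2 \<partial>P)" using nn by (intro integral_nonneg_AE) auto
    ultimately show ?thesis by simp
  qed
  have gm: "?g \<in> borel_measurable S" using f(1) by simp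
  have g1: "?g x \<le> 1" if "x \<in> space S" for x using f(2)[OF that] by (simp add: ennreal_le_1)
  let ?a = "((\<integral>x. f x \<partial>M) + 1) / 2" and ?b = "((\<integral>x. f x \<partial>N) + 1) / 2"
  have "ennreal ?a \<le> ennreal ?b + ennreal e" "ennreal ?b \<le> ennreal ?a + ennreal e"
    using le[OF gm g1] key[OF M] key[OF N] by auto
  then have "?a \<le> ?b + e" "?b \<le> ?a + e"
    using key[OF M] key[OF N] e by (auto simp del: ennreal_plus simp: ennreal_plus[symmetric])
  then show "\<bar>(\<integral>x. f x \<partial>M) - (\<integral>x. f x \<partial>N)\<bar> \<le> 2 * e" by (simp add: abs_le_iff field_simps)
qed

lemma mgp_stationary_unique:
  assumes n: "n \<ge> 2" "0 < \<mu>" and \<nu>: "prob_space \<nu>" "sets \<nu> = sets (state_space n)"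
    and inv: "\<And>t. 0 \<le> t \<Longrightarrow> mgp_evolve n \<mu> \<nu> t = \<nu>"
  shows "\<nu> = mgp_stationary n \<mu>"
proof (rule prob_measure_eqI_le)
  show "prob_space \<nu>" by (rule \<nu>(1))
  show "prob_space (mgp_stationary n \<mu>)" by (rule prob_space_mgp_stationary[OF n])
  show "sets \<nu> = sets (mgp_stationary n \<mu>)" using \<nu>(2) sets_mgp_stationary by simp
  fix A assume "A \<in> sets \<nu>"
  then have A: "A \<in> sets (state_space n)" using \<nu>(2) by simp
  let ?c = "(1 - coupling_rate n) * \<mu>"
  have c: "0 < ?c" using coupling_bounds(5)[OF n(1)] n(2) by simp
  show "emeasure \<nu> A \<le> emeasure (mgp_stationary n \<mu>) A"
  proof (rule ennreal_le_epsilon)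
    fix e :: real assume e: "0 < e"
    define t where "t = max 0 (ln (2 / e) / ?c)"
    have t: "0 \<le> t" unfolding t_def by simp
    have "ln (2 / e) \<le> ?c * t" using c unfolding t_def by (simp add: max_def field_simps)
    then have "exp (- ?c * t) \<le> exp (- ln (2 / e))" by simp
    also have "\<dots> = e / 2" using e by (simp add: exp_minus)
    finally have small: "2 * exp (- (1 - coupling_rate n) * \<mu> * t) \<le> e"
      by (simp only: mult_minus_left mult.assoc)
    have "emeasure \<nu> A = (\<integral>\<^sup>+y. indicator A y \<partial>mgp_evolve n \<mu> \<nu> t)" using A \<nu>(2) inv[OF t] by simp
    also have "\<dots> \<le> (\<integral>\<^sup>+y. indicator A y \<partial>mgp_stationary n \<mu>) + ennreal (2 * exp (- (1 - coupling_rate n) * \<mu> * t))"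
      using A by (intro mgp_evolve_contraction(1)[OF n t \<nu>]) (auto split: split_indicator)
    also have "\<dots> \<le> (\<integral>\<^sup>+y. indicator A y \<partial>mgp_stationary n \<mu>) + ennreal e"
      using small by (intro add_left_mono ennreal_leI)
    also have "(\<integral>\<^sup>+y. indicator A y \<partial>mgp_stationary n \<mu>) = emeasure (mgp_stationary n \<mu>) A"
      using A sets_mgp_stationary by simp
    finally show "emeasure \<nu> A \<le> emeasure (mgp_stationary n \<mu>) A + ennreal e" .
  qed
qed

lemma mgp_tv_decay:
  assumes n: "n \<ge> 2" "0 < \<mu>" and t: "0 \<le> t" and \<nu>: "prob_space \<nu>" "sets \<nu> = sets (state_space n)"
  shows "tv_norm_diff (state_space n) (mgp_evolve n \<mu> \<nu> t) (mgp_stationary n \<mu>)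
    < 5 * exp (- (1 - coupling_rate n) * \<mu>) powr t"
proof -
  let ?e = "2 * exp (- (1 - coupling_rate n) * \<mu> * t)"
  have "tv_norm_diff (state_space n) (mgp_evolve n \<mu> \<nu> t) (mgp_stationary n \<mu>) \<le> 2 * ?e"
    using mgp_evolve_contraction[OF n t \<nu>]
    by (intro tv_norm_diff_le mgp_evolve_props(1,2)[OF n t \<nu>] prob_space_mgp_stationary[OF n] sets_mgp_stationary)
      (auto simp: space_state_space)
  also have "\<dots> < 5 * exp (- (1 - coupling_rate n) * \<mu> * t)" by simp
  also have "\<dots> = 5 * exp (- (1 - coupling_rate n) * \<mu>) powr t" by (simp add: exp_powr_real)
  finally show ?thesis .
qed

theorem theorem1:
  fixes n :: nat and \<mu> :: real
  assumes "n \<ge> 2" and "\<mu> > 0"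
  shows "prob_space (mgp_stationary n \<mu>)
    \<and> sets (mgp_stationary n \<mu>) = sets (state_space n)
    \<and> (\<forall>t\<ge>0. mgp_evolve n \<mu> (mgp_stationary n \<mu>) t = mgp_stationary n \<mu>)
    \<and> (\<forall>\<nu>. prob_space \<nu> \<and> sets \<nu> = sets (state_space n)
            \<and> (\<forall>t\<ge>0. mgp_evolve n \<mu> \<nu> t = \<nu>) \<longrightarrow> \<nu> = mgp_stationary n \<mu>)
    \<and> (\<exists>D::real. \<exists>\<rho>::real. 0 \<le> \<rho> \<and> \<rho> < 1 \<and>
        (\<forall>\<nu> t. prob_space \<nu> \<and> sets \<nu> = sets (state_space n) \<and> t \<ge> 0 \<longrightarrow>
           tv_norm_diff (state_space n) (mgp_evolve n \<mu> \<nu> t) (mgp_stationary n \<mu>) < D * \<rho> powr t))"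
proof (intro conjI)
  show "prob_space (mgp_stationary n \<mu>)" by (rule prob_space_mgp_stationary[OF assms])
  show "sets (mgp_stationary n \<mu>) = sets (state_space n)" by (rule sets_mgp_stationary)
  show "\<forall>t\<ge>0. mgp_evolve n \<mu> (mgp_stationary n \<mu>) t = mgp_stationary n \<mu>"
    using mgp_stationary_invariant[OF assms] by blast
  show "\<forall>\<nu>. prob_space \<nu> \<and> sets \<nu> = sets (state_space n)
            \<and> (\<forall>t\<ge>0. mgp_evolve n \<mu> \<nu> t = \<nu>) \<longrightarrow> \<nu> = mgp_stationary n \<mu>"
    using mgp_stationary_unique[OF assms] by blast
  let ?\<rho> = "exp (- (1 - coupling_rate n) * \<mu>)"
  have "0 < (1 - coupling_rate n) * \<mu>" using coupling_bounds(5)[OF assms(1)] assms(2) by simp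
  then have "?\<rho> < 1" unfolding mult_minus_left by (simp only: exp_less_one_iff neg_less_0_iff_less)
  moreover have "\<forall>\<nu> t. prob_space \<nu> \<and> sets \<nu> = sets (state_space n) \<and> t \<ge> 0 \<longrightarrow>
           tv_norm_diff (state_space n) (mgp_evolve n \<mu> \<nu> t) (mgp_stationary n \<mu>) < 5 * ?\<rho> powr t"
    using mgp_tv_decay[OF assms] by blast
  ultimately show "\<exists>D::real. \<exists>\<rho>::real. 0 \<le> \<rho> \<and> \<rho> < 1 \<and>
        (\<forall>\<nu> t. prob_space \<nu> \<and> sets \<nu> = sets (state_space n) \<and> t \<ge> 0 \<longrightarrow>
           tv_norm_diff (state_space n) (mgp_evolve n \<mu> \<nu> t) (mgp_stationary n \<mu>) < D * \<rho> powr t)"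
    by (intro exI[of _ 5] exI[of _ ?\<rho>]) auto
qed

end
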